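(* \textsc{Metric Dimension} and \textsc{Geodetic Set} each admit (i) an algorithm solving the problem in $2^{\mathcal{O}(\mathtt{vc}^2)} \cdot n^{\mathcal{O}(1)}$ time, and (ii) a polynomial-time kernelization algorithm that outputs an equivalent instance whose graph has $2^{\mathcal{O}(\mathtt{vc})}$ vertices, where $n$ is the number of vertices and $\mathtt{vc}$ is the vertex cover number of the input graph.
   Context: All graphs are finite, simple and undirected; $d(u,v)$ denotes the shortest-path distance. \textsc{Metric Dimension}: given a graph $G$ and a positive integer $k$, decide whether there is $S\subseteq V(G)$ with $|S|\le k$ such that for every pair of vertices $u,v\in V(G)$ there exists $w\in S$ with $d(w,u)\ne d(w,v)$ (a resolving set). \textsc{Geodetic Set}: given a graph $G$ and a positive integer $k$, decide whether there is $S\subseteq V(G)$ with $|S|\le k$ such that every vertex $u\in V(G)$ lies on some shortest path between two vertices $s_1,s_2\in S$ (a geodetic set). The vertex cover number $\mathtt{vc}(G)$ is the minimum size of a set $X\subseteq V(G)$ such that $V(G)\setminus X$ is an independent set. A kernelization algorithm is a polynomial-time algorithm that maps an instance $(G,k)$ to an equivalent instance $(G',k')$ (i.e., $(G,k)$ is a yes-instance iff $(G',k')$ is) whose size and $k'$ are bounded by a function of the parameter. *)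

theory Defs
  imports Complex_Main "HOL-Library.Extended_Nat" "HOL-Library.Landau_Symbols"
begin

section \<open>Graphs\<close>

definition simple_graph :: "'a set \<Rightarrow> 'a set set \<Rightarrow> bool" where
  "simple_graph V E \<longleftrightarrow> finite V \<and> (\<forall>e\<in>E. e \<subseteq> V \<and> card e = 2)"

definition path_between :: "'a set \<Rightarrow> 'a set set \<Rightarrow> 'a \<Rightarrow> 'a list \<Rightarrow> 'a \<Rightarrow> bool" where
  "path_between V E u p v \<longleftrightarrow>
     p \<noteq> [] \<and> hd p = u \<and> last p = v \<and> set p \<subseteq> V \<and> distinct p \<and>
     successively (\<lambda>x y. {x, y} \<in> E) p"

definition path_length :: "'a list \<Rightarrow> nat" where
  "path_length p = length p - 1"

text \<open>Vertices in different connected components are at distance \<open>\<infinity>\<close>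
  (the infimum of the empty set).\<close>

definition gdist :: "'a set \<Rightarrow> 'a set set \<Rightarrow> 'a \<Rightarrow> 'a \<Rightarrow> enat" where
  "gdist V E u v = (INF p\<in>{p. path_between V E u p v}. enat (path_length p))"

definition shortest_path :: "'a set \<Rightarrow> 'a set set \<Rightarrow> 'a \<Rightarrow> 'a list \<Rightarrow> 'a \<Rightarrow> bool" where
  "shortest_path V E u p v \<longleftrightarrow>
     path_between V E u p v \<and> enat (path_length p) = gdist V E u v"

definition resolving_set :: "'a set \<Rightarrow> 'a set set \<Rightarrow> 'a set \<Rightarrow> bool" where
  "resolving_set V E S \<longleftrightarrow>
     S \<subseteq> V \<and>
     (\<forall>u\<in>V. \<forall>v\<in>V. u \<noteq> v \<longrightarrow> (\<exists>w\<in>S. gdist V E w u \<noteq> gdist V E w v))"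

text \<open>The two end vertices may coincide, so every vertex of \<open>S\<close> is covered by \<open>S\<close>.\<close>

definition geodetic_set :: "'a set \<Rightarrow> 'a set set \<Rightarrow> 'a set \<Rightarrow> bool" where
  "geodetic_set V E S \<longleftrightarrow>
     S \<subseteq> V \<and>
     (\<forall>u\<in>V. \<exists>s\<^sub>1\<in>S. \<exists>s\<^sub>2\<in>S. \<exists>p. shortest_path V E s\<^sub>1 p s\<^sub>2 \<and> u \<in> set p)"

definition independent_set :: "'a set set \<Rightarrow> 'a set \<Rightarrow> bool" where
  "independent_set E I \<longleftrightarrow> (\<forall>u\<in>I. \<forall>v\<in>I. {u, v} \<notin> E)"

definition vc :: "'a set \<Rightarrow> 'a set set \<Rightarrow> nat" where
  "vc V E = (LEAST m. \<exists>X\<subseteq>V. card X = m \<and> independent_set E (V - X))"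


section \<open>The decision problems\<close>

definition METRIC_DIMENSION :: "'a set \<Rightarrow> 'a set set \<Rightarrow> nat \<Rightarrow> bool" where
  "METRIC_DIMENSION V E k \<longleftrightarrow> (\<exists>S. card S \<le> k \<and> resolving_set V E S)"

definition GEODETIC_SET :: "'a set \<Rightarrow> 'a set set \<Rightarrow> nat \<Rightarrow> bool" where
  "GEODETIC_SET V E k \<longleftrightarrow> (\<exists>S. card S \<le> k \<and> geodetic_set V E S)"

text \<open>Inputs of algorithms are graphs with vertex set \<open>{..<n}\<close>.\<close>

definition valid_instance :: "nat \<Rightarrow> nat set set \<Rightarrow> nat \<Rightarrow> bool" where
  "valid_instance n E k \<longleftrightarrow> simple_graph {..<n} E \<and> k \<ge> 1"


section \<open>The machine model\<close>

text \<open>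
  A random access machine, programmed in a structured language. A program is a fixed
  finite piece of syntax, so it uses finitely many registers and finitely many arrays (the
  only unbounded memory); both hold natural numbers. Every operation costs one unit. The
  only arithmetic is addition and truncated subtraction: there is deliberately no
  multiplication, so that within \<open>t\<close> steps numbers grow by \<open>O(t)\<close> bits only and the
  unit cost measure is polynomially related to Turing machine time.
\<close>

datatype aexp =
    Const nat
  | Reg nat
  | Arr nat aexp
  | Add aexp aexp
  | Sub aexp aexp

datatype bexp =
    Less aexp aexp
  | Eq aexp aexp
  | Neg bexp
  | Conj bexp bexp

datatype com =
    Skip
  | SetReg nat aexp
  | SetArr nat aexp aexp
  | Seq com com
  | Cond bexp com com
  | While bexp com

record state =
  reg :: "nat \<Rightarrow> nat"
  arr :: "nat \<Rightarrow> nat \<Rightarrow> nat"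

fun aval :: "aexp \<Rightarrow> state \<Rightarrow> nat" where
  "aval (Const m) s = m"
| "aval (Reg x) s = reg s x"
| "aval (Arr a e) s = arr s a (aval e s)"
| "aval (Add e f) s = aval e s + aval f s"
| "aval (Sub e f) s = aval e s - aval f s"

fun bval :: "bexp \<Rightarrow> state \<Rightarrow> bool" where
  "bval (Less e f) s \<longleftrightarrow> aval e s < aval f s"
| "bval (Eq e f) s \<longleftrightarrow> aval e s = aval f s"
| "bval (Neg b) s \<longleftrightarrow> \<not> bval b s"
| "bval (Conj b c) s \<longleftrightarrow> bval b s \<and> bval c s"

fun acost :: "aexp \<Rightarrow> nat" where
  "acost (Const m) = 1"
| "acost (Reg x) = 1"
| "acost (Arr a e) = acost e + 1"
| "acost (Add e f) = acost e + acost f + 1"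
| "acost (Sub e f) = acost e + acost f + 1"

fun bcost :: "bexp \<Rightarrow> nat" where
  "bcost (Less e f) = acost e + acost f + 1"
| "bcost (Eq e f) = acost e + acost f + 1"
| "bcost (Neg b) = bcost b + 1"
| "bcost (Conj b c) = bcost b + bcost c + 1"

text \<open>\<open>exec c s t s'\<close>: started in \<open>s\<close>, the program \<open>c\<close> halts in \<open>s'\<close> after time \<open>t\<close>.\<close>

inductive exec :: "com \<Rightarrow> state \<Rightarrow> nat \<Rightarrow> state \<Rightarrow> bool" where
  Skip: "exec Skip s 1 s"
| SetReg: "exec (SetReg x e) s (acost e + 1) (s\<lparr>reg := (reg s)(x := aval e s)\<rparr>)"
| SetArr: "exec (SetArr a e f) s (acost e + acost f + 1)
    (s\<lparr>arr := (arr s)(a := (arr s a)(aval e s := aval f s))\<rparr>)"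
| Seq: "exec c\<^sub>1 s\<^sub>1 t\<^sub>1 s\<^sub>2 \<Longrightarrow> exec c\<^sub>2 s\<^sub>2 t\<^sub>2 s\<^sub>3 \<Longrightarrow> exec (Seq c\<^sub>1 c\<^sub>2) s\<^sub>1 (t\<^sub>1 + t\<^sub>2) s\<^sub>3"
| CondTrue: "bval b s \<Longrightarrow> exec c\<^sub>1 s t s' \<Longrightarrow> exec (Cond b c\<^sub>1 c\<^sub>2) s (bcost b + 1 + t) s'"
| CondFalse: "\<not> bval b s \<Longrightarrow> exec c\<^sub>2 s t s' \<Longrightarrow> exec (Cond b c\<^sub>1 c\<^sub>2) s (bcost b + 1 + t) s'"
| WhileFalse: "\<not> bval b s \<Longrightarrow> exec (While b c) s (bcost b + 1) s"
| WhileTrue: "bval b s\<^sub>1 \<Longrightarrow> exec c s\<^sub>1 t\<^sub>1 s\<^sub>2 \<Longrightarrow> exec (While b c) s\<^sub>2 t\<^sub>2 s\<^sub>3 \<Longrightarrow>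
    exec (While b c) s\<^sub>1 (bcost b + 1 + t\<^sub>1 + t\<^sub>2) s\<^sub>3"

inductive_cases Skip_exec: "exec Skip s t s'"
inductive_cases SetReg_exec: "exec (SetReg x e) s t s'"
inductive_cases SetArr_exec: "exec (SetArr a e f) s t s'"
inductive_cases Seq_exec: "exec (Seq c d) s t s'"
inductive_cases Cond_exec: "exec (Cond b c d) s t s'"
inductive_cases While_exec: "exec (While b c) s t s'"

text \<open>Execution is deterministic, so asserting that some halting execution has a property
  asserts it of the execution.\<close>

lemma exec_deterministic:
  "exec c s t s' \<Longrightarrow> exec c s u s'' \<Longrightarrow> t = u \<and> s' = s''"
proof (induction arbitrary: u s'' rule: exec.induct)
  case (Skip s)
  then show ?case by (auto elim: Skip_exec)
next
  case (SetReg x e s)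
  then show ?case by (auto elim: SetReg_exec)
next
  case (SetArr a e f s)
  then show ?case by (auto elim: SetArr_exec)
next
  case (Seq c\<^sub>1 s\<^sub>1 t\<^sub>1 s\<^sub>2 c\<^sub>2 t\<^sub>2 s\<^sub>3)
  from Seq.prems obtain u\<^sub>1 u\<^sub>2 s'
    where "exec c\<^sub>1 s\<^sub>1 u\<^sub>1 s'" "exec c\<^sub>2 s' u\<^sub>2 s''" "u = u\<^sub>1 + u\<^sub>2"
    by (elim Seq_exec)
  with Seq.IH show ?case by metis
next
  case (CondTrue b s c\<^sub>1 t s' c\<^sub>2)
  from CondTrue.prems \<open>bval b s\<close> obtain t' where "exec c\<^sub>1 s t' s''" "u = bcost b + 1 + t'"
    by (elim Cond_exec) simp_all
  with CondTrue.IH show ?case by metis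
next
  case (CondFalse b s c\<^sub>2 t s' c\<^sub>1)
  from CondFalse.prems \<open>\<not> bval b s\<close> obtain t' where "exec c\<^sub>2 s t' s''" "u = bcost b + 1 + t'"
    by (elim Cond_exec) simp_all
  with CondFalse.IH show ?case by metis
next
  case (WhileFalse b s c)
  show ?case
    by (rule While_exec[OF WhileFalse.prems]) (simp_all add: \<open>\<not> bval b s\<close>)
next
  case (WhileTrue b s\<^sub>1 c t\<^sub>1 s\<^sub>2 t\<^sub>2 s\<^sub>3)
  obtain u\<^sub>1 u\<^sub>2 s'
    where "exec c s\<^sub>1 u\<^sub>1 s'" "exec (While b c) s' u\<^sub>2 s''" "u = bcost b + 1 + u\<^sub>1 + u\<^sub>2"
    by (rule While_exec[OF WhileTrue.prems]) (simp_all add: \<open>bval b s\<^sub>1\<close>)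
  with WhileTrue.IH show ?case by metis
qed


section \<open>Input, output and running time\<close>

text \<open>An instance is presented by \<open>n\<close> in register 0, \<open>k\<close> in register 1 and the
  row-major adjacency matrix in array 0.\<close>

definition encodes :: "state \<Rightarrow> nat \<Rightarrow> nat set set \<Rightarrow> nat \<Rightarrow> bool" where
  "encodes s n E k \<longleftrightarrow>
     reg s 0 = n \<and> reg s 1 = k \<and>
     (\<forall>u<n. \<forall>v<n. arr s 0 (u * n + v) = of_bool ({u, v} \<in> E))"

definition input_state :: "nat \<Rightarrow> nat set set \<Rightarrow> nat \<Rightarrow> state" where
  "input_state n E k =
     \<lparr>reg = (\<lambda>_. 0)(0 := n, 1 := k),
      arr = (\<lambda>_ _. 0)(0 := (\<lambda>i. of_bool (i < n * n \<and> {i div n, i mod n} \<in> E)))\<rparr>"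

lemma encodes_input_state: "encodes (input_state n E k) n E k"
proof -
  have "u * n + v < n * n" if "u < n" "v < n" for u v
  proof -
    have "u * n + v < Suc u * n" using that by simp
    also have "\<dots> \<le> n * n" using that by (intro mult_le_mono1) simp
    finally show ?thesis .
  qed
  then show ?thesis by (auto simp: encodes_def input_state_def)
qed

text \<open>The answer of a decision algorithm is left in register 0.\<close>

definition decides_in_time ::
  "com \<Rightarrow> (nat set \<Rightarrow> nat set set \<Rightarrow> nat \<Rightarrow> bool) \<Rightarrow> (nat \<Rightarrow> nat \<Rightarrow> real) \<Rightarrow> bool" where
  "decides_in_time c P T \<longleftrightarrow>
     (\<forall>n E k. valid_instance n E k \<longrightarrow>
        (\<exists>t s. exec c (input_state n E k) t s \<and>
               reg s 0 = of_bool (P {..<n} E k) \<and>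
               real t \<le> T n (vc {..<n} E)))"

text \<open>\<open>T\<close> bounds the running time in terms of the number of vertices; \<open>N\<close> and \<open>K\<close>
  bound the number of vertices and the solution size of the output in terms of the
  vertex cover number of the input graph.\<close>

definition kernelizes_in_time ::
  "com \<Rightarrow> (nat set \<Rightarrow> nat set set \<Rightarrow> nat \<Rightarrow> bool) \<Rightarrow> (nat \<Rightarrow> real) \<Rightarrow>
   (nat \<Rightarrow> real) \<Rightarrow> (nat \<Rightarrow> nat) \<Rightarrow> bool" where
  "kernelizes_in_time c P T N K \<longleftrightarrow>
     (\<forall>n E k. valid_instance n E k \<longrightarrow>
        (\<exists>t s n' E' k'.
           exec c (input_state n E k) t s \<and>
           real t \<le> T n \<and>
           encodes s n' E' k' \<and>
           valid_instance n' E' k' \<and>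
           (P {..<n'} E' k' \<longleftrightarrow> P {..<n} E k) \<and>
           real n' \<le> N (vc {..<n} E) \<and>
           k' \<le> K (vc {..<n} E)))"

definition polynomially_bounded :: "(nat \<Rightarrow> real) \<Rightarrow> bool" where
  "polynomially_bounded p \<longleftrightarrow> (\<exists>d::nat. p \<in> O(\<lambda>n. real n ^ d))"

end

theory Submission
  imports Defs
begin

text \<open>
  Distances do not distinguish false twins (vertices with the same neighbourhood), and a graph with
  vertex cover number \<open>v\<close> has at most \<open>2\<^sup>v + v\<close> classes of them. Call a vertex kept if it is among
  the first five of its class; there are at most \<open>5 \<cdot> 2\<^sup>v + v\<close> kept vertices. For either problem there is
  a set of forced vertices (all but the first of each class for resolving sets, the simplicial
  vertices for geodetic sets) such that every solution can be transformed, without growing, into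
  one that contains all forced vertices and is otherwise contained in the kept ones.

  Kernel: keep the kept vertices and decrease \<open>k\<close> by the number of forced vertices deleted. Every
  deleted vertex has a kept twin, so distances do not change.

  Algorithm: the forced vertices together with a vertex cover form a solution, so at most \<open>v\<close>
  further vertices, all of them kept, have to be guessed; this leaves \<open>2\<^bsup>O(v\<^sup>2)\<^esup>\<close> candidates. A
  counter \<open>m\<close> runs through them, its digits in base one plus the number of kept vertices naming
  the guessed vertices. A set of size \<open>t\<close> is encoded by some \<open>m\<close> below the \<open>t\<close>-th power of the base and
  every such \<open>m\<close> encodes at most \<open>t\<close> vertices, so the first candidate that works is optimal.
  Neither program ever computes a vertex cover.
\<close>


section \<open>Distances\<close>

text \<open>The number five comes from geodetic sets. Five twins of a solution that have two
  nonadjacent common neighbours \<open>a\<close> and \<open>b\<close> can be replaced by two of the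
  twins together with \<open>a\<close> and \<open>b\<close>, so at most four members of a
  nonsimplicial class are ever worth using. Hence one of five kept twins is outside the solution,
  and whatever covers it also covers its deleted twins. Five kept twins also allow a deleted vertex
  to be represented by one that avoids up to four prescribed vertices. Lowering \<open>k\<close> can
  destroy the requirement that it be positive. Rounding up to 1 is harmless: if a forced vertex was
  deleted, every solution of the kernel has at least two elements. Capping the result just above the
  number of kernel vertices excludes no solution and bounds it in terms of the vertex cover number.
  The machine offers neither multiplication nor bounded loops, so the programs are written in a
  language of bounded sums and loops whose cost is polynomial by construction. Only the loop over
  the candidates lies outside it; a vertex cover enters nothing but the estimate of its
  rounds.\<close>

lemma enat_le_eqI:
  assumes "\<And>i. a \<le> enat i \<longleftrightarrow> b \<le> enat i"
  shows "a = b"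
proof (rule antisym)
  show "a \<le> b" using assms[of "the_enat b"] by (cases b) simp_all
  show "b \<le> a" using assms[of "the_enat a"] by (cases a) simp_all
qed

text \<open>An infimum of a nonempty set of extended naturals is attained. Finite thresholds replace
  the infimum from here on: distances are compared by induction on \<open>i\<close>, and infinity
  needs no case of its own.\<close>

lemma gdist_le_iff:
  "gdist V E u v \<le> enat i \<longleftrightarrow> (\<exists>p. path_between V E u p v \<and> path_length p \<le> i)"
proof
  assume le: "gdist V E u v \<le> enat i"
  let ?A = "(\<lambda>p. enat (path_length p)) ` {p. path_between V E u p v}"
  have ne: "?A \<noteq> {}"
  proof
    assume "?A = {}"
    then have "gdist V E u v = \<infinity>" unfolding gdist_def by (simp add: top_enat_def)
    with le show False by simp
  qed
  have "Inf ?A \<in> ?A" using ne by (auto simp: Inf_enat_def intro: LeastI)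
  then obtain p where "path_between V E u p v" "Inf ?A = enat (path_length p)" by auto
  then show "\<exists>p. path_between V E u p v \<and> path_length p \<le> i"
    using le unfolding gdist_def by auto
next
  assume "\<exists>p. path_between V E u p v \<and> path_length p \<le> i"
  then obtain p where p: "path_between V E u p v" "path_length p \<le> i" by blast
  have "gdist V E u v \<le> enat (path_length p)"
    unfolding gdist_def using p(1) by (intro INF_lower) simp
  also have "\<dots> \<le> enat i" using p by simp
  finally show "gdist V E u v \<le> enat i" .
qed

lemma gdist_leI: "path_between V E u p v \<Longrightarrow> path_length p \<le> i \<Longrightarrow> gdist V E u v \<le> enat i"
  by (auto simp: gdist_le_iff)

lemma gdist_leE:
  assumes "gdist V E u v \<le> enat i"
  obtains p where "path_between V E u p v" "path_length p \<le> i"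
  using assms by (auto simp: gdist_le_iff)

lemma gdist_eq_enatE:
  assumes "gdist V E u v = enat i"
  obtains p where "shortest_path V E u p v"
proof -
  from assms obtain p where p: "path_between V E u p v" "path_length p \<le> i"
    using gdist_le_iff[of V E u v i] by auto
  moreover have "gdist V E u v \<le> enat (path_length p)"
    using p(1) by (subst gdist_le_iff) auto
  ultimately have "shortest_path V E u p v"
    using assms by (auto simp: shortest_path_def)
  then show thesis by (rule that)
qed

lemma gdist_le_0: "gdist V E u v \<le> enat 0 \<longleftrightarrow> u = v \<and> u \<in> V"
proof -
  have "(\<exists>p. path_between V E u p v \<and> path_length p \<le> 0) \<longleftrightarrow> u = v \<and> u \<in> V"
  proof
    assume "\<exists>p. path_between V E u p v \<and> path_length p \<le> 0"
    then obtain p where p: "path_between V E u p v" "length p \<le> 1" by (auto simp: path_length_def)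
    then obtain x where "p = [x]" by (cases p) (auto simp: path_between_def)
    with p show "u = v \<and> u \<in> V" by (auto simp: path_between_def)
  next
    assume "u = v \<and> u \<in> V"
    then have "path_between V E u [u] v \<and> path_length [u] \<le> 0"
      by (auto simp: path_between_def path_length_def)
    then show "\<exists>p. path_between V E u p v \<and> path_length p \<le> 0" by blast
  qed
  then show ?thesis by (simp only: gdist_le_iff)
qed

lemma path_between_suffix:
  assumes "path_between V E u (xs @ w # ys) v"
  shows "path_between V E w (w # ys) v"
  using assms by (auto simp: path_between_def successively_append_iff)

lemma path_between_prefix:
  assumes "path_between V E u (xs @ w # ys) v"
  shows "path_between V E u (xs @ [w]) w"
  using assms by (auto simp: path_between_def successively_append_iff hd_append split: if_splits)

text \<open>Breadth-first recursion on the first step. Since paths must be simple, \<open>u\<close>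
  cannot always be put in front of a path from \<open>w\<close>; if it already occurs there, the
  suffix starting at \<open>u\<close> is used, which is even shorter.\<close>

lemma gdist_le_Suc:
  assumes "u \<in> V" "v \<in> V"
  shows "gdist V E u v \<le> enat (Suc i) \<longleftrightarrow>
    u = v \<or> (\<exists>w\<in>V. {u, w} \<in> E \<and> gdist V E w v \<le> enat i)"
proof
  assume "gdist V E u v \<le> enat (Suc i)"
  then obtain p where p: "path_between V E u p v" "path_length p \<le> Suc i"
    by (rule gdist_leE)
  show "u = v \<or> (\<exists>w\<in>V. {u, w} \<in> E \<and> gdist V E w v \<le> enat i)"
  proof (cases "tl p")
    case Nil
    with p have "p = [u]" by (cases p) (simp_all add: path_between_def)
    with p show ?thesis by (simp add: path_between_def)
  next
    case (Cons w ys)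
    with p(1) have p_eq: "p = u # w # ys" by (cases p) (auto simp: path_between_def)
    with p have "path_between V E w (w # ys) v" using path_between_suffix[of V E u "[u]"] by simp
    moreover have "path_length (w # ys) \<le> i" using p p_eq by (simp add: path_length_def)
    ultimately have "gdist V E w v \<le> enat i" by (rule gdist_leI)
    moreover have "{u, w} \<in> E" "w \<in> V" using p(1) p_eq by (simp_all add: path_between_def)
    ultimately show ?thesis by blast
  qed
next
  assume "u = v \<or> (\<exists>w\<in>V. {u, w} \<in> E \<and> gdist V E w v \<le> enat i)"
  then show "gdist V E u v \<le> enat (Suc i)"
  proof
    assume "u = v"
    then have "gdist V E u v \<le> enat 0" using assms by (simp only: gdist_le_0)
    then show ?thesis by (rule order_trans) simp
  next
    assume "\<exists>w\<in>V. {u, w} \<in> E \<and> gdist V E w v \<le> enat i"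
    then obtain w p where w: "w \<in> V" "{u, w} \<in> E" and
      p: "path_between V E w p v" "path_length p \<le> i" by (blast elim: gdist_leE)
    show ?thesis
    proof (cases "u \<in> set p")
      case True
      then obtain xs ys where "p = xs @ u # ys" by (meson split_list)
      then have "path_between V E u (u # ys) v" "path_length (u # ys) \<le> Suc i"
        using p path_between_suffix[of V E w xs u ys v] by (auto simp: path_length_def)
      then show ?thesis by (rule gdist_leI)
    next
      case False
      then have "path_between V E u (u # p) v"
        using p(1) w assms by (cases p) (auto simp: path_between_def)
      moreover have "path_length (u # p) \<le> Suc i" using p by (auto simp: path_length_def)
      ultimately show ?thesis by (rule gdist_leI)
    qed
  qed
qed

lemma gdist_commute: "gdist V E u v = gdist V E v u"
proof -
  have *: "path_between V E y (rev p) x \<and> path_length (rev p) = path_length p"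
    if "path_between V E x p y" for x p y
    using that by (auto simp: path_between_def path_length_def hd_rev last_rev insert_commute)
  have "gdist V E x y \<le> enat i" if "gdist V E y x \<le> enat i" for x y i
    using that unfolding gdist_le_iff using * by fastforce
  then show ?thesis by (intro enat_le_eqI) blast
qed

lemma gdist_self: "u \<in> V \<Longrightarrow> gdist V E u u = 0"
  using gdist_le_0[of V E u u] by (simp add: enat_0)

lemma gdist_eq_0_iff: "u \<in> V \<Longrightarrow> gdist V E u v = 0 \<longleftrightarrow> u = v"
  using gdist_le_0[of V E u v] by (simp add: enat_0)

text \<open>Peeling off first steps with \<open>gdist_le_Suc\<close> avoids concatenating two simple
  paths, which need not give a simple path.\<close>

lemma gdist_triangle_aux:
  assumes "u \<in> V" "v \<in> V" "w \<in> V"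
  shows "gdist V E u w \<le> enat i \<Longrightarrow> gdist V E w v \<le> enat j \<Longrightarrow> gdist V E u v \<le> enat (i + j)"
  using assms
proof (induction i arbitrary: u)
  case 0
  then show ?case using gdist_le_0[of V E u w] by auto
next
  case (Suc i)
  show ?case
  proof (cases "u = w")
    case True
    then show ?thesis using Suc.prems by (auto intro: order_trans)
  next
    case False
    then obtain x where "x \<in> V" "{u, x} \<in> E" "gdist V E x w \<le> enat i"
      using Suc.prems gdist_le_Suc[of u V w E i] by auto
    with Suc.IH[of x] Suc.prems have "gdist V E x v \<le> enat (i + j)" by auto
    then show ?thesis
      using gdist_le_Suc[of u V v E "i + j"] \<open>x \<in> V\<close> \<open>{u, x} \<in> E\<close> Suc.prems by auto
  qed
qed

lemma gdist_triangle:
  assumes "u \<in> V" "v \<in> V" "w \<in> V"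
  shows "gdist V E u v \<le> gdist V E u w + gdist V E w v"
  using gdist_triangle_aux[OF assms, of E] by (cases "gdist V E u w"; cases "gdist V E w v") auto

text \<open>A simple path has at most \<open>card V\<close> vertices. The value
  \<open>card V\<close> is therefore free to encode infinite distance, as \<open>ndist\<close> does
  later.\<close>

lemma gdist_finite_less_card:
  assumes "finite V" "gdist V E u v \<noteq> \<infinity>"
  shows "gdist V E u v < enat (card V)"
proof -
  obtain p where p: "shortest_path V E u p v"
    using assms(2) by (auto elim: gdist_eq_enatE)
  then have "length p \<le> card V" "p \<noteq> []"
    using assms(1) card_mono[of V "set p"]
    by (auto simp: shortest_path_def path_between_def distinct_card)
  moreover have "gdist V E u v = enat (length p - 1)"
    using p by (simp add: shortest_path_def path_length_def)
  ultimately show ?thesis by (cases p) auto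
qed

text \<open>Metric form of lying on a shortest path. Finiteness is demanded separately because
  \<open>\<infinity> = \<infinity>\<close> would satisfy the equation for end vertices in different
  components.\<close>

definition covers :: "'a set \<Rightarrow> 'a set set \<Rightarrow> 'a \<Rightarrow> 'a \<Rightarrow> 'a \<Rightarrow> bool" where
  "covers V E s t u \<longleftrightarrow>
     gdist V E s u + gdist V E u t = gdist V E s t \<and> gdist V E s t \<noteq> \<infinity>"

lemma covers_if_on_shortest_path:
  assumes "shortest_path V E s p t" "u \<in> set p"
  shows "covers V E s t u"
proof -
  obtain xs ys where p: "p = xs @ u # ys" using assms(2) by (meson split_list)
  have pb: "path_between V E s (xs @ u # ys) t" using assms p by (auto simp: shortest_path_def)
  have V: "s \<in> V" "t \<in> V" "u \<in> V"
    using pb by (auto simp: path_between_def hd_append split: if_splits)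
  have "gdist V E s u \<le> enat (length xs)"
    using path_between_prefix[OF pb] by (subst gdist_le_iff) (force simp: path_length_def)
  moreover have "gdist V E u t \<le> enat (length ys)"
    using path_between_suffix[OF pb] by (subst gdist_le_iff) (force simp: path_length_def)
  moreover have st: "gdist V E s t = enat (length xs + length ys)"
    using assms p by (auto simp: shortest_path_def path_length_def)
  moreover have "gdist V E s t \<le> gdist V E s u + gdist V E u t"
    using V by (intro gdist_triangle)
  ultimately show ?thesis
    unfolding covers_def by (cases "gdist V E s u"; cases "gdist V E u t") auto
qed

text \<open>Induction on the distance from \<open>s\<close> to \<open>u\<close>: a neighbour
  \<open>w\<close> one step closer to \<open>u\<close> is also one step closer to \<open>t\<close>,
  so the equation persists for \<open>w\<close>, and \<open>s\<close> can be put in front of the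
  path found for \<open>w\<close>.\<close>

lemma on_shortest_path_if_covers:
  assumes "s \<in> V" "t \<in> V" "u \<in> V" "gdist V E s u = enat i" "covers V E s t u"
  shows "\<exists>p. shortest_path V E s p t \<and> u \<in> set p"
  using assms
proof (induction i arbitrary: s)
  case 0
  then have "s = u" using gdist_eq_0_iff[of s V E u] by (simp add: zero_enat_def)
  obtain p where p: "shortest_path V E s p t"
    using 0 by (auto simp: covers_def elim: gdist_eq_enatE)
  then have "hd p = s" "p \<noteq> []" by (auto simp: shortest_path_def path_between_def)
  with p \<open>s = u\<close> show ?case by (cases p) auto
next
  case (Suc i)
  from Suc.prems obtain m where m: "gdist V E s t = enat m" "gdist V E u t = enat (m - Suc i)" "Suc i \<le> m"
    by (cases "gdist V E s t"; cases "gdist V E u t") (auto simp: covers_def)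
  have "s \<noteq> u" using Suc.prems gdist_self[of u V E] by (auto simp: zero_enat_def)
  then obtain w where w: "w \<in> V" "{s, w} \<in> E" "gdist V E w u \<le> enat i"
    using Suc.prems gdist_le_Suc[of s V u E i] by auto
  have "\<not> gdist V E w u < enat i"
  proof
    assume "gdist V E w u < enat i"
    then obtain i' where "i = Suc i'" "gdist V E w u \<le> enat i'"
      by (cases "gdist V E w u"; cases i) (auto simp: less_Suc_eq_le)
    then have "gdist V E s u \<le> enat i"
      using gdist_le_Suc[of s V u E i'] w Suc.prems by auto
    then show False using Suc.prems by simp
  qed
  with w have wu: "gdist V E w u = enat i" by auto
  have "gdist V E w t \<le> enat (m - 1)"
    using gdist_triangle_aux[of w V t u E i "m - Suc i"] wu m w Suc.prems by auto
  moreover have "\<not> gdist V E w t < enat (m - 1)"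
  proof
    assume "gdist V E w t < enat (m - 1)"
    then obtain i' where "m = Suc (Suc i')" "gdist V E w t \<le> enat i'"
      by (cases "gdist V E w t"; cases m; cases "m - 1") (auto simp: less_Suc_eq_le)
    then have "gdist V E s t \<le> enat (m - 1)"
      using gdist_le_Suc[of s V t E i'] w Suc.prems by auto
    then show False using m by simp
  qed
  ultimately have wt: "gdist V E w t = enat (m - 1)" by auto
  have "covers V E w t u" using wu wt m by (auto simp: covers_def)
  with Suc.IH[OF w(1) Suc.prems(2,3) wu] obtain p where
    p: "shortest_path V E w p t" "u \<in> set p" by blast
  \<comment> \<open>If \<open>s\<close> were on \<open>p\<close>, the distance from \<open>w\<close>
    to \<open>t\<close> would be at least \<open>m\<close>, but it is \<open>m - 1\<close>.\<close>
  have "s \<notin> set p"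
  proof
    assume "s \<in> set p"
    with p(1) have "covers V E w t s" by (rule covers_if_on_shortest_path)
    then show False using m wt by (cases "gdist V E w s") (auto simp: covers_def)
  qed
  then have "path_between V E s (s # p) t" "path_length (s # p) = m"
    using p w wt m Suc.prems by (cases p; force simp: shortest_path_def path_between_def path_length_def)+
  then show ?case using p m by (intro exI[of _ "s # p"]) (auto simp: shortest_path_def)
qed

text \<open>From here on paths are no longer needed: both problems are expressed by the distance
  function alone.\<close>

lemma geodetic_set_iff:
  "geodetic_set V E S \<longleftrightarrow> S \<subseteq> V \<and> (\<forall>u\<in>V. \<exists>s\<in>S. \<exists>t\<in>S. covers V E s t u)"
proof -
  have "(\<exists>p. shortest_path V E s p t \<and> u \<in> set p) \<longleftrightarrow> covers V E s t u"
    if "s \<in> V" "t \<in> V" "u \<in> V" for s t u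
  proof
    assume c: "covers V E s t u"
    then obtain i where "gdist V E s u = enat i"
      by (cases "gdist V E s u") (auto simp: covers_def)
    then show "\<exists>p. shortest_path V E s p t \<and> u \<in> set p"
      using on_shortest_path_if_covers that c by metis
  qed (auto intro: covers_if_on_shortest_path)
  then show ?thesis unfolding geodetic_set_def by (meson subsetD)
qed


section \<open>False twins and normal forms of solutions\<close>

lemma simple_graph_no_loop: "simple_graph V E \<Longrightarrow> {v, v} \<notin> E"
  by (auto simp: simple_graph_def)

lemma gdist_le_1:
  assumes "u \<in> V" "v \<in> V"
  shows "gdist V E u v \<le> enat 1 \<longleftrightarrow> u = v \<or> {u, v} \<in> E"
  using gdist_le_Suc[OF assms, of E 0] assms by (auto simp: gdist_le_0 simp del: enat_0)

definition twins :: "'a set \<Rightarrow> 'a set set \<Rightarrow> 'a \<Rightarrow> 'a \<Rightarrow> bool" where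
  "twins V E u v \<longleftrightarrow> (\<forall>w\<in>V. {u, w} \<in> E \<longleftrightarrow> {v, w} \<in> E)"

definition simplicial :: "'a set \<Rightarrow> 'a set set \<Rightarrow> 'a \<Rightarrow> bool" where
  "simplicial V E v \<longleftrightarrow>
     (\<forall>a\<in>V. \<forall>b\<in>V. {v, a} \<in> E \<and> {v, b} \<in> E \<and> a \<noteq> b \<longrightarrow> {a, b} \<in> E)"

lemma twins_refl: "twins V E u u"
  and twins_sym: "twins V E u v \<Longrightarrow> twins V E v u"
  and twins_trans: "twins V E u v \<Longrightarrow> twins V E v w \<Longrightarrow> twins V E u w"
  by (auto simp: twins_def)

lemma twins_not_adjacent:
  assumes "simple_graph V E" "v \<in> V" "twins V E u v"
  shows "{u, v} \<notin> E"
  using assms simple_graph_no_loop[of V E v] by (auto simp: twins_def)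

lemma simplicial_twins: "twins V E u v \<Longrightarrow> simplicial V E u \<longleftrightarrow> simplicial V E v"
  by (auto simp: twins_def simplicial_def)

text \<open>Towards a third vertex both twins have the same possible first steps, and
  \<open>gdist_le_Suc\<close> depends on nothing else.\<close>

lemma gdist_twins:
  assumes "u \<in> V" "v \<in> V" "x \<in> V" "twins V E u v" "x \<noteq> u" "x \<noteq> v"
  shows "gdist V E u x = gdist V E v x"
proof (rule enat_le_eqI)
  fix i
  show "gdist V E u x \<le> enat i \<longleftrightarrow> gdist V E v x \<le> enat i"
  proof (cases i)
    case 0
    then show ?thesis using assms by (simp only: gdist_le_0) blast
  next
    case (Suc j)
    then show ?thesis using assms by (auto simp: gdist_le_Suc twins_def)
  qed
qed

section \<open>Covering pairs, and the exchange of twins in them\<close>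

lemma geodetic_setE:
  assumes "geodetic_set V E S" "u \<in> V"
  obtains s t where "s \<in> S" "t \<in> S" "s \<in> V" "t \<in> V" "covers V E s t u"
proof -
  from assms obtain s t where "s \<in> S" "t \<in> S" "covers V E s t u" "S \<subseteq> V"
    unfolding geodetic_set_iff by blast
  then show thesis using that by blast
qed

lemma covers_commute: "covers V E s t u \<longleftrightarrow> covers V E t s u"
  unfolding covers_def gdist_commute[of V E s u] gdist_commute[of V E u t] gdist_commute[of V E s t]
  by (simp add: add.commute)

lemma covers_finite:
  assumes "covers V E s t u"
  shows "gdist V E s u \<noteq> \<infinity>" "gdist V E u t \<noteq> \<infinity>"
  using assms by (cases "gdist V E s u"; cases "gdist V E u t"; simp add: covers_def)+

lemma covers_self: "u \<in> V \<Longrightarrow> covers V E u u u"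
  by (simp add: covers_def gdist_self)

lemma covers_same_ends: "u \<in> V \<Longrightarrow> s \<in> V \<Longrightarrow> covers V E s s u \<Longrightarrow> u = s"
  using gdist_eq_0_iff[of s V E u] gdist_self[of s V E] unfolding covers_def by auto

lemma covers_twins_end:
  assumes "s \<in> V" "s' \<in> V" "t \<in> V" "u \<in> V" "twins V E s s'" "covers V E s t u"
    and "u \<noteq> s" "u \<noteq> s'" "t \<noteq> s" "t \<noteq> s'"
  shows "covers V E s' t u"
  using assms(6-10) gdist_twins[OF assms(1,2,4,5)] gdist_twins[OF assms(1,2,3,5)]
  unfolding covers_def by simp

lemma covers_twins_mid:
  assumes "s \<in> V" "t \<in> V" "u \<in> V" "u' \<in> V" "twins V E u u'" "covers V E s t u"
    and "u \<noteq> s" "u \<noteq> t" "u' \<noteq> s" "u' \<noteq> t"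
  shows "covers V E s t u'"
  using assms(6-10) gdist_twins[OF assms(3,4,1,5)] gdist_twins[OF assms(3,4,2,5)]
  unfolding covers_def gdist_commute[of V E s] by simp

lemma gdist_adjacent:
  assumes "simple_graph V E" "u \<in> V" "v \<in> V" "{u, v} \<in> E"
  shows "gdist V E u v = enat 1"
proof -
  have "u \<noteq> v" using assms simple_graph_no_loop[of V E u] by auto
  then have "\<not> gdist V E u v \<le> enat 0" by (simp only: gdist_le_0 simp_thms)
  moreover have "gdist V E u v \<le> enat 1" using gdist_le_1[OF assms(2,3)] assms(4) by blast
  ultimately show ?thesis by (cases "gdist V E u v") auto
qed

lemma covers_common_neighbour:
  assumes "simple_graph V E" "u \<in> V" "a \<in> V" "b \<in> V" "{u, a} \<in> E" "{u, b} \<in> E" "a \<noteq> b" "{a, b} \<notin> E"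
  shows "covers V E a b u" "gdist V E a b = enat 2"
proof -
  have 1: "gdist V E u b = enat 1" "gdist V E a u = enat 1"
    using assms gdist_adjacent[of V E u b] gdist_adjacent[of V E a u] by (auto simp: insert_commute)
  have "gdist V E a b \<le> enat 2" using gdist_triangle_aux[of a V b u E 1 1] 1 assms by (simp add: numeral_2_eq_2)
  moreover have "\<not> gdist V E a b \<le> enat 1" using assms gdist_le_1[of a V b E] by simp
  ultimately show "gdist V E a b = enat 2" by (cases "gdist V E a b") auto
  with 1 show "covers V E a b u" by (simp add: covers_def numeral_2_eq_2)
qed

text \<open>Transposing two twins preserves all distances (\<open>gdist_swap\<close>), so solutions
  of either problem can be transported along it without changing their size.\<close>

definition swap :: "'a \<Rightarrow> 'a \<Rightarrow> 'a \<Rightarrow> 'a" where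
  "swap u v x = (if x = u then v else if x = v then u else x)"

lemma gdist_swap:
  assumes "u \<in> V" "v \<in> V" "twins V E u v" "x \<in> V" "y \<in> V"
  shows "gdist V E (swap u v x) (swap u v y) = gdist V E x y"
proof -
  have *: "gdist V E v z = gdist V E u z" "gdist V E z v = gdist V E z u"
    if "z \<in> V" "z \<noteq> u" "z \<noteq> v" for z
    using gdist_twins[OF assms(1,2) that(1) assms(3) that(2,3)] gdist_commute[of V E z] by simp_all
  show ?thesis
    using assms * gdist_self[of u V E] gdist_self[of v V E] gdist_commute[of V E u v]
    by (simp add: swap_def)
qed

lemma swap_swap [simp]: "swap u v (swap u v x) = x"
  by (simp add: swap_def)

lemma swap_in: "u \<in> V \<Longrightarrow> v \<in> V \<Longrightarrow> x \<in> V \<Longrightarrow> swap u v x \<in> V"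
  by (simp add: swap_def)

lemma swap_image: "u \<in> S \<Longrightarrow> v \<notin> S \<Longrightarrow> swap u v ` S = insert v (S - {u})"
  by (force simp: swap_def image_iff)

lemma resolving_set_swap:
  assumes "resolving_set V E S" "u \<in> V" "v \<in> V" "twins V E u v"
  shows "resolving_set V E (swap u v ` S)"
  unfolding resolving_set_def
proof (intro conjI ballI impI)
  have "S \<subseteq> V" using assms(1) by (simp add: resolving_set_def)
  then show "swap u v ` S \<subseteq> V" using swap_in[OF assms(2,3)] by blast
next
  fix x y assume xy: "x \<in> V" "y \<in> V" "x \<noteq> y"
  then have "swap u v x \<noteq> swap u v y" by (metis swap_swap)
  with xy obtain w where w: "w \<in> S" "w \<in> V"
    "gdist V E w (swap u v x) \<noteq> gdist V E w (swap u v y)"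
    using assms swap_in[of u V v] unfolding resolving_set_def by (meson subsetD)
  with xy assms have "gdist V E (swap u v w) x \<noteq> gdist V E (swap u v w) y"
    using gdist_swap[of u V v E w "swap u v x"] gdist_swap[of u V v E w "swap u v y"]
    by (simp add: swap_in)
  with w show "\<exists>w\<in>swap u v ` S. gdist V E w x \<noteq> gdist V E w y" by blast
qed

lemma geodetic_set_swap:
  assumes "geodetic_set V E S" "u \<in> V" "v \<in> V" "twins V E u v"
  shows "geodetic_set V E (swap u v ` S)"
  unfolding geodetic_set_iff
proof (intro conjI ballI)
  have "S \<subseteq> V" using assms(1) by (simp add: geodetic_set_iff)
  then show "swap u v ` S \<subseteq> V" using swap_in[OF assms(2,3)] by blast
next
  fix x assume x: "x \<in> V"
  have sx: "swap u v x \<in> V" using assms(2,3) x by (rule swap_in)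
  with assms(1) obtain s t where st: "s \<in> S" "t \<in> S" "s \<in> V" "t \<in> V" "covers V E s t (swap u v x)"
    using geodetic_setE by metis
  have "covers V E (swap u v s) (swap u v t) x"
    using st(5) gdist_swap[OF assms(2-4) st(3) sx] gdist_swap[OF assms(2-4) sx st(4)]
      gdist_swap[OF assms(2-4) st(3,4)]
    unfolding covers_def by simp
  with st show "\<exists>s\<in>swap u v ` S. \<exists>t\<in>swap u v ` S. covers V E s t x" by blast
qed

lemma card_swap_image: "card (swap u v ` S) = card S"
  by (rule card_image) (metis inj_onI swap_swap)

text \<open>By \<open>gdist_twins\<close> every vertex other than the twins themselves sees both at
  the same distance.\<close>

lemma resolving_set_twins:
  assumes "resolving_set V E S" "u \<in> V" "v \<in> V" "twins V E u v" "u \<noteq> v"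
  shows "u \<in> S \<or> v \<in> S"
proof (rule ccontr)
  assume *: "\<not> (u \<in> S \<or> v \<in> S)"
  obtain w where w: "w \<in> S" "w \<in> V" "gdist V E w u \<noteq> gdist V E w v"
    using assms unfolding resolving_set_def by (meson subsetD)
  then have "gdist V E u w = gdist V E v w" using assms * by (intro gdist_twins) auto
  with w(3) gdist_commute[of V E w] show False by simp
qed

text \<open>A member of \<open>S\<close> is told apart from all other vertices by its own distance
  0, so only pairs outside \<open>S\<close> need attention.\<close>

lemma resolving_setI:
  assumes "S \<subseteq> V"
    and "\<And>u v. u \<in> V \<Longrightarrow> v \<in> V \<Longrightarrow> u \<noteq> v \<Longrightarrow> u \<notin> S \<Longrightarrow> v \<notin> S \<Longrightarrow>
      \<exists>w\<in>S. gdist V E w u \<noteq> gdist V E w v"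
  shows "resolving_set V E S"
  unfolding resolving_set_def
proof (intro conjI ballI impI)
  fix u v assume uv: "u \<in> V" "v \<in> V" "u \<noteq> v"
  consider "u \<in> S" | "v \<in> S" | "u \<notin> S" "v \<notin> S" by blast
  then show "\<exists>w\<in>S. gdist V E w u \<noteq> gdist V E w v"
  proof cases
    case 1
    then show ?thesis using uv gdist_self[of u V E] gdist_eq_0_iff[of u V E v] by (intro bexI[of _ u]) auto
  next
    case 2
    then show ?thesis using uv gdist_self[of v V E] gdist_eq_0_iff[of v V E u] by (intro bexI[of _ v]) auto
  next
    case 3
    then show ?thesis using assms(2) uv by blast
  qed
qed (fact assms(1))

definition repeated :: "nat set \<Rightarrow> nat set set \<Rightarrow> nat \<Rightarrow> bool" where
  "repeated V E v \<longleftrightarrow> (\<exists>u\<in>V. u < v \<and> twins V E u v)"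

text \<open>By \<open>resolving_set_twins\<close> a class misses at most one member. If the missing
  vertex is repeated, transposing it with the least member of its class moves the gap to a vertex
  that is not repeated; the number of missing repeated vertices drops.\<close>

lemma resolving_set_normal_form:
  assumes "finite V" "resolving_set V E S"
  shows "\<exists>S'. resolving_set V E S' \<and> card S' = card S \<and> {v\<in>V. repeated V E v} \<subseteq> S'"
  using assms(2)
proof (induction "card ({v\<in>V. repeated V E v} - S)" arbitrary: S rule: less_induct)
  case less
  show ?case
  proof (cases "{v\<in>V. repeated V E v} \<subseteq> S")
    case True
    then show ?thesis using less by blast
  next
    case False
    then obtain v where v: "v \<in> V" "repeated V E v" "v \<notin> S" by blast
    define u where "u = (LEAST u. u \<in> V \<and> twins V E u v)"
    have "u \<in> V \<and> twins V E u v"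
      unfolding u_def
      by (rule LeastI[where P = "\<lambda>u. u \<in> V \<and> twins V E u v" and k = v]) (simp add: v(1) twins_refl)
    then have u: "u \<in> V" "twins V E u v" by simp_all
    have "\<not> repeated V E u"
    proof
      assume "repeated V E u"
      then obtain w where "w \<in> V" "w < u" "twins V E w u" by (auto simp: repeated_def)
      with u(2) twins_trans[of V E w u v] have "w \<in> V \<and> twins V E w v" by blast
      then have "u \<le> w" unfolding u_def by (rule Least_le)
      with \<open>w < u\<close> show False by simp
    qed
    with v(2) have "u \<noteq> v" by blast
    then have "u \<in> S" using resolving_set_twins[OF less.prems u(1) v(1) u(2)] v(3) by blast
    define S' where "S' = swap u v ` S"
    have S': "S' = insert v (S - {u})" unfolding S'_def using \<open>u \<in> S\<close> v(3) by (rule swap_image)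
    have "{v\<in>V. repeated V E v} - S' \<subset> {v\<in>V. repeated V E v} - S"
      using v \<open>\<not> repeated V E u\<close> by (auto simp: S')
    then have "card ({v\<in>V. repeated V E v} - S') < card ({v\<in>V. repeated V E v} - S)"
      using assms(1) by (intro psubset_card_mono) auto
    moreover have "resolving_set V E S'"
      unfolding S'_def using less.prems u v by (intro resolving_set_swap) auto
    ultimately show ?thesis using less.hyps[of S'] by (simp add: S'_def card_swap_image)
  qed
qed

text \<open>On a shortest path through \<open>v\<close>, the neighbours \<open>a\<close> and
  \<open>b\<close> of \<open>v\<close> towards the two ends would be equal or adjacent, and
  bypassing \<open>v\<close> would shorten the path.\<close>

lemma simplicial_in_geodetic_set:
  assumes "geodetic_set V E S" "v \<in> V" "simplicial V E v"
  shows "v \<in> S"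
proof (rule ccontr)
  assume "v \<notin> S"
  obtain s t where st: "s \<in> S" "t \<in> S" "s \<in> V" "t \<in> V" "covers V E s t v"
    using assms(1,2) geodetic_setE by metis
  have *: "\<exists>a\<in>V. {v, a} \<in> E \<and> (\<exists>i. gdist V E v s = enat (Suc i) \<and> gdist V E a s \<le> enat i)"
    if s: "s \<in> S" "s \<in> V" "gdist V E v s \<noteq> \<infinity>" for s
  proof -
    have "v \<noteq> s" using s \<open>v \<notin> S\<close> by blast
    then have "gdist V E v s \<noteq> 0" using gdist_eq_0_iff[of v V E s] assms by blast
    then obtain i where i: "gdist V E v s = enat (Suc i)"
      using s(3) by (cases "gdist V E v s") (auto simp: zero_enat_def gr0_conv_Suc)
    then show ?thesis using gdist_le_Suc[of v V s E i] s assms \<open>v \<noteq> s\<close> by auto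
  qed
  have "gdist V E v s \<noteq> \<infinity>" "gdist V E v t \<noteq> \<infinity>"
    using covers_finite[OF st(5)] gdist_commute[of V E s v] by simp_all
  from *[OF st(1,3) this(1)] *[OF st(2,4) this(2)] obtain a i b j where
    a: "a \<in> V" "{v, a} \<in> E" "gdist V E v s = enat (Suc i)" "gdist V E a s \<le> enat i" and
    b: "b \<in> V" "{v, b} \<in> E" "gdist V E v t = enat (Suc j)" "gdist V E b t \<le> enat j"
    by blast
  have "gdist V E a b \<le> enat 1"
    using gdist_le_1[OF a(1) b(1), of E] a b assms by (auto simp: simplicial_def)
  then have "gdist V E a t \<le> enat (1 + j)"
    using gdist_triangle_aux[of a V t b E 1 j] a b st by blast
  then have "gdist V E s t \<le> enat (i + (1 + j))"
    using gdist_triangle_aux[of s V t a E i "1 + j"] a b st gdist_commute[of V E a s] by simp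
  moreover have "gdist V E s t = enat (Suc i + Suc j)"
    using st a b gdist_commute[of V E s v] by (simp add: covers_def)
  ultimately show False by simp
qed

text \<open>Two of the twins in \<open>C\<close> cover the common neighbourhood and two nonadjacent common neighbours
  cover \<open>C\<close>, so four vertices do the work of five.\<close>

lemma geodetic_set_reduce:
  assumes G: "simple_graph V E" and S: "geodetic_set V E S"
    and C: "C \<subseteq> S" "card C = 5" "\<And>u v. u \<in> C \<Longrightarrow> v \<in> C \<Longrightarrow> twins V E u v"
    and "c \<in> C" "\<not> simplicial V E c"
  shows "\<exists>S' A. geodetic_set V E S' \<and> card S' < card S \<and> S' \<subseteq> S \<union> A \<and> finite A \<and> card A \<le> 4"
proof -
  have SV: "S \<subseteq> V" and CV: "C \<subseteq> V" using S C by (auto simp: geodetic_set_iff)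
  have fin: "finite V" "finite S" "finite C" using G SV CV finite_subset by (auto simp: simple_graph_def)
  obtain a b where ab: "a \<in> V" "b \<in> V" "{c, a} \<in> E" "{c, b} \<in> E" "a \<noteq> b" "{a, b} \<notin> E"
    using assms(7) by (auto simp: simplicial_def)
  obtain c1 c2 where c12: "c1 \<in> C" "c2 \<in> C" "c1 \<noteq> c2"
  proof -
    have "\<not> card C \<le> Suc 0" using C(2) by simp
    then show thesis using that card_le_Suc0_iff_eq[OF fin(3)] by blast
  qed
  have adj: "{d, x} \<in> E \<longleftrightarrow> {c, x} \<in> E" if "d \<in> C" "x \<in> V" for d x
    using C(3)[OF that(1) \<open>c \<in> C\<close>] that by (auto simp: twins_def)
  define A where "A = {c1, c2, a, b}"
  define S' where "S' = (S - C) \<union> A"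
  have "card A \<le> 4" by (simp add: A_def card_insert_if)
  have "card S' \<le> card (S - C) + card A" unfolding S'_def by (rule card_Un_le)
  moreover have "card (S - C) + 5 = card S"
    using C fin card_mono[of S C] by (simp add: card_Diff_subset)
  ultimately have "card S' < card S" using \<open>card A \<le> 4\<close> by linarith
  \<comment> \<open>The fixed member \<open>c1\<close> can stand in for any other member of
    \<open>C\<close> as one end of a covering pair, as long as the other end and the covered vertex
    are outside \<open>C\<close>.\<close>
  have half: "covers V E c1 t x" if "s \<in> C" "t \<in> V" "t \<notin> C" "x \<in> V" "x \<notin> C" "covers V E s t x" for s t x
  proof (cases "s = c1")
    case False
    then show ?thesis using that c12 C CV by (intro covers_twins_end[of s V c1 t x E]) auto
  qed (use that in simp)
  have "geodetic_set V E S'"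
    unfolding geodetic_set_iff
  proof (intro conjI ballI)
    show "S' \<subseteq> V" using SV CV c12 ab by (auto simp: S'_def A_def)
  next
    fix x assume x: "x \<in> V"
    consider "x \<in> C" | "{x, c} \<in> E" | "x \<notin> C" "{x, c} \<notin> E" by blast
    then show "\<exists>s\<in>S'. \<exists>t\<in>S'. covers V E s t x"
    proof cases
      case 1
      then have "covers V E a b x"
        using ab x adj by (intro covers_common_neighbour[OF G]) auto
      then show ?thesis by (auto simp: S'_def A_def)
    next
      case 2
      then have "{x, d} \<in> E" if "d \<in> C" for d using adj[OF that x] by (simp add: insert_commute)
      moreover have "{c1, c2} \<notin> E"
        using twins_not_adjacent[OF G _ C(3)[OF c12(1,2)]] c12(2) CV by blast
      ultimately have "covers V E c1 c2 x"
        using c12 x CV by (intro covers_common_neighbour[OF G]) auto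
      then show ?thesis by (auto simp: S'_def A_def)
    next
      case 3
      obtain s t where st: "s \<in> S" "t \<in> S" "covers V E s t x"
        using S x unfolding geodetic_set_iff by blast
      then have stV: "s \<in> V" "t \<in> V" using SV by auto
      consider "s \<in> C" "t \<in> C" | "s \<in> C" "t \<notin> C" | "s \<notin> C" "t \<in> C" | "s \<notin> C" "t \<notin> C" by blast
      then show ?thesis
      proof cases
        case 1
        \<comment> \<open>This case is impossible: two members of \<open>C\<close> have the common
          neighbour \<open>a\<close> and hence distance 2, so a vertex strictly between them is
          adjacent to \<open>C\<close>.\<close>
        have "s \<noteq> t" using covers_same_ends[OF x stV(1)] st(3) 3(1) 1(1) by blast
        moreover have "{s, t} \<notin> E" using twins_not_adjacent[OF G stV(2) C(3)[OF 1]] .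
        moreover have "{a, s} \<in> E" "{a, t} \<in> E"
          using adj[OF 1(1) ab(1)] adj[OF 1(2) ab(1)] ab by (auto simp: insert_commute)
        ultimately have "gdist V E s t = enat 2"
          using covers_common_neighbour(2)[OF G ab(1) stV] by blast
        moreover have "gdist V E s x \<noteq> 0" "gdist V E x t \<noteq> 0"
          using gdist_eq_0_iff[of s V E x] gdist_eq_0_iff[of x V E t] x stV 1 3 by auto
        ultimately have "gdist V E s x \<le> enat 1"
          using st(3) by (cases "gdist V E s x"; cases "gdist V E x t") (auto simp: covers_def zero_enat_def)
        then have "{s, x} \<in> E" using gdist_le_1[OF stV(1) x, of E] 1 3 by auto
        then have "{c, x} \<in> E" using adj[OF 1(1) x] by blast
        with 3 show ?thesis by (simp add: insert_commute)
      next
        case 2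
        then have "covers V E c1 t x" using half[of s t x] st(3) stV x 3 by blast
        then show ?thesis using st 2 by (auto simp: S'_def A_def)
      next
        case s: 3
        have "covers V E t s x" using st(3) covers_commute[of V E s t x] by blast
        then have "covers V E c1 s x" using half[of t s x] s stV x 3 by blast
        then show ?thesis using st s by (auto simp: S'_def A_def)
      next
        case 4
        then show ?thesis using st by (auto simp: S'_def)
      qed
    qed
  qed
  then show ?thesis
    using \<open>card S' < card S\<close> \<open>card A \<le> 4\<close>
    by (intro exI[of _ S'] exI[of _ A]) (auto simp: S'_def A_def)
qed

text \<open>Positions in the increasing enumeration, starting at 0. They select the first five
  twins, number the vertices of the kernel and serve as digits in the enumeration of
  candidates.\<close>

definition rank :: "nat set \<Rightarrow> nat \<Rightarrow> nat" where
  "rank K v = card {u\<in>K. u < v}"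

lemma bij_betw_rank:
  assumes "finite K"
  shows "bij_betw (rank K) K {..<card K}"
proof -
  have mono: "rank K u < rank K v" if "u \<in> K" "v \<in> K" "u < v" for u v
    unfolding rank_def using assms that by (intro psubset_card_mono) auto
  then have "inj_on (rank K) K"
    by (intro inj_onI) (metis less_irrefl linorder_neqE_nat)
  moreover have "rank K ` K \<subseteq> {..<card K}"
    unfolding rank_def using assms by (auto intro!: psubset_card_mono)
  ultimately have "rank K ` K = {..<card K}"
    by (intro card_subset_eq) (auto simp: card_image)
  with \<open>inj_on (rank K) K\<close> show ?thesis by (simp add: bij_betw_def)
qed

definition kept :: "nat set \<Rightarrow> nat set set \<Rightarrow> nat \<Rightarrow> bool" where
  "kept V E v \<longleftrightarrow> card {u\<in>V. u < v \<and> twins V E u v} < 5"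

text \<open>The first five members of the class of \<open>v\<close> all precede \<open>v\<close>,
  and they are kept by definition.\<close>

lemma not_kept_twins:
  assumes "finite V" "v \<in> V" "\<not> kept V E v"
  shows "\<exists>C\<subseteq>{u\<in>V. kept V E u}. card C = 5 \<and> (\<forall>c\<in>C. c < v \<and> twins V E c v)"
proof -
  define B where "B = {u\<in>V. u < v \<and> twins V E u v}"
  have fin: "finite B" and B5: "5 \<le> card B" using assms by (auto simp: B_def kept_def)
  define C where "C = {u\<in>B. rank B u < 5}"
  have C: "C = inv_into B (rank B) ` {..<5}"
  proof -
    have bij: "bij_betw (rank B) B {..<card B}" using fin by (rule bij_betw_rank)
    show ?thesis
    proof (intro equalityI subsetI)
      fix u assume "u \<in> C"
      then show "u \<in> inv_into B (rank B) ` {..<5}"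
        using bij by (intro image_eqI[of _ _ "rank B u"]) (auto simp: C_def bij_betw_def)
    next
      fix u assume "u \<in> inv_into B (rank B) ` {..<5}"
      then obtain i where i: "i < 5" "u = inv_into B (rank B) i" by auto
      moreover have "i \<in> rank B ` B" using bij i B5 by (auto simp: bij_betw_def)
      ultimately show "u \<in> C" unfolding C_def
        using inv_into_into[of i "rank B" B] f_inv_into_f[of i "rank B" B] by auto
    qed
  qed
  have "inj_on (inv_into B (rank B)) {..<5}"
    using bij_betw_rank[OF fin] B5 by (intro inj_on_inv_into) (auto simp: bij_betw_def)
  then have "card C = 5" by (simp add: C card_image)
  moreover have "kept V E u" if "u \<in> C" for u
  proof -
    \<comment> \<open>The class of \<open>u\<close> below \<open>u\<close> is the class of
      \<open>v\<close> below \<open>u\<close>, so for members of \<open>B\<close> being kept means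
      having rank below 5 in \<open>B\<close>.\<close>
    have "{w\<in>V. w < u \<and> twins V E w u} = {w\<in>B. w < u}"
      using that twins_trans[of V E _ u v] twins_trans[of V E _ v u] twins_sym[of V E u v]
      by (auto simp: C_def B_def)
    then show ?thesis using that by (simp add: kept_def C_def rank_def)
  qed
  ultimately show ?thesis by (intro exI[of _ C]) (auto simp: C_def B_def)
qed

text \<open>What \<open>geodetic_set_reduce\<close> achieves by exhaustive application. It is part
  of the normal form because it yields, among any five twins that are not simplicial, one outside
  the solution.\<close>

definition nonredundant :: "'a set \<Rightarrow> 'a set set \<Rightarrow> 'a set \<Rightarrow> bool" where
  "nonredundant V E S \<longleftrightarrow> \<not> (\<exists>C\<subseteq>S. card C = 5 \<and>
     (\<forall>u\<in>C. \<forall>v\<in>C. twins V E u v) \<and> (\<exists>c\<in>C. \<not> simplicial V E c))"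

text \<open>The induction measure decreases both when five twins are replaced by four vertices and when
  a vertex is swapped for a kept twin.\<close>

lemma geodetic_set_normal_form:
  fixes V :: "nat set"
  assumes "simple_graph V E" "geodetic_set V E S"
  shows "\<exists>S'. geodetic_set V E S' \<and> card S' \<le> card S \<and> {v\<in>V. simplicial V E v} \<subseteq> S' \<and>
    S' \<subseteq> {v\<in>V. simplicial V E v \<or> kept V E v} \<and> nonredundant V E S'"
  using assms(2)
proof (induction "6 * card S + card (S - {v\<in>V. kept V E v})" arbitrary: S rule: less_induct)
  case less
  let ?K = "{v\<in>V. kept V E v}"
  have SV: "S \<subseteq> V" and fin: "finite V" "finite S"
    using less.prems assms(1) finite_subset by (auto simp: geodetic_set_iff simple_graph_def)
  show ?case
  proof (cases "nonredundant V E S")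
    case False
    then obtain C c where C: "C \<subseteq> S" "card C = 5" "\<forall>u\<in>C. \<forall>v\<in>C. twins V E u v" "c \<in> C" "\<not> simplicial V E c"
      by (auto simp: nonredundant_def)
    obtain S' A where S': "geodetic_set V E S'" "card S' < card S" "S' \<subseteq> S \<union> A" "finite A" "card A \<le> 4"
      using geodetic_set_reduce[OF assms(1) less.prems C(1,2) _ C(4,5)] C(3) by blast
    have "card (S' - ?K) \<le> card ((S - ?K) \<union> A)"
      using S' fin by (intro card_mono) auto
    also have "\<dots> \<le> card (S - ?K) + card A" by (rule card_Un_le)
    \<comment> \<open>The first summand drops by at least 6, and the at most four new vertices raise
      the second by at most 4.\<close>
    finally have "6 * card S' + card (S' - ?K) < 6 * card S + card (S - ?K)" using S' by linarith
    from less.hyps[OF this S'(1)] S'(2) show ?thesis by (meson order_trans less_imp_le)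
  next
    case nr: True
    show ?thesis
    proof (cases "S \<subseteq> {v\<in>V. simplicial V E v \<or> kept V E v}")
      case True
      then show ?thesis
        using less.prems nr simplicial_in_geodetic_set by (intro exI[of _ S]) auto
    next
      case False
      then obtain u where u: "u \<in> S" "u \<in> V" "\<not> simplicial V E u" "\<not> kept V E u" using SV by blast
      obtain C where C: "C \<subseteq> ?K" "card C = 5" "\<forall>c\<in>C. c < u \<and> twins V E c u"
        using not_kept_twins[OF fin(1) u(2,4)] by blast
      have "\<forall>x\<in>C. \<forall>y\<in>C. twins V E x y"
      proof (intro ballI)
        fix x y assume "x \<in> C" "y \<in> C"
        then have "twins V E x u" "twins V E u y" using C(3) twins_sym[of V E y u] by simp_all
        then show "twins V E x y" by (rule twins_trans)
      qed
      moreover have "\<not> simplicial V E c" if "c \<in> C" for c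
        using C(3) u(3) that simplicial_twins[of V E c u] by simp
      moreover have "C \<noteq> {}" using C(2) by auto
      \<comment> \<open>Here nonredundancy pays off: one of the five kept twins of \<open>u\<close>
        is still free to take its place.\<close>
      ultimately have "\<not> C \<subseteq> S" using nr C(2) unfolding nonredundant_def by (meson ex_in_conv)
      then obtain w where w: "w \<in> C" "w \<notin> S" by blast
      then have wK: "w \<in> V" "kept V E w" "twins V E u w" using C twins_sym[of V E w u] by auto
      define S' where "S' = swap u w ` S"
      have S': "S' = insert w (S - {u})" unfolding S'_def using u(1) w(2) by (rule swap_image)
      have "S' - ?K \<subset> S - ?K" using u wK by (auto simp: S')
      then have "card (S' - ?K) < card (S - ?K)" using fin by (intro psubset_card_mono) auto
      moreover have "geodetic_set V E S'"
        unfolding S'_def using less.prems u wK by (intro geodetic_set_swap) auto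
      moreover have "card S' = card S" by (simp add: S'_def card_swap_image)
      ultimately show ?thesis using less.hyps[of S'] by simp
    qed
  qed
qed

text \<open>Two vertices outside the set are not twins, since the later of two twins is repeated. A
  vertex adjacent to exactly one of them must lie in \<open>X\<close>, and it has distance at most 1
  from that one only.\<close>

lemma resolving_set_vertex_cover:
  assumes "simple_graph V E" "X \<subseteq> V" "independent_set E (V - X)"
  shows "resolving_set V E ({v\<in>V. repeated V E v} \<union> X)"
proof (rule resolving_setI)
  fix u v assume uv: "u \<in> V" "v \<in> V" "u \<noteq> v"
    "u \<notin> {v\<in>V. repeated V E v} \<union> X" "v \<notin> {v\<in>V. repeated V E v} \<union> X"
  have "\<not> twins V E u v"
    using uv twins_sym[of V E] by (metis (no_types, lifting) UnCI linorder_neqE_nat mem_Collect_eq repeated_def)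
  then obtain w where w: "w \<in> V" "{u, w} \<in> E \<longleftrightarrow> {v, w} \<notin> E" by (auto simp: twins_def)
  have "w \<in> X"
  proof (rule ccontr)
    assume "w \<notin> X"
    with w uv assms(3) show False by (auto simp: independent_set_def)
  qed
  moreover have "gdist V E w u \<le> enat 1 \<longleftrightarrow> {u, w} \<in> E" "gdist V E w v \<le> enat 1 \<longleftrightarrow> {v, w} \<in> E"
    using gdist_le_1[of w V u E] gdist_le_1[of w V v E] w uv \<open>w \<in> X\<close> by (auto simp: insert_commute)
  ultimately show "\<exists>w\<in>{v\<in>V. repeated V E v} \<union> X. gdist V E w u \<noteq> gdist V E w v"
    using w(2) by (intro bexI[of _ w]) auto
qed (use assms in auto)

text \<open>A vertex outside the set has two nonadjacent neighbours because it is not simplicial,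
  and all its neighbours lie in \<open>X\<close>.\<close>

lemma geodetic_set_vertex_cover:
  assumes "simple_graph V E" "X \<subseteq> V" "independent_set E (V - X)"
  shows "geodetic_set V E ({v\<in>V. simplicial V E v} \<union> X)"
  unfolding geodetic_set_iff
proof (intro conjI ballI)
  fix u assume u: "u \<in> V"
  let ?S = "{v\<in>V. simplicial V E v} \<union> X"
  show "\<exists>s\<in>?S. \<exists>t\<in>?S. covers V E s t u"
  proof (cases "u \<in> ?S")
    case True
    then show ?thesis using covers_self[OF u] by blast
  next
    case False
    then obtain a b where ab: "a \<in> V" "b \<in> V" "{u, a} \<in> E" "{u, b} \<in> E" "a \<noteq> b" "{a, b} \<notin> E"
      using u by (auto simp: simplicial_def)
    moreover from this have "a \<in> X" "b \<in> X"
      using False u assms(3) by (auto simp: independent_set_def)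
    ultimately show ?thesis using covers_common_neighbour(1)[OF assms(1) u] by blast
  qed
qed (use assms in auto)

text \<open>Outside \<open>X\<close> a vertex has its neighbourhood inside \<open>X\<close>, so
  there are at most \<open>2 ^ card X\<close> classes, each with at most five kept members; the
  vertices of \<open>X\<close> are counted one by one.\<close>

lemma card_kept:
  assumes "finite V" "X \<subseteq> V" "independent_set E (V - X)"
  shows "card {v\<in>V. kept V E v} \<le> card X + 5 * 2 ^ card X"
proof -
  define A where "A = (\<lambda>Y. {v\<in>V. kept V E v \<and> v \<notin> X \<and> {w\<in>V. {v, w} \<in> E} = Y})"
  have finX: "finite X" using assms finite_subset by blast
  have finA: "finite (A Y)" for Y using assms(1) by (simp add: A_def)
  have "{v\<in>V. kept V E v} \<subseteq> X \<union> (\<Union>Y\<in>Pow X. A Y)"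
  proof
    fix v assume v: "v \<in> {v\<in>V. kept V E v}"
    show "v \<in> X \<union> (\<Union>Y\<in>Pow X. A Y)"
    proof (cases "v \<in> X")
      case False
      then have "{w\<in>V. {v, w} \<in> E} \<in> Pow X"
        using v assms(3) by (auto simp: independent_set_def)
      moreover have "v \<in> A {w\<in>V. {v, w} \<in> E}" using v False by (simp add: A_def)
      ultimately show ?thesis by blast
    qed simp
  qed
  then have "card {v\<in>V. kept V E v} \<le> card (X \<union> (\<Union>Y\<in>Pow X. A Y))"
    using finX finA by (intro card_mono finite_UnI finite_UN_I) simp_all
  also have "\<dots> \<le> card X + card (\<Union>Y\<in>Pow X. A Y)" by (rule card_Un_le)
  also have "card (\<Union>Y\<in>Pow X. A Y) \<le> (\<Sum>Y\<in>Pow X. card (A Y))" using finX by (intro card_UN_le) simp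
  also have "\<dots> \<le> (\<Sum>Y\<in>Pow X. 5)"
  proof (rule sum_mono)
    fix Y
    have fin: "finite (A Y)" by (rule finA)
    have "rank (A Y) v < 5" if v: "v \<in> A Y" for v
    proof -
      have tw: "twins V E u v" if "u \<in> A Y" for u
      proof -
        have "{w\<in>V. {u, w} \<in> E} = {w\<in>V. {v, w} \<in> E}" using that v by (simp add: A_def)
        then show ?thesis unfolding twins_def by blast
      qed
      have "A Y \<subseteq> V" by (auto simp: A_def)
      then have "{u\<in>A Y. u < v} \<subseteq> {u\<in>V. u < v \<and> twins V E u v}" using tw by blast
      then have "card {u\<in>A Y. u < v} \<le> card {u\<in>V. u < v \<and> twins V E u v}"
        using assms by (intro card_mono) auto
      then show ?thesis using v by (simp add: rank_def A_def kept_def)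
    qed
    then have "rank (A Y) ` A Y \<subseteq> {..<5}" by auto
    then have "{..<card (A Y)} \<subseteq> {..<5}" using bij_betw_rank[OF fin] by (simp add: bij_betw_def)
    then show "card (A Y) \<le> 5" by (simp add: lessThan_subset_iff)
  qed
  also have "\<dots> = 5 * 2 ^ card X" using finX by (simp add: card_Pow)
  finally show ?thesis by simp
qed

lemma vc_witness:
  assumes "finite V"
  obtains X where "X \<subseteq> V" "card X = vc V E" "independent_set E (V - X)"
proof -
  have "\<exists>X\<subseteq>V. card X = vc V E \<and> independent_set E (V - X)"
    unfolding vc_def
    by (rule LeastI[where P = "\<lambda>m. \<exists>X\<subseteq>V. card X = m \<and> independent_set E (V - X)" and k = "card V"])
      (auto simp: independent_set_def)
  then show thesis using that by blast
qed


section \<open>Deleting twins\<close>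

lemma twins_adjacent_iff:
  assumes "twins V E u v" "w \<in> V"
  shows "{w, u} \<in> E \<longleftrightarrow> {w, v} \<in> E"
proof -
  have "{w, u} = {u, w}" "{w, v} = {v, w}" by auto
  then show ?thesis using assms by (simp only: twins_def)
qed

text \<open>An induced subgraph obtained by deleting vertices, given by an embedding because the
  kernel is renumbered. By \<open>rich\<close>, each deleted vertex has a remaining twin that avoids
  any four given vertices (\<open>twin_avoiding\<close>).\<close>

locale twin_reduction =
  fixes V :: "'a set" and E :: "'a set set" and V' :: "'b set" and E' :: "'b set set" and \<iota> :: "'b \<Rightarrow> 'a"
  assumes graph: "simple_graph V E" and graph': "simple_graph V' E'"
    and inj: "inj_on \<iota> V'" and into: "\<iota> ` V' \<subseteq> V"
    and edge: "\<And>i j. i \<in> V' \<Longrightarrow> j \<in> V' \<Longrightarrow> {i, j} \<in> E' \<longleftrightarrow> {\<iota> i, \<iota> j} \<in> E"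
    and rich: "\<And>v. v \<in> V \<Longrightarrow> v \<notin> \<iota> ` V' \<Longrightarrow> \<exists>C\<subseteq>V'. card C = 5 \<and> (\<forall>c\<in>C. twins V E v (\<iota> c))"
begin

lemma emb [simp]: "i \<in> V' \<Longrightarrow> \<iota> i \<in> V"
  using into by blast

lemma emb_eq_iff [simp]: "i \<in> V' \<Longrightarrow> j \<in> V' \<Longrightarrow> \<iota> i = \<iota> j \<longleftrightarrow> i = j"
  using inj by (auto dest: inj_onD)

lemma fin: "finite V" "finite V'"
  using graph graph' by (auto simp: simple_graph_def)

lemma twin_avoiding:
  assumes "v \<in> V" "v \<notin> \<iota> ` V'" "finite Z" "card Z \<le> 4"
  obtains c where "c \<in> V'" "twins V E v (\<iota> c)" "c \<notin> Z"
proof -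
  obtain C where C: "C \<subseteq> V'" "card C = 5" "\<forall>c\<in>C. twins V E v (\<iota> c)" using rich[OF assms(1,2)] by blast
  have "\<not> C \<subseteq> Z" using card_mono[OF assms(3), of C] C(2) assms(4) by auto
  then show thesis using that C by blast
qed

text \<open>Induction on the threshold: a first step to a deleted vertex is redirected to a
  remaining twin other than the target, which has the same neighbours and the same distance to the
  target.\<close>

lemma gdist_emb:
  assumes "i \<in> V'" "j \<in> V'"
  shows "gdist V' E' i j = gdist V E (\<iota> i) (\<iota> j)"
proof (rule enat_le_eqI)
  fix m
  show "gdist V' E' i j \<le> enat m \<longleftrightarrow> gdist V E (\<iota> i) (\<iota> j) \<le> enat m"
    using assms(1)
  proof (induction m arbitrary: i)
    case 0
    then show ?case using assms by (simp add: gdist_le_0)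
  next
    case (Suc m)
    have "(\<exists>w\<in>V. {\<iota> i, w} \<in> E \<and> gdist V E w (\<iota> j) \<le> enat m) \<longleftrightarrow>
        (\<exists>k\<in>V'. {\<iota> i, \<iota> k} \<in> E \<and> gdist V E (\<iota> k) (\<iota> j) \<le> enat m)" if "i \<noteq> j"
    proof
      assume "\<exists>w\<in>V. {\<iota> i, w} \<in> E \<and> gdist V E w (\<iota> j) \<le> enat m"
      then obtain w where w: "w \<in> V" "{\<iota> i, w} \<in> E" "gdist V E w (\<iota> j) \<le> enat m" by blast
      show "\<exists>k\<in>V'. {\<iota> i, \<iota> k} \<in> E \<and> gdist V E (\<iota> k) (\<iota> j) \<le> enat m"
      proof (cases "w \<in> \<iota> ` V'")
        case True
        with w show ?thesis by blast
      next
        case False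
        then obtain k where k: "k \<in> V'" "twins V E w (\<iota> k)" "k \<notin> {j}"
          by (rule twin_avoiding[OF w(1), of "{j}"]) simp_all
        then have "gdist V E w (\<iota> j) = gdist V E (\<iota> k) (\<iota> j)"
          using w(1) False assms(2) by (intro gdist_twins) auto
        moreover have "{\<iota> i, \<iota> k} \<in> E"
          using twins_adjacent_iff[OF k(2), of "\<iota> i"] w(2) Suc.prems by simp
        ultimately show ?thesis using k(1) w(3) by auto
      qed
    qed auto
    then show ?case
      using Suc.prems assms(2) by (auto simp: gdist_le_Suc edge Suc.IH)
  qed
qed

lemma covers_emb:
  assumes "s \<in> V'" "t \<in> V'" "u \<in> V'"
  shows "covers V' E' s t u \<longleftrightarrow> covers V E (\<iota> s) (\<iota> t) (\<iota> u)"
  using assms by (simp add: covers_def gdist_emb)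

text \<open>A deleted vertex that tests adjacency can be replaced by a remaining twin, which gives
  the same answers.\<close>

lemma twins_emb:
  assumes "i \<in> V'" "j \<in> V'"
  shows "twins V' E' i j \<longleftrightarrow> twins V E (\<iota> i) (\<iota> j)"
proof
  assume tw: "twins V' E' i j"
  show "twins V E (\<iota> i) (\<iota> j)"
    unfolding twins_def
  proof
    fix w assume w: "w \<in> V"
    obtain k where k: "k \<in> V'" "twins V E w (\<iota> k)"
    proof (cases "w \<in> \<iota> ` V'")
      case True
      then show thesis using that twins_refl[of V E w] by blast
    next
      case False
      then show thesis using that twin_avoiding[OF w False, of "{}"] by auto
    qed
    show "{\<iota> i, w} \<in> E \<longleftrightarrow> {\<iota> j, w} \<in> E"
      using tw k(1) assms twins_adjacent_iff[OF k(2), of "\<iota> i"] twins_adjacent_iff[OF k(2), of "\<iota> j"]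
      by (simp add: twins_def edge)
  qed
next
  assume "twins V E (\<iota> i) (\<iota> j)"
  then show "twins V' E' i j" using assms by (simp add: twins_def edge)
qed

lemma twins_embI: "i \<in> V' \<Longrightarrow> j \<in> V' \<Longrightarrow> twins V E (\<iota> i) (\<iota> j) \<Longrightarrow> twins V' E' i j"
  by (simp add: twins_emb)

text \<open>The delicate direction leads to the big graph: two different neighbours have to be
  represented by remaining twins that are still different, before simpliciality in the small graph
  can be applied.\<close>

lemma simplicial_emb:
  assumes "i \<in> V'"
  shows "simplicial V' E' i \<longleftrightarrow> simplicial V E (\<iota> i)"
proof
  assume s: "simplicial V' E' i"
  show "simplicial V E (\<iota> i)"
    unfolding simplicial_def
  proof (intro ballI impI)
    fix a b assume ab: "a \<in> V" "b \<in> V" "{\<iota> i, a} \<in> E \<and> {\<iota> i, b} \<in> E \<and> a \<noteq> b"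
    have *: "\<exists>k\<in>V'. k \<noteq> z \<and> twins V E w (\<iota> k) \<and> (w = \<iota> k \<or> w \<notin> \<iota> ` V')"
      if "w \<in> V" "w \<notin> \<iota> ` V' \<or> w \<noteq> \<iota> z" for w z
    proof (cases "w \<in> \<iota> ` V'")
      case True
      then obtain k where "k \<in> V'" "w = \<iota> k" by blast
      then show ?thesis using that(2) twins_refl[of V E w] by auto
    next
      case False
      then show ?thesis using twin_avoiding[OF that(1) False, of "{z}"] by auto
    qed
    \<comment> \<open>The vertex that the representative of \<open>a\<close> must avoid: the
      preimage of \<open>b\<close>, if \<open>b\<close> remains. Otherwise the default
      \<open>i\<close> does no harm, as \<open>a\<close> is adjacent to \<open>\<iota> i\<close> and
      so differs from it.\<close>
    define za where "za = (if b \<in> \<iota> ` V' then inv_into V' \<iota> b else i)"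
    have "a \<notin> \<iota> ` V' \<or> a \<noteq> \<iota> za"
    proof (cases "b \<in> \<iota> ` V'")
      case True
      then show ?thesis using ab(3) f_inv_into_f[of b \<iota> V'] by (simp add: za_def)
    next
      case False
      have "a \<noteq> \<iota> i" using ab(3) simple_graph_no_loop[OF graph, of "\<iota> i"] by auto
      with False show ?thesis by (simp add: za_def)
    qed
    from *[OF ab(1) this] obtain k where k: "k \<in> V'" "k \<noteq> za" "twins V E a (\<iota> k)" by blast
    have "b \<notin> \<iota> ` V' \<or> b \<noteq> \<iota> k"
    proof (cases "b \<in> \<iota> ` V'")
      case True
      then show ?thesis using k(2) inv_into_f_f[OF inj k(1)] by (auto simp: za_def)
    qed simp
    from *[OF ab(2) this] obtain l where l: "l \<in> V'" "l \<noteq> k" "twins V E b (\<iota> l)" by blast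
    have a: "{x, a} \<in> E \<longleftrightarrow> {x, \<iota> k} \<in> E" if "x \<in> V" for x
      using twins_adjacent_iff[OF k(3) that] .
    have b: "{x, b} \<in> E \<longleftrightarrow> {x, \<iota> l} \<in> E" if "x \<in> V" for x
      using twins_adjacent_iff[OF l(3) that] .
    have "{i, k} \<in> E'" "{i, l} \<in> E'"
      using assms k(1) l(1) ab(3) a[of "\<iota> i"] b[of "\<iota> i"] by (simp_all add: edge)
    then have "{k, l} \<in> E'" using s k(1) l(1,2) unfolding simplicial_def by (metis insert_commute)
    then have "{\<iota> k, \<iota> l} \<in> E" using k(1) l(1) by (simp add: edge)
    then have "{\<iota> k, b} \<in> E" using b[of "\<iota> k"] k(1) by simp
    then have "{b, \<iota> k} \<in> E" by (simp add: insert_commute)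
    then have "{b, a} \<in> E" using a[of b] ab(2) by simp
    then show "{a, b} \<in> E" by (simp add: insert_commute)
  qed
next
  assume s: "simplicial V E (\<iota> i)"
  show "simplicial V' E' i"
    unfolding simplicial_def
  proof (intro ballI impI)
    fix a b assume "a \<in> V'" "b \<in> V'" "{i, a} \<in> E' \<and> {i, b} \<in> E' \<and> a \<noteq> b"
    then show "{a, b} \<in> E'" using s assms by (simp add: edge simplicial_def)
  qed
qed

section \<open>Moving solutions between the graph and its reduction\<close>

lemma card_restrict:
  assumes "finite S" "S \<subseteq> V"
  shows "card {i\<in>V'. \<iota> i \<in> S} + card (S - \<iota> ` V') = card S"
proof -
  have "card {i\<in>V'. \<iota> i \<in> S} = card (\<iota> ` {i\<in>V'. \<iota> i \<in> S})"
    using inj by (intro card_image[symmetric]) (auto intro: inj_on_subset)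
  also have "\<iota> ` {i\<in>V'. \<iota> i \<in> S} = S \<inter> \<iota> ` V'" by auto
  finally have "card {i\<in>V'. \<iota> i \<in> S} + card (S - \<iota> ` V') = card (S \<inter> \<iota> ` V') + card (S - \<iota> ` V')"
    by simp
  also have "\<dots> = card ((S \<inter> \<iota> ` V') \<union> (S - \<iota> ` V'))"
    using assms by (intro card_Un_disjoint[symmetric]) auto
  also have "(S \<inter> \<iota> ` V') \<union> (S - \<iota> ` V') = S" by blast
  finally show ?thesis .
qed

lemma card_extend:
  assumes "finite S" "finite R"
  shows "card (\<iota> ` S \<union> R) \<le> card S + card R"
  by (rule order_trans[OF card_Un_le]) (use card_image_le[OF assms(1), of \<iota>] in simp)

text \<open>A deleted vertex \<open>w\<close> that resolves a pair has two remaining twins, one of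
  which lies in \<open>S\<close> by \<open>resolving_set_twins\<close>; it has the same distances as
  \<open>w\<close> to the vertices outside \<open>S\<close>.\<close>

lemma resolving_set_restrict:
  assumes "resolving_set V E S" "V - \<iota> ` V' \<subseteq> S"
  shows "resolving_set V' E' {i\<in>V'. \<iota> i \<in> S}"
proof (rule resolving_setI)
  fix i j assume ij: "i \<in> V'" "j \<in> V'" "i \<noteq> j" "i \<notin> {i\<in>V'. \<iota> i \<in> S}" "j \<notin> {i\<in>V'. \<iota> i \<in> S}"
  then have "\<iota> i \<noteq> \<iota> j" "\<iota> i \<in> V" "\<iota> j \<in> V" by auto
  with assms(1) obtain w where w: "w \<in> S" "w \<in> V" "gdist V E w (\<iota> i) \<noteq> gdist V E w (\<iota> j)"
    unfolding resolving_set_def by (meson subsetD)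
  show "\<exists>k\<in>{i\<in>V'. \<iota> i \<in> S}. gdist V' E' k i \<noteq> gdist V' E' k j"
  proof (cases "w \<in> \<iota> ` V'")
    case True
    then obtain k where "k \<in> V'" "w = \<iota> k" by blast
    with w ij show ?thesis by (intro bexI[of _ k]) (simp_all add: gdist_emb)
  next
    case False
    obtain k where k: "k \<in> V'" "twins V E w (\<iota> k)" "k \<notin> {}"
      by (rule twin_avoiding[OF w(2) False, of "{}"]) simp_all
    obtain l where l: "l \<in> V'" "twins V E w (\<iota> l)" "l \<notin> {k}"
      by (rule twin_avoiding[OF w(2) False, of "{k}"]) simp_all
    have "twins V E (\<iota> k) (\<iota> l)" using twins_trans[OF twins_sym[OF k(2)] l(2)] .
    then have "\<iota> k \<in> S \<or> \<iota> l \<in> S"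
      using resolving_set_twins[OF assms(1), of "\<iota> k" "\<iota> l"] k(1) l(1,3) by auto
    then obtain m where m: "m \<in> V'" "twins V E w (\<iota> m)" "\<iota> m \<in> S" using k l by blast
    have "gdist V E w (\<iota> x) = gdist V' E' m x" if "x \<in> V'" "\<iota> x \<notin> S" for x
    proof -
      have "gdist V E w (\<iota> x) = gdist V E (\<iota> m) (\<iota> x)"
        using w(2) m that False by (intro gdist_twins) auto
      then show ?thesis using m(1) that by (simp add: gdist_emb)
    qed
    with w(3) ij m show ?thesis by (intro bexI[of _ m]) auto
  qed
qed auto

text \<open>By \<open>resolving_setI\<close> only pairs of remaining vertices are at issue, and
  their distances are those of the reduced graph.\<close>

lemma resolving_set_extend:
  assumes "resolving_set V' E' S"
  shows "resolving_set V E (\<iota> ` S \<union> (V - \<iota> ` V'))"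
proof (rule resolving_setI)
  have SV: "S \<subseteq> V'" using assms by (simp add: resolving_set_def)
  then show "\<iota> ` S \<union> (V - \<iota> ` V') \<subseteq> V" by auto
  fix u v assume uv: "u \<in> V" "v \<in> V" "u \<noteq> v" "u \<notin> \<iota> ` S \<union> (V - \<iota> ` V')" "v \<notin> \<iota> ` S \<union> (V - \<iota> ` V')"
  then obtain i j where ij: "i \<in> V'" "u = \<iota> i" "j \<in> V'" "v = \<iota> j" by auto
  with uv(3) have "i \<noteq> j" by auto
  then obtain k where k: "k \<in> S" "gdist V' E' k i \<noteq> gdist V' E' k j"
    using assms ij(1,3) unfolding resolving_set_def by meson
  moreover have "k \<in> V'" using k SV by blast
  ultimately show "\<exists>w\<in>\<iota> ` S \<union> (V - \<iota> ` V'). gdist V E w u \<noteq> gdist V E w v"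
    using ij by (intro bexI[of _ "\<iota> k"]) (simp_all add: gdist_emb)
qed

text \<open>Justifies rounding the parameter of the kernel up to 1. A set of at most one element
  would leave two of the five remaining twins of a deleted vertex unresolved.\<close>

lemma resolving_set_card_ge_2:
  assumes "resolving_set V' E' S" "V - \<iota> ` V' \<noteq> {}"
  shows "card S \<ge> 2"
proof (rule ccontr)
  assume "\<not> card S \<ge> 2"
  have "S \<subseteq> V'" using assms by (simp add: resolving_set_def)
  then have "finite S" using fin finite_subset by blast
  obtain w where w: "w \<in> V" "w \<notin> \<iota> ` V'" using assms(2) by blast
  obtain k where k: "k \<in> V'" "twins V E w (\<iota> k)" "k \<notin> S"
    by (rule twin_avoiding[OF w, of S]) (use \<open>finite S\<close> \<open>\<not> card S \<ge> 2\<close> in simp_all)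
  obtain l where l: "l \<in> V'" "twins V E w (\<iota> l)" "l \<notin> insert k S"
    by (rule twin_avoiding[OF w, of "insert k S"])
      (use \<open>finite S\<close> \<open>\<not> card S \<ge> 2\<close> in \<open>simp_all add: card_insert_if\<close>)
  have "twins V' E' k l"
    using k(1) l(1) twins_trans[OF twins_sym[OF k(2)] l(2)] by (rule twins_embI)
  then show False using resolving_set_twins[OF assms(1) k(1) l(1)] k(3) l(3) by blast
qed

text \<open>Deleted members of \<open>S\<close> are simplicial. Their remaining twins are simplicial
  too and hence belong to \<open>S\<close>, so they can take over as ends of covering pairs.\<close>

lemma geodetic_set_restrict:
  assumes "geodetic_set V E S" and S: "S \<subseteq> {v\<in>V. simplicial V E v} \<union> \<iota> ` V'"
  shows "geodetic_set V' E' {i\<in>V'. \<iota> i \<in> S}"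
  unfolding geodetic_set_iff
proof (intro conjI ballI)
  fix i assume i: "i \<in> V'"
  define x where "x = \<iota> i"
  have x: "x \<in> V" "x \<in> \<iota> ` V'" using i by (auto simp: x_def)
  have SV: "S \<subseteq> V" using assms(1) by (simp add: geodetic_set_iff)
  have *: "\<exists>s'\<in>S \<inter> \<iota> ` V'. covers V E s' t x" if st: "s \<in> S" "t \<in> S" "covers V E s t x" "x \<notin> S" for s t
  proof (cases "s \<in> \<iota> ` V'")
    case False
    have sV: "s \<in> V" "t \<in> V" using st SV by auto
    have "t \<noteq> s" using covers_same_ends[OF x(1) sV(1)] st by blast
    \<comment> \<open>At most one element. The replacement for \<open>s\<close> must differ from the
      other end \<open>t\<close>, for otherwise the distances between the ends could not be compared
      by \<open>gdist_twins\<close>.\<close>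
    define Z where "Z = {k\<in>V'. \<iota> k = t}"
    have Z: "Z \<subseteq> {inv_into V' \<iota> t}" using inv_into_f_f[OF inj] by (auto simp: Z_def)
    then have finZ: "finite Z" and cardZ: "card Z \<le> 4"
      using finite_subset[OF Z] card_mono[OF _ Z] by simp_all
    obtain k where k: "k \<in> V'" "twins V E s (\<iota> k)" "k \<notin> Z"
      by (rule twin_avoiding[OF sV(1) False finZ cardZ])
    have "simplicial V E s" using S st(1) False by blast
    then have "simplicial V E (\<iota> k)" using simplicial_twins[OF k(2)] by simp
    then have kS: "\<iota> k \<in> S" using simplicial_in_geodetic_set[OF assms(1)] k(1) by simp
    have "covers V E (\<iota> k) t x"
      using sV k x st kS False \<open>t \<noteq> s\<close> by (intro covers_twins_end[of s V "\<iota> k" t x E]) (auto simp: Z_def)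
    then show ?thesis using kS k(1) by blast
  qed (use st in blast)
  have "\<exists>s\<in>S \<inter> \<iota> ` V'. \<exists>t\<in>S \<inter> \<iota> ` V'. covers V E s t x"
  proof (cases "x \<in> S")
    case True
    then show ?thesis using x covers_self[OF x(1)] by blast
  next
    case False
    obtain s t where st: "s \<in> S" "t \<in> S" "covers V E s t x"
      using geodetic_setE[OF assms(1) x(1)] by metis
    from *[OF st False] obtain s' where s': "s' \<in> S \<inter> \<iota> ` V'" "covers V E s' t x" by blast
    then have "covers V E t s' x" using covers_commute[of V E s' t x] by blast
    from *[OF st(2) _ this False] s' obtain t' where t': "t' \<in> S \<inter> \<iota> ` V'" "covers V E t' s' x" by blast
    then show ?thesis using s'(1) by blast
  qed
  then obtain k l where "k \<in> V'" "\<iota> k \<in> S" "l \<in> V'" "\<iota> l \<in> S" "covers V E (\<iota> k) (\<iota> l) (\<iota> i)"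
    by (auto simp: x_def)
  then show "\<exists>s\<in>{i\<in>V'. \<iota> i \<in> S}. \<exists>t\<in>{i\<in>V'. \<iota> i \<in> S}. covers V' E' s t i"
    using covers_emb[of k l i] i by blast
qed auto

text \<open>A deleted vertex that is not simplicial has five remaining twins, one of them outside
  \<open>S\<close> by nonredundancy. The pair covering that twin has it strictly in between and
  therefore also covers the deleted vertex.\<close>

lemma geodetic_set_extend:
  assumes "geodetic_set V' E' S" "nonredundant V' E' S"
  shows "geodetic_set V E (\<iota> ` S \<union> {v\<in>V - \<iota> ` V'. simplicial V E v})"
  unfolding geodetic_set_iff
proof (intro conjI ballI)
  let ?T = "\<iota> ` S \<union> {v\<in>V - \<iota> ` V'. simplicial V E v}"
  have SV: "S \<subseteq> V'" using assms by (simp add: geodetic_set_iff)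
  then show "?T \<subseteq> V" by auto
  have *: "\<exists>s\<in>S. \<exists>t\<in>S. covers V E (\<iota> s) (\<iota> t) (\<iota> i)" if i: "i \<in> V'" for i
  proof -
    obtain s t where "s \<in> S" "t \<in> S" "s \<in> V'" "t \<in> V'" "covers V' E' s t i"
      using geodetic_setE[OF assms(1) i] by metis
    then show ?thesis using covers_emb[of s t i] i by blast
  qed
  fix u assume u: "u \<in> V"
  consider "u \<in> \<iota> ` V'" | "u \<in> ?T" | "u \<notin> \<iota> ` V'" "\<not> simplicial V E u" using u by blast
  then show "\<exists>s\<in>?T. \<exists>t\<in>?T. covers V E s t u"
  proof cases
    case 1
    then show ?thesis using * by blast
  next
    case 2
    then show ?thesis using covers_self[OF u] by blast
  next
    case 3
    obtain C where C: "C \<subseteq> V'" "card C = 5" "\<forall>c\<in>C. twins V E u (\<iota> c)" using rich[OF u 3(1)] by blast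
    have "\<forall>x\<in>C. \<forall>y\<in>C. twins V' E' x y"
    proof (intro ballI)
      fix x y assume xy: "x \<in> C" "y \<in> C"
      then have "twins V E (\<iota> x) u" "twins V E u (\<iota> y)" using C(3) twins_sym[of V E u "\<iota> x"] by simp_all
      then have "twins V E (\<iota> x) (\<iota> y)" by (rule twins_trans)
      then show "twins V' E' x y" using xy C(1) by (intro twins_embI) auto
    qed
    moreover obtain c where c: "c \<in> C" using C(2) by fastforce
    moreover have "\<not> simplicial V' E' c"
      using c C simplicial_emb[of c] simplicial_twins[of V E u "\<iota> c"] 3(2) by auto
    ultimately have "\<not> C \<subseteq> S" using assms(2) C(2) unfolding nonredundant_def by blast
    then obtain k where k: "k \<in> C" "k \<notin> S" by blast
    then have "k \<in> V'" using C by blast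
    then obtain s t where st: "s \<in> S" "t \<in> S" "covers V E (\<iota> s) (\<iota> t) (\<iota> k)" using * by blast
    then have stV: "s \<in> V'" "t \<in> V'" "k \<noteq> s" "k \<noteq> t" using SV k by auto
    have "twins V E (\<iota> k) u" using C(3) k(1) twins_sym[of V E u "\<iota> k"] by blast
    then have "covers V E (\<iota> s) (\<iota> t) u"
      using st(3) stV \<open>k \<in> V'\<close> u 3(1) by (intro covers_twins_mid[of "\<iota> s" V "\<iota> t" "\<iota> k" u E]) auto
    then show ?thesis using st(1,2) by blast
  qed
qed

text \<open>Again for rounding up to 1: a deleted simplicial vertex leaves five simplicial twins
  behind, and all of them are forced.\<close>

lemma geodetic_set_card_ge_2:
  assumes "geodetic_set V' E' S" "{v\<in>V - \<iota> ` V'. simplicial V E v} \<noteq> {}"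
  shows "card S \<ge> 2"
proof -
  have "S \<subseteq> V'" using assms by (simp add: geodetic_set_iff)
  then have "finite S" using fin finite_subset by blast
  obtain w where w: "w \<in> V" "w \<notin> \<iota> ` V'" "simplicial V E w" using assms(2) by blast
  obtain C where C: "C \<subseteq> V'" "card C = 5" "\<forall>c\<in>C. twins V E w (\<iota> c)" using rich[OF w(1,2)] by blast
  have "C \<subseteq> S"
  proof
    fix c assume c: "c \<in> C"
    then have "simplicial V' E' c"
      using C simplicial_emb[of c] simplicial_twins[of V E w "\<iota> c"] w(3) by auto
    then show "c \<in> S" using simplicial_in_geodetic_set[OF assms(1)] c C(1) by blast
  qed
  then have "card C \<le> card S" using \<open>finite S\<close> by (intro card_mono)
  then show ?thesis using C(2) by simp
qed

end


section \<open>A structured language compiled to the machine\<close>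

text \<open>Bounded sums make up for the missing multiplication. Combined with truncated subtraction
  they also give counting and bounded quantifiers, so most of the programs are single expressions
  with a denotational meaning.\<close>

datatype hexp =
    HC nat
  | HV nat
  | HA nat hexp
  | HPlus hexp hexp
  | HMinus hexp hexp
  | HGuard hexp hexp
  | HSum nat nat hexp

fun hval :: "hexp \<Rightarrow> (nat \<Rightarrow> nat) \<Rightarrow> (nat \<Rightarrow> nat \<Rightarrow> nat) \<Rightarrow> nat" where
  "hval (HC c) \<rho> A = c"
| "hval (HV x) \<rho> A = \<rho> x"
| "hval (HA a e) \<rho> A = A a (hval e \<rho> A)"
| "hval (HPlus e f) \<rho> A = hval e \<rho> A + hval f \<rho> A"
| "hval (HMinus e f) \<rho> A = hval e \<rho> A - hval f \<rho> A"
| "hval (HGuard e f) \<rho> A = (if hval e \<rho> A = 0 then 0 else hval f \<rho> A)"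
| "hval (HSum i b e) \<rho> A = (\<Sum>j<\<rho> b. hval e (\<rho>(i := j)) A)"

text \<open>All loops are bounded; the meaning \<open>hrun\<close> is therefore a total function and
  the cost a polynomial by structural recursion.\<close>

datatype hcom =
    HAsg nat hexp
  | HStore nat hexp hexp
  | HSeq hcom hcom
  | HIf hexp hcom
  | HFor nat nat hcom

definition set_reg :: "nat \<Rightarrow> nat \<Rightarrow> state \<Rightarrow> state" where
  "set_reg x v s = s\<lparr>reg := (reg s)(x := v)\<rparr>"

definition set_arr :: "nat \<Rightarrow> nat \<Rightarrow> nat \<Rightarrow> state \<Rightarrow> state" where
  "set_arr a i v s = s\<lparr>arr := (arr s)(a := (arr s a)(i := v))\<rparr>"

lemma set_simps [simp]:
  "reg (set_reg x v s) = (reg s)(x := v)" "arr (set_reg x v s) = arr s"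
  "reg (set_arr a i v s) = reg s" "arr (set_arr a i v s) = (arr s)(a := (arr s a)(i := v))"
  by (simp_all add: set_reg_def set_arr_def)

primrec loop :: "(nat \<Rightarrow> 's \<Rightarrow> 's) \<Rightarrow> nat \<Rightarrow> 's \<Rightarrow> 's" where
  "loop f 0 s = s"
| "loop f (Suc j) s = f j (loop f j s)"

primrec hrun :: "hcom \<Rightarrow> state \<Rightarrow> state" where
  "hrun (HAsg x e) = (\<lambda>s. set_reg x (hval e (reg s) (arr s)) s)"
| "hrun (HStore a e f) = (\<lambda>s. set_arr a (hval e (reg s) (arr s)) (hval f (reg s) (arr s)) s)"
| "hrun (HSeq c d) = (\<lambda>s. hrun d (hrun c s))"
| "hrun (HIf e c) = (\<lambda>s. if hval e (reg s) (arr s) = 0 then s else hrun c s)"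
| "hrun (HFor i b c) = (\<lambda>s. loop (\<lambda>j s'. hrun c (set_reg i j s')) (reg s b) s)"

text \<open>Temporaries live in the registers from \<open>d\<close> on; a loop keeps its own copy of the counter,
  so that its variable may be overwritten by the body.\<close>

fun hexp_com :: "nat \<Rightarrow> hexp \<Rightarrow> com" where
  "hexp_com d (HC c) = SetReg d (Const c)"
| "hexp_com d (HV x) = SetReg d (Reg x)"
| "hexp_com d (HA a e) = Seq (hexp_com d e) (SetReg d (Arr a (Reg d)))"
| "hexp_com d (HPlus e f) =
     Seq (hexp_com d e) (Seq (hexp_com (d + 1) f) (SetReg d (Add (Reg d) (Reg (d + 1)))))"
| "hexp_com d (HMinus e f) =
     Seq (hexp_com d e) (Seq (hexp_com (d + 1) f) (SetReg d (Sub (Reg d) (Reg (d + 1)))))"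
| "hexp_com d (HGuard e f) =
     Seq (hexp_com d e) (Cond (Eq (Reg d) (Const 0)) Skip (hexp_com d f))"
| "hexp_com d (HSum i b e) =
     Seq (SetReg d (Const 0)) (Seq (SetReg (d + 1) (Reg i)) (Seq (SetReg (d + 2) (Reg b))
     (Seq (SetReg (d + 3) (Const 0))
     (Seq (While (Less (Reg (d + 3)) (Reg (d + 2)))
        (Seq (SetReg i (Reg (d + 3))) (Seq (hexp_com (d + 4) e)
        (Seq (SetReg d (Add (Reg d) (Reg (d + 4)))) (SetReg (d + 3) (Add (Reg (d + 3)) (Const 1)))))))
     (SetReg i (Reg (d + 1)))))))"

primrec hcom_com :: "nat \<Rightarrow> hcom \<Rightarrow> com" where
  "hcom_com d (HAsg x e) = Seq (hexp_com d e) (SetReg x (Reg d))"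
| "hcom_com d (HStore a e f) =
     Seq (hexp_com d e) (Seq (hexp_com (d + 1) f) (SetArr a (Reg d) (Reg (d + 1))))"
| "hcom_com d (HSeq c c') = Seq (hcom_com d c) (hcom_com d c')"
| "hcom_com d (HIf e c) = Seq (hexp_com d e) (Cond (Eq (Reg d) (Const 0)) Skip (hcom_com d c))"
| "hcom_com d (HFor i b c) =
     Seq (SetReg d (Reg b)) (Seq (SetReg (d + 1) (Const 0))
     (While (Less (Reg (d + 1)) (Reg d))
        (Seq (SetReg i (Reg (d + 1))) (Seq (hcom_com (d + 2) c)
        (SetReg (d + 1) (Add (Reg (d + 1)) (Const 1)))))))"

text \<open>\<open>N\<close> is a common bound for all loop bounds. For \<open>HSum\<close>, the
  first 14 pays for four initialisations, the failing test and the restoration of \<open>i\<close>;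
  the 14 per round pays for the test, the assignment to \<open>i\<close> and two additions.\<close>

fun hexp_cost :: "hexp \<Rightarrow> nat \<Rightarrow> nat" where
  "hexp_cost (HC c) N = 2"
| "hexp_cost (HV x) N = 2"
| "hexp_cost (HA a e) N = hexp_cost e N + 3"
| "hexp_cost (HPlus e f) N = hexp_cost e N + hexp_cost f N + 4"
| "hexp_cost (HMinus e f) N = hexp_cost e N + hexp_cost f N + 4"
| "hexp_cost (HGuard e f) N = hexp_cost e N + hexp_cost f N + 5"
| "hexp_cost (HSum i b e) N = 14 + N * (hexp_cost e N + 14)"

primrec hcom_cost :: "hcom \<Rightarrow> nat \<Rightarrow> nat" where
  "hcom_cost (HAsg x e) N = hexp_cost e N + 2"
| "hcom_cost (HStore a e f) N = hexp_cost e N + hexp_cost f N + 3"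
| "hcom_cost (HSeq c c') N = hcom_cost c N + hcom_cost c' N"
| "hcom_cost (HIf e c) N = hexp_cost e N + hcom_cost c N + 5"
| "hcom_cost (HFor i b c) N = 8 + N * (hcom_cost c N + 10)"

text \<open>Loop bounds come from the registers in \<open>W\<close>, which change only as loop variables and hence stay
  below their initial bound; this is what makes every program run in polynomial time.\<close>

fun hexp_ok :: "nat \<Rightarrow> nat set \<Rightarrow> hexp \<Rightarrow> bool" where
  "hexp_ok D W (HC c) \<longleftrightarrow> True"
| "hexp_ok D W (HV x) \<longleftrightarrow> x < D"
| "hexp_ok D W (HA a e) \<longleftrightarrow> hexp_ok D W e"
| "hexp_ok D W (HPlus e f) \<longleftrightarrow> hexp_ok D W e \<and> hexp_ok D W f"
| "hexp_ok D W (HMinus e f) \<longleftrightarrow> hexp_ok D W e \<and> hexp_ok D W f"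
| "hexp_ok D W (HGuard e f) \<longleftrightarrow> hexp_ok D W e \<and> hexp_ok D W f"
| "hexp_ok D W (HSum i b e) \<longleftrightarrow> i < D \<and> b < D \<and> b \<in> W \<and> hexp_ok D W e"

primrec hcom_ok :: "nat \<Rightarrow> nat set \<Rightarrow> hcom \<Rightarrow> bool" where
  "hcom_ok D W (HAsg x e) \<longleftrightarrow> x < D \<and> x \<notin> W \<and> hexp_ok D W e"
| "hcom_ok D W (HStore a e f) \<longleftrightarrow> hexp_ok D W e \<and> hexp_ok D W f"
| "hcom_ok D W (HSeq c c') \<longleftrightarrow> hcom_ok D W c \<and> hcom_ok D W c'"
| "hcom_ok D W (HIf e c) \<longleftrightarrow> hexp_ok D W e \<and> hcom_ok D W c"
| "hcom_ok D W (HFor i b c) \<longleftrightarrow> i < D \<and> b < D \<and> b \<in> W \<and> hcom_ok D W c"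

lemma exec_SetReg: "exec (SetReg x e) s (acost e + 1) (set_reg x (aval e s) s)"
  unfolding set_reg_def by (rule exec.SetReg)

lemma exec_SetArr:
  "exec (SetArr a e f) s (acost e + acost f + 1) (set_arr a (aval e s) (aval f s) s)"
  unfolding set_arr_def by (rule exec.SetArr)

text \<open>For loops whose number \<open>m\<close> of rounds can be named in advance; one invariant
  then yields termination, result and time. The induction is on the number of rounds left.\<close>

lemma while_rule:
  assumes "\<And>j s. j < m \<Longrightarrow> I j s \<Longrightarrow> bval b s \<and> (\<exists>t s'. exec c s t s' \<and> I (Suc j) s' \<and> t \<le> T)"
    and "\<And>s. I m s \<Longrightarrow> \<not> bval b s"
    and "I 0 s"
  shows "\<exists>t s'. exec (While b c) s t s' \<and> I m s' \<and> t \<le> m * (T + bcost b + 1) + bcost b + 1"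
proof -
  have "\<exists>t s'. exec (While b c) s t s' \<and> I m s' \<and> t \<le> k * (T + bcost b + 1) + bcost b + 1"
    if "k \<le> m" "I (m - k) s" for k s
    using that
  proof (induction k arbitrary: s)
    case 0
    then show ?case using assms(2) exec.WhileFalse by fastforce
  next
    case (Suc k)
    from assms(1)[of "m - Suc k" s] Suc.prems obtain t s'
      where *: "bval b s" "exec c s t s'" "I (m - k) s'" "t \<le> T"
      by (auto simp: Suc_diff_Suc)
    from Suc.IH[OF _ *(3)] Suc.prems obtain t' s'' where
      **: "exec (While b c) s' t' s''" "I m s''" "t' \<le> k * (T + bcost b + 1) + bcost b + 1"
      by auto
    show ?case
      by (intro exI conjI, rule exec.WhileTrue[OF *(1,2) **(1)]) (use **(2,3) *(4) in simp_all)
  qed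
  from this[of m s] assms(3) show ?thesis by simp
qed

text \<open>The registers from \<open>D\<close> on belong to the compiled code and are not
  compared.\<close>

definition agree :: "nat \<Rightarrow> state \<Rightarrow> (nat \<Rightarrow> nat) \<Rightarrow> (nat \<Rightarrow> nat \<Rightarrow> nat) \<Rightarrow> bool" where
  "agree D s \<rho> A \<longleftrightarrow> arr s = A \<and> (\<forall>x<D. reg s x = \<rho> x)"

text \<open>All registers below \<open>d\<close> survive, which protects intermediate results of
  enclosing expressions. The valuation \<open>\<rho>\<close> varies in the induction because the
  body of a sum is evaluated with its variable changed.\<close>

lemma exec_hexp_com:
  assumes "hexp_ok D W e" "D \<le> d" "agree D s \<rho> A" "\<forall>b\<in>W. \<rho> b \<le> N"
  shows "\<exists>t s'. exec (hexp_com d e) s t s' \<and> agree D s' \<rho> A \<and>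
    (\<forall>x<d. reg s' x = reg s x) \<and> reg s' d = hval e \<rho> A \<and> t \<le> hexp_cost e N"
  using assms
proof (induction e arbitrary: d s \<rho>)
  case (HC c)
  show ?case
    by (intro exI conjI, simp, rule exec_SetReg) (use HC in \<open>auto simp: agree_def\<close>)
next
  case (HV x)
  show ?case
    by (intro exI conjI, simp, rule exec_SetReg) (use HV in \<open>auto simp: agree_def\<close>)
next
  case (HA a e)
  from HA.IH[of d s \<rho>] HA.prems obtain t s1 where 1:
    "exec (hexp_com d e) s t s1" "agree D s1 \<rho> A" "\<forall>x<d. reg s1 x = reg s x"
    "reg s1 d = hval e \<rho> A" "t \<le> hexp_cost e N" by auto
  show ?case
    by (intro exI conjI, simp, rule exec.Seq[OF 1(1) exec_SetReg])
      (use 1 HA.prems in \<open>auto simp: agree_def\<close>)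
next
  case (HPlus e f)
  from HPlus.IH(1)[of d s \<rho>] HPlus.prems obtain t s1 where 1:
    "exec (hexp_com d e) s t s1" "agree D s1 \<rho> A" "\<forall>x<d. reg s1 x = reg s x"
    "reg s1 d = hval e \<rho> A" "t \<le> hexp_cost e N" by auto
  from HPlus.IH(2)[of "d + 1" s1 \<rho>] HPlus.prems 1 obtain t' s2 where 2:
    "exec (hexp_com (d + 1) f) s1 t' s2" "agree D s2 \<rho> A" "\<forall>x<d+1. reg s2 x = reg s1 x"
    "reg s2 (d + 1) = hval f \<rho> A" "t' \<le> hexp_cost f N" by auto
  show ?case
    by (intro exI conjI, simp, rule exec.Seq[OF 1(1) exec.Seq[OF 2(1)[simplified] exec_SetReg]])
      (use 1 2 HPlus.prems in \<open>auto simp: agree_def\<close>)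
next
  case (HMinus e f)
  from HMinus.IH(1)[of d s \<rho>] HMinus.prems obtain t s1 where 1:
    "exec (hexp_com d e) s t s1" "agree D s1 \<rho> A" "\<forall>x<d. reg s1 x = reg s x"
    "reg s1 d = hval e \<rho> A" "t \<le> hexp_cost e N" by auto
  from HMinus.IH(2)[of "d + 1" s1 \<rho>] HMinus.prems 1 obtain t' s2 where 2:
    "exec (hexp_com (d + 1) f) s1 t' s2" "agree D s2 \<rho> A" "\<forall>x<d+1. reg s2 x = reg s1 x"
    "reg s2 (d + 1) = hval f \<rho> A" "t' \<le> hexp_cost f N" by auto
  show ?case
    by (intro exI conjI, simp, rule exec.Seq[OF 1(1) exec.Seq[OF 2(1)[simplified] exec_SetReg]])
      (use 1 2 HMinus.prems in \<open>auto simp: agree_def\<close>)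
next
  case (HGuard e f)
  from HGuard.IH(1)[of d s \<rho>] HGuard.prems obtain t s1 where 1:
    "exec (hexp_com d e) s t s1" "agree D s1 \<rho> A" "\<forall>x<d. reg s1 x = reg s x"
    "reg s1 d = hval e \<rho> A" "t \<le> hexp_cost e N" by auto
  from HGuard.IH(2)[of d s1 \<rho>] HGuard.prems 1 obtain t' s2 where 2:
    "exec (hexp_com d f) s1 t' s2" "agree D s2 \<rho> A" "\<forall>x<d. reg s2 x = reg s1 x"
    "reg s2 d = hval f \<rho> A" "t' \<le> hexp_cost f N" by auto
  show ?case
  proof (cases "hval e \<rho> A = 0")
    case True
    show ?thesis
      by (intro exI conjI, simp, rule exec.Seq[OF 1(1) exec.CondTrue[OF _ exec.Skip]])
        (use 1 True in auto)
  next
    case False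
    show ?thesis
      by (intro exI conjI, simp, rule exec.Seq[OF 1(1) exec.CondFalse[OF _ 2(1)]])
        (use 1 2 False in auto)
  qed
next
  case (HSum i b e)
  define s1 where "s1 = set_reg (d + 3) 0 (set_reg (d + 2) (\<rho> b) (set_reg (d + 1) (\<rho> i) (set_reg d 0 s)))"
  have ri: "reg s i = \<rho> i" "reg s b = \<rho> b" and lt: "i < d" "b < d" "i < D"
    using HSum.prems by (auto simp: agree_def)
  \<comment> \<open>The summation variable \<open>i\<close> is exempt: it is overwritten in each
    round, its old value waits in register \<open>d + 1\<close> and is put back after the
    loop.\<close>
  define I where "I = (\<lambda>j (s'::state). arr s' = A \<and> (\<forall>x<D. x \<noteq> i \<longrightarrow> reg s' x = \<rho> x) \<and>
    (\<forall>x<d. x \<noteq> i \<longrightarrow> reg s' x = reg s x) \<and> reg s' d = (\<Sum>j'<j. hval e (\<rho>(i := j')) A) \<and>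
    reg s' (d + 1) = \<rho> i \<and> reg s' (d + 2) = \<rho> b \<and> reg s' (d + 3) = j)"
  have "\<exists>t s'. exec (While (Less (Reg (d + 3)) (Reg (d + 2)))
        (Seq (SetReg i (Reg (d + 3))) (Seq (hexp_com (d + 4) e)
        (Seq (SetReg d (Add (Reg d) (Reg (d + 4)))) (SetReg (d + 3) (Add (Reg (d + 3)) (Const 1)))))))
        s1 t s' \<and> I (\<rho> b) s' \<and> t \<le> \<rho> b * ((hexp_cost e N + 10) + bcost (Less (Reg (d + 3)) (Reg (d + 2))) + 1)
          + bcost (Less (Reg (d + 3)) (Reg (d + 2))) + 1"
  proof (rule while_rule)
    fix j s2 assume j: "j < \<rho> b" and I2: "I j s2"
    have "\<exists>t s'. exec (hexp_com (d + 4) e) (set_reg i j s2) t s' \<and> agree D s' (\<rho>(i := j)) A \<and>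
      (\<forall>x<d+4. reg s' x = reg (set_reg i j s2) x) \<and> reg s' (d + 4) = hval e (\<rho>(i := j)) A \<and>
      t \<le> hexp_cost e N"
      using j I2 HSum.prems by (intro HSum.IH) (auto simp: I_def agree_def order.strict_implies_order
        dest: order.strict_trans2[OF j])
    then obtain t s3 where 3: "exec (hexp_com (d + 4) e) (set_reg i j s2) t s3"
      "agree D s3 (\<rho>(i := j)) A"
      "\<forall>x<d+4. reg s3 x = reg (set_reg i j s2) x" "reg s3 (d + 4) = hval e (\<rho>(i := j)) A"
      "t \<le> hexp_cost e N" by blast
    have e1: "exec (SetReg i (Reg (d + 3))) s2 2 (set_reg i j s2)"
      using exec_SetReg[of i "Reg (d + 3)" s2] I2 by (simp add: I_def numeral_2_eq_2)
    show "bval (Less (Reg (d + 3)) (Reg (d + 2))) s2 \<and> (\<exists>t s'. exec (Seq (SetReg i (Reg (d + 3))) (Seq (hexp_com (d + 4) e)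
        (Seq (SetReg d (Add (Reg d) (Reg (d + 4)))) (SetReg (d + 3) (Add (Reg (d + 3)) (Const 1)))))) s2 t s' \<and> I (Suc j) s' \<and> t \<le> hexp_cost e N + 10)"
      apply (rule conjI)
      subgoal using I2 j by (simp add: I_def)
      apply (intro exI conjI, rule exec.Seq[OF e1 exec.Seq[OF 3(1) exec.Seq[OF exec_SetReg exec_SetReg]]])
      subgoal using I2 3 lt HSum.prems(2) by (auto simp: I_def agree_def)
      subgoal using 3(5) by simp
      done
  next
    show "I 0 s1"
      using HSum.prems lt by (auto simp: I_def s1_def agree_def)
  qed (auto simp: I_def)
  then obtain t s2 where 2: "exec (While (Less (Reg (d + 3)) (Reg (d + 2)))
        (Seq (SetReg i (Reg (d + 3))) (Seq (hexp_com (d + 4) e)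
        (Seq (SetReg d (Add (Reg d) (Reg (d + 4)))) (SetReg (d + 3) (Add (Reg (d + 3)) (Const 1)))))))
        s1 t s2" "I (\<rho> b) s2" "t \<le> \<rho> b * (hexp_cost e N + 14) + 4"
    by (elim exE conjE) (rule that, assumption+, simp add: algebra_simps)
  have "\<rho> b \<le> N" using HSum.prems by auto
  then have "\<rho> b * (hexp_cost e N + 14) \<le> N * (hexp_cost e N + 14)" by (rule mult_le_mono1)
  with 2(3) have t: "t \<le> N * (hexp_cost e N + 14) + 4" by linarith
  have e1: "exec (SetReg d (Const 0)) s 2 (set_reg d 0 s)"
    using exec_SetReg[of d "Const 0" s] by (simp add: numeral_2_eq_2)
  have e2: "exec (SetReg (d + 1) (Reg i)) (set_reg d 0 s) 2 (set_reg (d + 1) (\<rho> i) (set_reg d 0 s))"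
    using exec_SetReg[of "d + 1" "Reg i" "set_reg d 0 s"] ri lt by (simp add: numeral_2_eq_2)
  have e3: "exec (SetReg (d + 2) (Reg b)) (set_reg (d + 1) (\<rho> i) (set_reg d 0 s)) 2
      (set_reg (d + 2) (\<rho> b) (set_reg (d + 1) (\<rho> i) (set_reg d 0 s)))"
    using exec_SetReg[of "d + 2" "Reg b" "set_reg (d + 1) (\<rho> i) (set_reg d 0 s)"] ri lt by (simp add: numeral_2_eq_2)
  have e4: "exec (SetReg (d + 3) (Const 0)) (set_reg (d + 2) (\<rho> b) (set_reg (d + 1) (\<rho> i) (set_reg d 0 s))) 2 s1"
    using exec_SetReg[of "d + 3" "Const 0" "set_reg (d + 2) (\<rho> b) (set_reg (d + 1) (\<rho> i) (set_reg d 0 s))"]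
    by (simp add: s1_def numeral_2_eq_2)
  have e5: "exec (SetReg i (Reg (d + 1))) s2 2 (set_reg i (\<rho> i) s2)"
    using exec_SetReg[of i "Reg (d + 1)" s2] 2(2) by (simp add: I_def numeral_2_eq_2)
  show ?case
    by (intro exI conjI, subst hexp_com.simps,
        rule exec.Seq[OF e1 exec.Seq[OF e2 exec.Seq[OF e3 exec.Seq[OF e4 exec.Seq[OF 2(1) e5]]]]])
      (use 2(2) lt ri t in \<open>auto simp: I_def agree_def\<close>)
qed

lemma loop_inv:
  assumes "I 0 s" "\<And>j s. j < m \<Longrightarrow> I j s \<Longrightarrow> I (Suc j) (f j s)"
  shows "I m (loop f m s)"
proof -
  have "k \<le> m \<Longrightarrow> I k (loop f k s)" for k
    by (induction k) (auto intro: assms)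
  then show ?thesis by simp
qed

lemma hrun_bounded:
  assumes "hcom_ok D W c" "\<forall>b\<in>W. reg s b \<le> N"
  shows "\<forall>b\<in>W. reg (hrun c s) b \<le> N"
  using assms
proof (induction c arbitrary: s)
  case (HFor i b c)
  have "\<forall>b'\<in>W. reg (loop (\<lambda>j s'. hrun c (set_reg i j s')) (reg s b) s) b' \<le> N"
  proof (rule loop_inv[where I = "\<lambda>_ s'. \<forall>b\<in>W. reg s' b \<le> N"])
    fix j and s' :: state assume j: "j < reg s b" and "\<forall>b\<in>W. reg s' b \<le> N"
    moreover have "reg s b \<le> N" using HFor.prems by auto
    ultimately show "\<forall>b\<in>W. reg (hrun c (set_reg i j s')) b \<le> N"
      using HFor.prems by (intro HFor.IH) auto
  qed (use HFor.prems in auto)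
  then show ?case by simp
qed auto

text \<open>Temporaries between \<open>D\<close> and \<open>d\<close> survive as well, so that the
  private counters and bounds of enclosing loops are safe.\<close>

lemma exec_hcom_com:
  assumes "hcom_ok D W c" "D \<le> d" "agree D s (reg \<sigma>) (arr \<sigma>)" "\<forall>b\<in>W. reg \<sigma> b \<le> N"
  shows "\<exists>t s'. exec (hcom_com d c) s t s' \<and> agree D s' (reg (hrun c \<sigma>)) (arr (hrun c \<sigma>)) \<and>
    (\<forall>x<d. D \<le> x \<longrightarrow> reg s' x = reg s x) \<and> t \<le> hcom_cost c N"
  using assms
proof (induction c arbitrary: d s \<sigma>)
  case (HAsg x e)
  from exec_hexp_com[of D W e d s "reg \<sigma>" "arr \<sigma>" N] HAsg.prems obtain t s1 where 1:
    "exec (hexp_com d e) s t s1" "agree D s1 (reg \<sigma>) (arr \<sigma>)" "\<forall>x<d. reg s1 x = reg s x"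
    "reg s1 d = hval e (reg \<sigma>) (arr \<sigma>)" "t \<le> hexp_cost e N" by auto
  show ?case
    by (intro exI conjI, simp, rule exec.Seq[OF 1(1) exec_SetReg])
      (use 1 HAsg.prems in \<open>auto simp: agree_def\<close>)
next
  case (HStore a e f)
  from exec_hexp_com[of D W e d s "reg \<sigma>" "arr \<sigma>" N] HStore.prems obtain t s1 where 1:
    "exec (hexp_com d e) s t s1" "agree D s1 (reg \<sigma>) (arr \<sigma>)" "\<forall>x<d. reg s1 x = reg s x"
    "reg s1 d = hval e (reg \<sigma>) (arr \<sigma>)" "t \<le> hexp_cost e N" by auto
  from exec_hexp_com[of D W f "d + 1" s1 "reg \<sigma>" "arr \<sigma>" N] HStore.prems 1 obtain t' s2 where 2:
    "exec (hexp_com (d + 1) f) s1 t' s2" "agree D s2 (reg \<sigma>) (arr \<sigma>)" "\<forall>x<d+1. reg s2 x = reg s1 x"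
    "reg s2 (d + 1) = hval f (reg \<sigma>) (arr \<sigma>)" "t' \<le> hexp_cost f N" by auto
  show ?case
    by (intro exI conjI, simp, rule exec.Seq[OF 1(1) exec.Seq[OF 2(1)[simplified] exec_SetArr]])
      (use 1 2 HStore.prems in \<open>auto simp: agree_def\<close>)
next
  case (HSeq c c')
  from HSeq.IH(1)[OF _ HSeq.prems(2-4)] HSeq.prems(1) obtain t s1 where 1:
    "exec (hcom_com d c) s t s1" "agree D s1 (reg (hrun c \<sigma>)) (arr (hrun c \<sigma>))"
    "\<forall>x<d. D \<le> x \<longrightarrow> reg s1 x = reg s x" "t \<le> hcom_cost c N" by auto
  have b: "\<forall>b\<in>W. reg (hrun c \<sigma>) b \<le> N" using HSeq.prems hrun_bounded[of D W c] by auto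
  from HSeq.IH(2)[OF _ HSeq.prems(2) 1(2) b] HSeq.prems(1) obtain t' s2 where 2:
    "exec (hcom_com d c') s1 t' s2" "agree D s2 (reg (hrun c' (hrun c \<sigma>))) (arr (hrun c' (hrun c \<sigma>)))"
    "\<forall>x<d. D \<le> x \<longrightarrow> reg s2 x = reg s1 x" "t' \<le> hcom_cost c' N" by auto
  show ?case
    by (intro exI conjI, simp, rule exec.Seq[OF 1(1) 2(1)]) (use 1 2 in auto)
next
  case (HIf e c)
  from exec_hexp_com[of D W e d s "reg \<sigma>" "arr \<sigma>" N] HIf.prems obtain t s1 where 1:
    "exec (hexp_com d e) s t s1" "agree D s1 (reg \<sigma>) (arr \<sigma>)" "\<forall>x<d. reg s1 x = reg s x"
    "reg s1 d = hval e (reg \<sigma>) (arr \<sigma>)" "t \<le> hexp_cost e N" by auto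
  from HIf.IH[of d s1 \<sigma>] HIf.prems 1 obtain t' s2 where 2:
    "exec (hcom_com d c) s1 t' s2" "agree D s2 (reg (hrun c \<sigma>)) (arr (hrun c \<sigma>))"
    "\<forall>x<d. D \<le> x \<longrightarrow> reg s2 x = reg s1 x" "t' \<le> hcom_cost c N" by auto
  show ?case
  proof (cases "hval e (reg \<sigma>) (arr \<sigma>) = 0")
    case True
    show ?thesis
      by (intro exI conjI, simp, rule exec.Seq[OF 1(1) exec.CondTrue[OF _ exec.Skip]])
        (use 1 True in auto)
  next
    case False
    show ?thesis
      by (intro exI conjI, simp, rule exec.Seq[OF 1(1) exec.CondFalse[OF _ 2(1)]])
        (use 1 2 False in auto)
  qed
next
  case (HFor i b c)
  define m where "m = reg \<sigma> b"
  define s1 where "s1 = set_reg (d + 1) 0 (set_reg d m s)"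
  define st where "st = (\<lambda>j. loop (\<lambda>j s'. hrun c (set_reg i j s')) j \<sigma>)"
  have rb: "reg s b = m" and lt: "i < d" "b < d" "i < D" and mN: "m \<le> N"
    using HFor.prems by (auto simp: agree_def m_def)
  define I where "I = (\<lambda>j (s'::state). agree D s' (reg (st j)) (arr (st j)) \<and> (\<forall>b\<in>W. reg (st j) b \<le> N) \<and>
    (\<forall>x<d. D \<le> x \<longrightarrow> reg s' x = reg s x) \<and> reg s' d = m \<and> reg s' (d + 1) = j)"
  let ?w = "Less (Reg (d + 1)) (Reg d)"
  let ?c = "Seq (SetReg i (Reg (d + 1))) (Seq (hcom_com (d + 2) c)
        (SetReg (d + 1) (Add (Reg (d + 1)) (Const 1))))"
  have "\<exists>t s'. exec (While ?w ?c) s1 t s' \<and> I m s' \<and>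
      t \<le> m * ((hcom_cost c N + 6) + bcost ?w + 1) + bcost ?w + 1"
  proof (rule while_rule)
    fix j s2 assume j: "j < m" and I2: "I j s2"
    have b: "\<forall>b\<in>W. reg (set_reg i j (st j)) b \<le> N"
      using I2 j mN by (auto simp: I_def)
    have "\<exists>t s'. exec (hcom_com (d + 2) c) (set_reg i j s2) t s' \<and>
      agree D s' (reg (hrun c (set_reg i j (st j)))) (arr (hrun c (set_reg i j (st j)))) \<and>
      (\<forall>x<d+2. D \<le> x \<longrightarrow> reg s' x = reg (set_reg i j s2) x) \<and> t \<le> hcom_cost c N"
      using j I2 HFor.prems b by (intro HFor.IH) (auto simp: I_def agree_def)
    then obtain t s3 where 3: "exec (hcom_com (d + 2) c) (set_reg i j s2) t s3"
      "agree D s3 (reg (hrun c (set_reg i j (st j)))) (arr (hrun c (set_reg i j (st j))))"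
      "\<forall>x<d+2. D \<le> x \<longrightarrow> reg s3 x = reg (set_reg i j s2) x" "t \<le> hcom_cost c N" by blast
    have e1: "exec (SetReg i (Reg (d + 1))) s2 2 (set_reg i j s2)"
      using exec_SetReg[of i "Reg (d + 1)" s2] I2 by (simp add: I_def numeral_2_eq_2)
    have "hcom_ok D W c" using HFor.prems by simp
    from hrun_bounded[OF this b] have "\<forall>b\<in>W. reg (st (Suc j)) b \<le> N" by (simp add: st_def)
    then show "bval ?w s2 \<and> (\<exists>t s'. exec ?c s2 t s' \<and> I (Suc j) s' \<and> t \<le> hcom_cost c N + 6)"
      apply (intro conjI)
      subgoal using I2 j by (simp add: I_def)
      apply (intro exI conjI, rule exec.Seq[OF e1 exec.Seq[OF 3(1) exec_SetReg]])
      subgoal using I2 3 lt HFor.prems(2) by (auto simp: I_def agree_def st_def)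
      subgoal using 3(4) by simp
      done
  next
    show "I 0 s1"
      using HFor.prems lt by (auto simp: I_def s1_def agree_def st_def)
  qed (auto simp: I_def)
  then obtain t s2 where 2: "exec (While ?w ?c) s1 t s2" "I m s2"
    "t \<le> m * (hcom_cost c N + 10) + 4"
    by (elim exE conjE) (rule that, assumption+, simp add: algebra_simps)
  from mN have "m * (hcom_cost c N + 10) \<le> N * (hcom_cost c N + 10)" by (rule mult_le_mono1)
  with 2(3) have t: "t \<le> N * (hcom_cost c N + 10) + 4" by linarith
  have e1: "exec (SetReg d (Reg b)) s 2 (set_reg d m s)"
    using exec_SetReg[of d "Reg b" s] rb by (simp add: numeral_2_eq_2)
  have e2: "exec (SetReg (d + 1) (Const 0)) (set_reg d m s) 2 s1"
    using exec_SetReg[of "d + 1" "Const 0" "set_reg d m s"] by (simp add: s1_def numeral_2_eq_2)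
  show ?case
    by (intro exI conjI, subst hcom_com.simps, rule exec.Seq[OF e1 exec.Seq[OF e2 2(1)]])
      (use 2(2) t in \<open>auto simp: I_def st_def m_def\<close>)
qed

text \<open>A bound valid for every \<open>N\<close> with explicit constants, closed under sums and
  products and applicable to the argument \<open>n + M\<close> of the search; it becomes a Landau
  statement only at the end.\<close>

definition poly_bounded_nat :: "(nat \<Rightarrow> nat) \<Rightarrow> bool" where
  "poly_bounded_nat f \<longleftrightarrow> (\<exists>C k. \<forall>N. f N \<le> C * (N + 1) ^ k)"

lemma poly_bounded_const: "poly_bounded_nat (\<lambda>_. c)"
  unfolding poly_bounded_nat_def by (rule exI[of _ c], rule exI[of _ 0]) simp

lemma poly_bounded_id: "poly_bounded_nat (\<lambda>N. N)"
  unfolding poly_bounded_nat_def by (rule exI[of _ 1], rule exI[of _ 1]) simp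

lemma poly_bounded_add:
  assumes "poly_bounded_nat f" "poly_bounded_nat g"
  shows "poly_bounded_nat (\<lambda>N. f N + g N)"
proof -
  from assms obtain C k C' k' where
    f: "\<And>N. f N \<le> C * (N + 1) ^ k" and g: "\<And>N. g N \<le> C' * (N + 1) ^ k'"
    unfolding poly_bounded_nat_def by blast
  have "f N + g N \<le> (C + C') * (N + 1) ^ (k + k')" for N
  proof -
    have "C * (N + 1) ^ k \<le> C * (N + 1) ^ (k + k')"
      by (intro mult_le_mono2 power_increasing) auto
    moreover have "C' * (N + 1) ^ k' \<le> C' * (N + 1) ^ (k + k')"
      by (intro mult_le_mono2 power_increasing) auto
    ultimately show ?thesis using f[of N] g[of N] unfolding distrib_right by linarith
  qed
  then show ?thesis unfolding poly_bounded_nat_def by blast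
qed

lemma poly_bounded_mult:
  assumes "poly_bounded_nat f" "poly_bounded_nat g"
  shows "poly_bounded_nat (\<lambda>N. f N * g N)"
proof -
  from assms obtain C k C' k' where
    f: "\<And>N. f N \<le> C * (N + 1) ^ k" and g: "\<And>N. g N \<le> C' * (N + 1) ^ k'"
    unfolding poly_bounded_nat_def by blast
  have "f N * g N \<le> (C * C') * (N + 1) ^ (k + k')" for N
    using mult_le_mono[OF f[of N] g[of N]] by (simp add: power_add algebra_simps)
  then show ?thesis unfolding poly_bounded_nat_def by blast
qed

lemmas poly_bounded_intros =
  poly_bounded_const poly_bounded_id poly_bounded_add poly_bounded_mult

lemma poly_bounded_hexp_cost: "poly_bounded_nat (hexp_cost e)"
  by (induction e) (simp_all only: hexp_cost.simps poly_bounded_intros)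

lemma poly_bounded_hcom_cost: "poly_bounded_nat (hcom_cost c)"
  by (induction c) (simp_all only: hcom_cost.simps poly_bounded_intros poly_bounded_hexp_cost)


section \<open>Building blocks of the programs\<close>

text \<open>Truth values are numbers, with every nonzero number counting as true. Truncated
  subtraction from 1 negates, and negating twice normalises to 0 or 1.\<close>

definition notx :: "hexp \<Rightarrow> hexp" where
  "notx e = HMinus (HC 1) e"
definition lessx :: "hexp \<Rightarrow> hexp \<Rightarrow> hexp" where
  "lessx e f = notx (notx (HMinus f e))"
definition eqx :: "hexp \<Rightarrow> hexp \<Rightarrow> hexp" where
  "eqx e f = notx (HPlus (HMinus e f) (HMinus f e))"
definition andx :: "hexp \<Rightarrow> hexp \<Rightarrow> hexp" where
  "andx e f = notx (HPlus (notx e) (notx f))"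
definition orx :: "hexp \<Rightarrow> hexp \<Rightarrow> hexp" where
  "orx e f = notx (notx (HPlus e f))"
definition allx :: "nat \<Rightarrow> nat \<Rightarrow> hexp \<Rightarrow> hexp" where
  "allx i b e = notx (HSum i b (notx e))"
definition exx :: "nat \<Rightarrow> nat \<Rightarrow> hexp \<Rightarrow> hexp" where
  "exx i b e = notx (notx (HSum i b e))"

lemma one_diff_nat: "1 - (m::nat) = of_bool (m = 0)"
  by (cases m) auto

lemma hval_logic [simp]:
  "hval (notx e) \<rho> A = of_bool (hval e \<rho> A = 0)"
  "hval (lessx e f) \<rho> A = of_bool (hval e \<rho> A < hval f \<rho> A)"
  "hval (eqx e f) \<rho> A = of_bool (hval e \<rho> A = hval f \<rho> A)"
  "hval (andx e f) \<rho> A = of_bool (hval e \<rho> A \<noteq> 0 \<and> hval f \<rho> A \<noteq> 0)"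
  "hval (orx e f) \<rho> A = of_bool (hval e \<rho> A \<noteq> 0 \<or> hval f \<rho> A \<noteq> 0)"
  "hval (allx i b e) \<rho> A = of_bool (\<forall>j<\<rho> b. hval e (\<rho>(i := j)) A \<noteq> 0)"
  "hval (exx i b e) \<rho> A = of_bool (\<exists>j<\<rho> b. hval e (\<rho>(i := j)) A \<noteq> 0)"
  unfolding notx_def lessx_def eqx_def andx_def orx_def allx_def exx_def hval.simps one_diff_nat
  by (auto simp: sum_eq_0_iff)

lemma hexp_ok_logic [simp]:
  "hexp_ok D W (notx e) \<longleftrightarrow> hexp_ok D W e"
  "hexp_ok D W (lessx e f) \<longleftrightarrow> hexp_ok D W e \<and> hexp_ok D W f"
  "hexp_ok D W (eqx e f) \<longleftrightarrow> hexp_ok D W e \<and> hexp_ok D W f"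
  "hexp_ok D W (andx e f) \<longleftrightarrow> hexp_ok D W e \<and> hexp_ok D W f"
  "hexp_ok D W (orx e f) \<longleftrightarrow> hexp_ok D W e \<and> hexp_ok D W f"
  "hexp_ok D W (allx i b e) \<longleftrightarrow> i < D \<and> b < D \<and> b \<in> W \<and> hexp_ok D W e"
  "hexp_ok D W (exx i b e) \<longleftrightarrow> i < D \<and> b < D \<and> b \<in> W \<and> hexp_ok D W e"
  by (auto simp: notx_def lessx_def eqx_def andx_def orx_def allx_def exx_def)

text \<open>The programs use registers below 30: 0 holds \<open>n\<close>, 1 holds \<open>k\<close>, 3 counts the candidates tried, and
  those from 10 on are loop variables. Array 0 is the adjacency matrix, 1 and 2 mark the kept and
  the forced vertices, 3 is the distance matrix, 4 a buffer, 5 holds the digits of the counter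
  and 6 marks the candidate.\<close>

abbreviation "bound_regs \<equiv> {b. b = 0 \<or> b = 3 \<or> 10 \<le> b \<and> b < 30} :: nat set"

text \<open>The row-major position \<open>u * n + v\<close>, with the product written as a sum;
  register 29 merely counts the summands.\<close>

definition idx :: "nat \<Rightarrow> nat \<Rightarrow> hexp" where
  "idx u v = HPlus (HSum 29 u (HV 0)) (HV v)"

lemma hval_idx [simp]: "v \<noteq> 29 \<Longrightarrow> hval (idx u v) \<rho> A = \<rho> u * \<rho> 0 + \<rho> v"
  by (simp add: idx_def)

definition adjx :: "nat \<Rightarrow> nat \<Rightarrow> hexp" where
  "adjx u v = HA 0 (idx u v)"

definition twinx :: "nat \<Rightarrow> nat \<Rightarrow> hexp" where
  "twinx u v = allx 28 0 (eqx (adjx u 28) (adjx v 28))"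

definition keptx :: hexp where
  "keptx = lessx (HSum 27 10 (twinx 27 10)) (HC 5)"

definition adjacency :: "nat \<Rightarrow> nat set set \<Rightarrow> (nat \<Rightarrow> nat) \<Rightarrow> bool" where
  "adjacency n E a \<longleftrightarrow> (\<forall>u<n. \<forall>v<n. a (u * n + v) = of_bool ({u, v} \<in> E))"

lemma hval_adjx:
  assumes "adjacency n E (A 0)" "\<rho> 0 = n" "\<rho> u < n" "\<rho> v < n" "v \<noteq> 29"
  shows "hval (adjx u v) \<rho> A = of_bool ({\<rho> u, \<rho> v} \<in> E)"
  using assms by (simp add: adjx_def adjacency_def)

lemma hval_twinx:
  assumes "adjacency n E (A 0)" "\<rho> 0 = n" "\<rho> u < n" "\<rho> v < n" "u \<noteq> 28" "v \<noteq> 28"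
  shows "hval (twinx u v) \<rho> A = of_bool (twins {..<n} E (\<rho> u) (\<rho> v))"
  using assms by (auto simp: twinx_def hval_adjx[where n = n and E = E] twins_def of_bool_def)

lemma hval_keptx:
  assumes "adjacency n E (A 0)" "\<rho> 0 = n" "\<rho> 10 < n"
  shows "hval keptx \<rho> A = of_bool (kept {..<n} E (\<rho> 10))"
proof -
  have "hval (HSum 27 10 (twinx 27 10)) \<rho> A =
      (\<Sum>j<\<rho> 10. of_bool (twins {..<n} E j (\<rho> 10)))"
    using assms unfolding hval.simps by (intro sum.cong refl) (simp add: hval_twinx[where n = n and E = E])
  also have "\<dots> = card ({..<\<rho> 10} \<inter> {j. twins {..<n} E j (\<rho> 10)})"
    by (simp add: of_bool_def sum.If_cases)
  also have "{..<\<rho> 10} \<inter> {j. twins {..<n} E j (\<rho> 10)} = {u\<in>{..<n}. u < \<rho> 10 \<and> twins {..<n} E u (\<rho> 10)}"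
    using assms by auto
  finally show ?thesis unfolding keptx_def kept_def hval_logic hval.simps(1) by simp
qed

definition same_arrs :: "nat \<Rightarrow> (nat \<Rightarrow> nat \<Rightarrow> nat) \<Rightarrow> (nat \<Rightarrow> nat \<Rightarrow> nat) \<Rightarrow> bool" where
  "same_arrs a A A' \<longleftrightarrow> (\<forall>b. b \<noteq> a \<longrightarrow> A' b = A b)"

definition fill :: "nat \<Rightarrow> hexp \<Rightarrow> hcom" where
  "fill a e = HFor 10 0 (HStore a (HV 10) e)"

text \<open>The assumption ranges over all contents of array \<open>a\<close>: the values written
  must not depend on the array being overwritten, so they can be evaluated in any intermediate
  state.\<close>

lemma hrun_fill:
  assumes e: "\<And>j A. j < reg s 0 \<Longrightarrow> same_arrs a (arr s) A \<Longrightarrow> hval e ((reg s)(10 := j)) A = X j"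
  shows "\<forall>x. x \<noteq> 10 \<longrightarrow> reg (hrun (fill a e) s) x = reg s x"
    and "\<forall>b. b \<noteq> a \<longrightarrow> arr (hrun (fill a e) s) b = arr s b"
    and "\<forall>j<reg s 0. arr (hrun (fill a e) s) a j = X j"
proof -
  define I where "I = (\<lambda>j (s'::state). (\<forall>x. x \<noteq> 10 \<longrightarrow> reg s' x = reg s x) \<and> same_arrs a (arr s) (arr s') \<and>
    (\<forall>i<j. arr s' a i = X i))"
  have "I (reg s 0) (loop (\<lambda>j s'. hrun (HStore a (HV 10) e) (set_reg 10 j s')) (reg s 0) s)"
  proof (rule loop_inv)
    fix j and s' :: state assume j: "j < reg s 0" and I: "I j s'"
    have "(reg s')(10 := j) = (reg s)(10 := j)" using I by (auto simp: I_def)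
    then have "hval e ((reg s')(10 := j)) (arr s') = X j"
      using e[OF j, of "arr s'"] I by (simp add: I_def)
    then show "I (Suc j) (hrun (HStore a (HV 10) e) (set_reg 10 j s'))"
      using I by (auto simp: I_def same_arrs_def less_Suc_eq)
  qed (simp add: I_def same_arrs_def)
  then show "\<forall>x. x \<noteq> 10 \<longrightarrow> reg (hrun (fill a e) s) x = reg s x"
    "\<forall>b. b \<noteq> a \<longrightarrow> arr (hrun (fill a e) s) b = arr s b"
    "\<forall>j<reg s 0. arr (hrun (fill a e) s) a j = X j"
    by (simp_all add: fill_def I_def same_arrs_def)
qed

definition scatter :: "nat \<Rightarrow> hexp \<Rightarrow> hexp \<Rightarrow> hexp \<Rightarrow> hcom" where
  "scatter a g e f = HFor 10 0 (HFor 11 0 (HIf g (HStore a e f)))"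

text \<open>Injectivity of the positions under the guard ensures that no later write destroys an
  earlier one.\<close>

lemma hrun_scatter:
  assumes e: "\<And>i j A. i < reg s 0 \<Longrightarrow> j < reg s 0 \<Longrightarrow> same_arrs a (arr s) A \<Longrightarrow>
      (hval g ((reg s)(10 := i, 11 := j)) A \<noteq> 0 \<longleftrightarrow> G i j) \<and>
      (G i j \<longrightarrow> hval e ((reg s)(10 := i, 11 := j)) A = P i j \<and>
                 hval f ((reg s)(10 := i, 11 := j)) A = X i j)"
    and inj: "\<And>i j k l. i < reg s 0 \<Longrightarrow> j < reg s 0 \<Longrightarrow> k < reg s 0 \<Longrightarrow> l < reg s 0 \<Longrightarrow>
      G i j \<Longrightarrow> G k l \<Longrightarrow> P i j = P k l \<Longrightarrow> i = k \<and> j = l"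
  shows "\<forall>x. x \<noteq> 10 \<and> x \<noteq> 11 \<longrightarrow> reg (hrun (scatter a g e f) s) x = reg s x"
    and "\<forall>b. b \<noteq> a \<longrightarrow> arr (hrun (scatter a g e f) s) b = arr s b"
    and "\<forall>i<reg s 0. \<forall>j<reg s 0. G i j \<longrightarrow> arr (hrun (scatter a g e f) s) a (P i j) = X i j"
proof -
  let ?n = "reg s 0" and ?c = "HIf g (HStore a e f)"
  \<comment> \<open>The pairs lexicographically below \<open>(i, j)\<close> have been dealt
    with.\<close>
  define J where "J = (\<lambda>i j (s'::state). (\<forall>x. x \<noteq> 10 \<and> x \<noteq> 11 \<longrightarrow> reg s' x = reg s x) \<and>
    same_arrs a (arr s) (arr s') \<and>
    (\<forall>k<?n. \<forall>l<?n. (k < i \<or> k = i \<and> l < j) \<and> G k l \<longrightarrow> arr s' a (P k l) = X k l))"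
  have inner: "J (Suc i) 0 (hrun (HFor 11 0 ?c) (set_reg 10 i s'))" if i: "i < ?n" and I: "J i 0 s'" for i s'
  proof -
    have n: "reg (set_reg 10 i s') 0 = ?n" using I by (simp add: J_def)
    define J' where "J' = (\<lambda>j s'. J i j s' \<and> reg s' 10 = i)"
    have "J' ?n (loop (\<lambda>j s'. hrun ?c (set_reg 11 j s')) ?n (set_reg 10 i s'))"
    proof (rule loop_inv)
      fix j and s' :: state assume j: "j < ?n" and J: "J' j s'"
      have "(reg s')(11 := j) = (reg s)(10 := i, 11 := j)" using J by (auto simp: J_def J'_def)
      then have *: "(hval g ((reg s')(11 := j)) (arr s') \<noteq> 0 \<longleftrightarrow> G i j) \<and>
          (G i j \<longrightarrow> hval e ((reg s')(11 := j)) (arr s') = P i j \<and>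
            hval f ((reg s')(11 := j)) (arr s') = X i j)"
        using e[OF i j, of "arr s'"] J by (simp add: J_def J'_def)
      show "J' (Suc j) (hrun ?c (set_reg 11 j s'))"
      proof (cases "G i j")
        case True
        have eq: "hrun ?c (set_reg 11 j s') = set_arr a (P i j) (X i j) (set_reg 11 j s')"
          using * True by simp
        have "((arr s' a)(P i j := X i j)) (P k l) = X k l"
          if "k < ?n" "l < ?n" "k < i \<or> k = i \<and> l < Suc j" "G k l" for k l
          using J that inj[OF i j that(1,2) True that(4)]
          by (auto simp: J_def J'_def less_Suc_eq)
        then show ?thesis using J unfolding eq by (auto simp: J_def J'_def same_arrs_def)
      next
        case False
        then show ?thesis using J * by (auto simp: J_def J'_def less_Suc_eq)
      qed
    next
      show "J' 0 (set_reg 10 i s')" using I by (simp add: J_def J'_def)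
    qed
    then have "J i ?n (hrun (HFor 11 0 ?c) (set_reg 10 i s'))" using n by (simp add: J'_def)
    then show ?thesis by (auto simp: J_def less_Suc_eq)
  qed
  have "J ?n 0 (loop (\<lambda>i s'. hrun (HFor 11 0 ?c) (set_reg 10 i s')) ?n s)"
    by (rule loop_inv[where I = "\<lambda>i. J i 0"]) (use inner in \<open>auto simp: J_def same_arrs_def\<close>)
  then have "J ?n 0 (hrun (scatter a g e f) s)" by (simp add: scatter_def)
  then show "\<forall>x. x \<noteq> 10 \<and> x \<noteq> 11 \<longrightarrow> reg (hrun (scatter a g e f) s) x = reg s x"
    "\<forall>b. b \<noteq> a \<longrightarrow> arr (hrun (scatter a g e f) s) b = arr s b"
    "\<forall>i<reg s 0. \<forall>j<reg s 0. G i j \<longrightarrow> arr (hrun (scatter a g e f) s) a (P i j) = X i j"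
    by (auto simp: J_def same_arrs_def)
qed

section \<open>Computing all distances\<close>

lemma row_major_inj:
  fixes i j k l n :: nat
  assumes "j < n" "l < n" "i * n + j = k * n + l"
  shows "i = k \<and> j = l"
proof -
  have "i = (i * n + j) div n" "k = (k * n + l) div n" using assms(1,2) by auto
  then have "i = k" using assms(3) by simp
  with assms(3) show ?thesis by simp
qed

text \<open>Infinity is coded by \<open>n\<close>, which no finite distance reaches by
  \<open>gdist_finite_less_card\<close>.\<close>

definition ndist :: "nat \<Rightarrow> nat set set \<Rightarrow> nat \<Rightarrow> nat \<Rightarrow> nat" where
  "ndist n E u v = (case gdist {..<n} E u v of enat d \<Rightarrow> d | \<infinity> \<Rightarrow> n)"

lemma ndist_cases:
  obtains "gdist {..<n} E u v = \<infinity>" "ndist n E u v = n"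
  | "gdist {..<n} E u v = enat (ndist n E u v)" "ndist n E u v < n"
proof (cases "gdist {..<n} E u v")
  case (enat d)
  then show thesis using that(2) gdist_finite_less_card[of "{..<n}" E u v] by (simp add: ndist_def)
next
  case infinity
  then show thesis using that(1) by (simp add: ndist_def)
qed

lemma ndist_le_iff: "i < n \<Longrightarrow> ndist n E u v \<le> i \<longleftrightarrow> gdist {..<n} E u v \<le> enat i"
  by (cases rule: ndist_cases[of n E u v]) simp_all

lemma ndist_le: "ndist n E u v \<le> n"
  by (cases rule: ndist_cases[of n E u v]) simp_all

lemma ndist_eq_iff: "ndist n E u v = ndist n E w x \<longleftrightarrow> gdist {..<n} E u v = gdist {..<n} E w x"
  by (cases rule: ndist_cases[of n E u v]; cases rule: ndist_cases[of n E w x]) simp_all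

lemma covers_ndist_iff:
  "covers {..<n} E s t u \<longleftrightarrow>
    ndist n E s u + ndist n E u t = ndist n E s t \<and> ndist n E s t < n"
  unfolding covers_def
  by (cases rule: ndist_cases[of n E s u]; cases rule: ndist_cases[of n E u t];
      cases rule: ndist_cases[of n E s t]) simp_all

text \<open>With a strict inequality on the right the breadth-first recursion also holds for
  \<open>i = 0\<close>, so the loop computing distances needs no special first round.\<close>

lemma ndist_le_step:
  assumes "u < n" "v < n" "i < n"
  shows "ndist n E u v \<le> i \<longleftrightarrow> u = v \<or> (\<exists>w<n. {u, w} \<in> E \<and> ndist n E w v < i)"
proof (cases i)
  case 0
  then show ?thesis using assms ndist_le_iff[of 0 n E u v] by (simp add: gdist_le_0)
next
  case (Suc j)
  have "ndist n E w v < i \<longleftrightarrow> gdist {..<n} E w v \<le> enat j" for w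
    using ndist_le_iff[of j n E w v] assms Suc by (simp add: less_Suc_eq_le)
  then show ?thesis using assms Suc ndist_le_iff[of i n E u v] gdist_le_Suc[of u "{..<n}" v E j]
    by (auto simp: lessThan_iff)
qed

definition matrix :: "nat \<Rightarrow> (nat \<Rightarrow> nat \<Rightarrow> nat) \<Rightarrow> (nat \<Rightarrow> nat) \<Rightarrow> bool" where
  "matrix n M a \<longleftrightarrow> (\<forall>u<n. \<forall>v<n. a (u * n + v) = M u v)"

text \<open>Round \<open>i\<close> turns truncated distances \<open>min d i\<close> into
  \<open>min d (i + 1)\<close>: an entry grows by one unless the distance is at most
  \<open>i\<close>, which \<open>ndist_le_step\<close> detects from entries below \<open>i\<close>.
  After \<open>n\<close> rounds the truncation has no effect.\<close>

definition distx :: hexp where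
  "distx = HPlus (HA 3 (idx 10 11)) (notx (orx (eqx (HV 10) (HV 11))
     (exx 13 0 (andx (adjx 10 13) (lessx (HA 3 (idx 13 11)) (HV 12))))))"

text \<open>Array 4 collects the new matrix, since every entry of a round must be computed from the
  old one.\<close>

definition dist_com :: hcom where
  "dist_com = HSeq (scatter 3 (HC 1) (idx 10 11) (HC 0))
     (HFor 12 0 (HSeq (scatter 4 (HC 1) (idx 10 11) distx)
                      (scatter 3 (HC 1) (idx 10 11) (HA 4 (idx 10 11)))))"

lemma hrun_scatter_matrix:
  assumes "\<And>i j A. i < reg s 0 \<Longrightarrow> j < reg s 0 \<Longrightarrow> same_arrs a (arr s) A \<Longrightarrow>
      hval f ((reg s)(10 := i, 11 := j)) A = M i j"
  shows "\<forall>x. x \<noteq> 10 \<and> x \<noteq> 11 \<longrightarrow> reg (hrun (scatter a (HC 1) (idx 10 11) f) s) x = reg s x"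
    and "\<forall>b. b \<noteq> a \<longrightarrow> arr (hrun (scatter a (HC 1) (idx 10 11) f) s) b = arr s b"
    and "matrix (reg s 0) M (arr (hrun (scatter a (HC 1) (idx 10 11) f) s) a)"
proof -
  have e: "(hval (HC 1) ((reg s)(10 := i, 11 := j)) A \<noteq> 0 \<longleftrightarrow> True) \<and>
      (True \<longrightarrow> hval (idx 10 11) ((reg s)(10 := i, 11 := j)) A = i * reg s 0 + j \<and>
                 hval f ((reg s)(10 := i, 11 := j)) A = M i j)"
    if "i < reg s 0" "j < reg s 0" "same_arrs a (arr s) A" for i j A
    using assms[OF that] by simp
  have inj: "i = k \<and> j = l" if "i < reg s 0" "j < reg s 0" "k < reg s 0" "l < reg s 0" True True
      "i * reg s 0 + j = k * reg s 0 + l" for i j k l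
    using that(2,4,7) by (rule row_major_inj)
  note r = hrun_scatter[where G = "\<lambda>_ _. True" and P = "\<lambda>i j. i * reg s 0 + j" and X = M and g = "HC 1" and e = "idx 10 11"
      and f = f and s = s and a = a, OF e inj]
  show "\<forall>x. x \<noteq> 10 \<and> x \<noteq> 11 \<longrightarrow> reg (hrun (scatter a (HC 1) (idx 10 11) f) s) x = reg s x"
    by (rule r(1))
  show "\<forall>b. b \<noteq> a \<longrightarrow> arr (hrun (scatter a (HC 1) (idx 10 11) f) s) b = arr s b"
    by (rule r(2))
  show "matrix (reg s 0) M (arr (hrun (scatter a (HC 1) (idx 10 11) f) s) a)"
    unfolding matrix_def using r(3) by blast
qed

lemma hrun_dist_com:
  assumes n: "reg s 0 = n" and adj: "adjacency n E (arr s 0)"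
  shows "\<forall>x. x \<notin> {10, 11, 12} \<longrightarrow> reg (hrun dist_com s) x = reg s x"
    and "\<forall>b. b \<noteq> 3 \<and> b \<noteq> 4 \<longrightarrow> arr (hrun dist_com s) b = arr s b"
    and "matrix n (ndist n E) (arr (hrun dist_com s) 3)"
proof -
  define I where "I = (\<lambda>i (s'::state). (\<forall>x. x \<notin> {10, 11, 12} \<longrightarrow> reg s' x = reg s x) \<and>
    (\<forall>b. b \<noteq> 3 \<and> b \<noteq> 4 \<longrightarrow> arr s' b = arr s b) \<and>
    matrix n (\<lambda>u v. min (ndist n E u v) i) (arr s' 3))"
  define s1 where "s1 = hrun (scatter 3 (HC 1) (idx 10 11) (HC 0)) s"
  have s1: "I 0 s1" "reg s1 0 = n"
    unfolding s1_def I_def using hrun_scatter_matrix[of s 3 "HC 0" "\<lambda>_ _. 0"] n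
    by simp_all
  let ?c1 = "scatter 4 (HC 1) (idx 10 11) distx"
  let ?c2 = "scatter 3 (HC 1) (idx 10 11) (HA 4 (idx 10 11))"
  have "I n (loop (\<lambda>i s'. hrun (HSeq ?c1 ?c2) (set_reg 12 i s')) n s1)"
  proof (rule loop_inv)
    fix i and s' :: state assume i: "i < n" and I: "I i s'"
    define s2 where "s2 = set_reg 12 i s'"
    have 2: "reg s2 0 = n" "reg s2 12 = i" "adjacency n E (arr s2 0)"
      "matrix n (\<lambda>u v. min (ndist n E u v) i) (arr s2 3)"
      using I n adj by (auto simp: s2_def I_def)
    have v: "hval distx ((reg s2)(10 := u, 11 := v)) A = min (ndist n E u v) (Suc i)"
      if uv: "u < reg s2 0" "v < reg s2 0" and A: "same_arrs 4 (arr s2) A" for u v A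
    proof -
      have A03: "A 0 = arr s2 0" "A 3 = arr s2 3" using A by (simp_all add: same_arrs_def)
      let ?\<rho> = "(reg s2)(10 := u, 11 := v)"
      have "hval (adjx 10 13) (?\<rho>(13 := w)) A = of_bool ({u, w} \<in> E)" if "w < n" for w
        using hval_adjx[of n E A "?\<rho>(13 := w)" 10 13] that uv 2 A03 by simp
      moreover have "A 3 (w * n + v) = min (ndist n E w v) i" if "w < n" for w
        using 2(1,4) uv that A03 by (simp add: matrix_def)
      ultimately have "hval (exx 13 0 (andx (adjx 10 13) (lessx (HA 3 (idx 13 11)) (HV 12)))) ?\<rho> A =
          of_bool (\<exists>w<n. {u, w} \<in> E \<and> ndist n E w v < i)"
        using 2(1,2) by (auto simp: of_bool_def split: if_splits)
      then have "hval distx ?\<rho> A = min (ndist n E u v) i +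
          of_bool (\<not> (u = v \<or> (\<exists>w<n. {u, w} \<in> E \<and> ndist n E w v < i)))"
        using 2(1,4) uv A03 by (simp add: distx_def matrix_def) blast
      also have "\<dots> = min (ndist n E u v) i + of_bool (\<not> ndist n E u v \<le> i)"
        using ndist_le_step[of u n v i E] uv 2(1) i by simp
      also have "\<dots> = min (ndist n E u v) (Suc i)" by auto
      finally show ?thesis .
    qed
    note c1 = hrun_scatter_matrix[of s2 4 distx, OF v]
    define s3 where "s3 = hrun ?c1 s2"
    have 3: "reg s3 0 = n" "matrix n (\<lambda>u v. min (ndist n E u v) (Suc i)) (arr s3 4)"
      "\<forall>x. x \<noteq> 10 \<and> x \<noteq> 11 \<longrightarrow> reg s3 x = reg s2 x" "\<forall>b. b \<noteq> 4 \<longrightarrow> arr s3 b = arr s2 b"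
      using c1 2(1) by (simp_all add: s3_def)
    have "hval (HA 4 (idx 10 11)) ((reg s3)(10 := u, 11 := v)) A = min (ndist n E u v) (Suc i)"
      if "u < reg s3 0" "v < reg s3 0" "same_arrs 3 (arr s3) A" for u v A
      using that 3(1,2) by (simp add: same_arrs_def matrix_def)
    note c2 = hrun_scatter_matrix[of s3 3 "HA 4 (idx 10 11)", OF this]
    have "I (Suc i) (hrun ?c2 s3)"
      unfolding I_def using c2 3 I by (auto simp: I_def s2_def)
    then show "I (Suc i) (hrun (HSeq ?c1 ?c2) (set_reg 12 i s'))" by (simp add: s3_def s2_def)
  qed (rule s1)
  then have "I n (hrun dist_com s)" using s1(2) by (simp add: dist_com_def s1_def)
  moreover have "min (ndist n E u v) n = ndist n E u v" for u v using ndist_le by (simp add: min_absorb1)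
  ultimately show "\<forall>x. x \<notin> {10, 11, 12} \<longrightarrow> reg (hrun dist_com s) x = reg s x"
    "\<forall>b. b \<noteq> 3 \<and> b \<noteq> 4 \<longrightarrow> arr (hrun dist_com s) b = arr s b"
    "matrix n (ndist n E) (arr (hrun dist_com s) 3)"
    by (simp_all add: I_def)
qed

lemma hcom_ok_fill [simp]:
  "hcom_ok 30 bound_regs (fill a e) \<longleftrightarrow> hexp_ok 30 bound_regs e"
  by (simp add: fill_def)

lemma hcom_ok_scatter [simp]:
  "hcom_ok 30 bound_regs (scatter a g e f) \<longleftrightarrow>
    hexp_ok 30 bound_regs g \<and> hexp_ok 30 bound_regs e \<and> hexp_ok 30 bound_regs f"
  by (simp add: scatter_def)

lemma hexp_ok_graph [simp]:
  "hexp_ok 30 bound_regs (idx u v) \<longleftrightarrow> u < 30 \<and> v < 30 \<and> u \<in> bound_regs"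
  "hexp_ok 30 bound_regs (adjx u v) \<longleftrightarrow> u < 30 \<and> v < 30 \<and> u \<in> bound_regs"
  "hexp_ok 30 bound_regs (twinx u v) \<longleftrightarrow> u < 30 \<and> v < 30 \<and> u \<in> bound_regs \<and> v \<in> bound_regs"
  "hexp_ok 30 bound_regs keptx"
  by (auto simp: idx_def adjx_def twinx_def keptx_def)

lemma hcom_ok_dist_com [simp]: "hcom_ok 30 bound_regs dist_com"
  by (simp add: dist_com_def distx_def)


section \<open>Enumeration of candidate solutions\<close>

text \<open>In base \<open>card K + 1\<close> the digit \<open>r + 1\<close> names the element of
  rank \<open>r\<close> and the digit 0 names nothing. Order and repetition of digits do not
  matter.\<close>

definition decode :: "nat set \<Rightarrow> nat \<Rightarrow> nat set" where
  "decode K m = {v\<in>K. \<exists>i. m div (card K + 1) ^ i mod (card K + 1) = rank K v + 1}"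

lemma rank_less_card: "finite K \<Longrightarrow> v \<in> K \<Longrightarrow> rank K v < card K"
  using bij_betw_rank[of K] by (auto simp: bij_betw_def)

lemma rank_eq_iff: "finite K \<Longrightarrow> u \<in> K \<Longrightarrow> v \<in> K \<Longrightarrow> rank K u = rank K v \<longleftrightarrow> u = v"
  using bij_betw_rank[of K] by (auto simp: bij_betw_def dest: inj_onD)

lemma ex_nat_split: "(\<exists>i. P i) \<longleftrightarrow> P 0 \<or> (\<exists>i. P (Suc i))"
  by (metis not0_implies_Suc)

text \<open>A new element \<open>v\<close> is added by appending the digit
  \<open>rank K v + 1\<close> as the least significant one.\<close>

lemma decode_surj:
  assumes "finite K" "T \<subseteq> K"
  shows "\<exists>m<(card K + 1) ^ card T. decode K m = T"
proof -
  have "finite T" using assms finite_subset by blast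
  from this assms(2) show ?thesis
  proof (induction T rule: finite_induct)
    case empty
    have "decode K 0 = {}" by (simp add: decode_def)
    then show ?case by simp
  next
    case (insert v T)
    define B where "B = card K + 1"
    obtain m where m: "m < B ^ card T" "decode K m = T" using insert by (auto simp: B_def)
    have v: "v \<in> K" "rank K v + 1 < B" using insert.prems rank_less_card[OF assms(1)] by (auto simp: B_def)
    define m' where "m' = m * B + (rank K v + 1)"
    have "B > 0" by (simp add: B_def)
    have 0: "m' mod B = rank K v + 1" using v(2) unfolding m'_def by simp
    have "(m * B + d) div B = m" if "d < B" for d using that by simp
    from this[OF v(2)] have "m' div B = m" unfolding m'_def .
    then have Suc: "m' div B ^ Suc i mod B = m div B ^ i mod B" for i by (simp add: div_mult2_eq)
    have "decode K m' = insert v (decode K m)"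
    proof (rule set_eqI)
      fix u
      have "u \<in> decode K m' \<longleftrightarrow> u \<in> K \<and> (rank K v = rank K u \<or> (\<exists>i. m div B ^ i mod B = rank K u + 1))"
        unfolding decode_def B_def[symmetric]
        using 0 by (subst ex_nat_split) (simp add: Suc del: power_Suc)
      also have "\<dots> \<longleftrightarrow> u \<in> insert v (decode K m)"
        using v(1) rank_eq_iff[OF assms(1) v(1), of u] unfolding decode_def B_def[symmetric] by auto
      finally show "u \<in> decode K m' \<longleftrightarrow> u \<in> insert v (decode K m)" .
    qed
    moreover have "m' < B ^ card (insert v T)"
    proof -
      have "m' < (m + 1) * B" using v(2) unfolding m'_def by simp
      also have "\<dots> \<le> B ^ card T * B" using m(1) by (intro mult_le_mono1) simp
      finally show ?thesis using insert.hyps by (simp add: mult.commute)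
    qed
    ultimately show ?case using m(2) unfolding B_def by blast
  qed
qed

text \<open>Only the lowest \<open>t\<close> digits of such an \<open>m\<close> can be nonzero, and
  each digit names at most one element.\<close>

lemma card_decode_le:
  assumes "finite K" "m < (card K + 1) ^ t"
  shows "card (decode K m) \<le> t"
proof -
  define B where "B = card K + 1"
  have "(\<lambda>v. rank K v + 1) ` decode K m \<subseteq> (\<lambda>i. m div B ^ i mod B) ` {..<t}"
  proof
    fix r assume "r \<in> (\<lambda>v. rank K v + 1) ` decode K m"
    then obtain v i where vi: "r = rank K v + 1" "m div B ^ i mod B = rank K v + 1"
      unfolding decode_def B_def[symmetric] by blast
    have "i < t"
    proof (rule ccontr)
      assume "\<not> i < t"
      then have "m < B ^ i"
        using assms(2) power_increasing[of t i B] unfolding B_def by linarith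
      then show False using vi by simp
    qed
    then show "r \<in> (\<lambda>i. m div B ^ i mod B) ` {..<t}" using vi by (metis image_eqI lessThan_iff)
  qed
  then have "card ((\<lambda>v. rank K v + 1) ` decode K m) \<le> card ((\<lambda>i. m div B ^ i mod B) ` {..<t})"
    by (intro card_mono) auto
  also have "\<dots> \<le> t" using card_image_le[of "{..<t}" "\<lambda>i. m div B ^ i mod B"] by simp
  also have "card ((\<lambda>v. rank K v + 1) ` decode K m) = card (decode K m)"
    using rank_eq_iff[OF assms(1)] by (intro card_image inj_onI) (auto simp: decode_def)
  finally show ?thesis .
qed

text \<open>Gives the program a finite range of positions: once \<open>K\<close> is nonempty the
  base is at least 2, and \<open>m < 2 ^ i\<close> for all \<open>i \<ge> m\<close>, so every digit
  from position \<open>m\<close> on is 0.\<close>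

lemma decode_bounded:
  assumes "finite K"
  shows "decode K m = {v\<in>K. \<exists>i<m. m div (card K + 1) ^ i mod (card K + 1) = rank K v + 1}"
proof -
  have "i < m" if "v \<in> K" "m div (card K + 1) ^ i mod (card K + 1) = rank K v + 1" for v i
  proof (rule ccontr)
    assume "\<not> i < m"
    have "card K \<noteq> 0" using that assms by auto
    then have "2 ^ i \<le> (card K + 1) ^ i" by (intro power_mono) auto
    then have "m < (card K + 1) ^ i" using less_exp[of i] \<open>\<not> i < m\<close> by linarith
    then show False using that(2) by simp
  qed
  then show ?thesis unfolding decode_def by blast
qed

text \<open>In the last two assumptions \<open>fexp\<close> tests the vertex in register 10, and \<open>gexp\<close> the candidate in
  array 6 by means of the distances in array 3.\<close>

locale twin_problem =
  fixes good :: "nat set \<Rightarrow> nat set set \<Rightarrow> nat set \<Rightarrow> bool"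
    and forced :: "nat set \<Rightarrow> nat set set \<Rightarrow> nat \<Rightarrow> bool"
    and fexp gexp :: hexp
  assumes good_subset: "good V E S \<Longrightarrow> S \<subseteq> V"
    and normal_form: "simple_graph V E \<Longrightarrow> good V E S \<Longrightarrow> \<exists>S'. good V E S' \<and> card S' \<le> card S \<and>
      {v\<in>V. forced V E v} \<subseteq> S' \<and> S' \<subseteq> {v\<in>V. forced V E v \<or> kept V E v}"
    and vertex_cover: "simple_graph V E \<Longrightarrow> X \<subseteq> V \<Longrightarrow> independent_set E (V - X) \<Longrightarrow>
      good V E ({v\<in>V. forced V E v} \<union> X)"
    and restrict: "twin_reduction V E V' E' \<iota> \<Longrightarrow> \<iota> ` V' = {v\<in>V. kept V E v} \<Longrightarrow> good V E S \<Longrightarrow>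
      {v\<in>V. forced V E v} \<subseteq> S \<Longrightarrow> S \<subseteq> {v\<in>V. forced V E v \<or> kept V E v} \<Longrightarrow>
      good V' E' {i\<in>V'. \<iota> i \<in> S}"
    and extend: "twin_reduction V E V' E' \<iota> \<Longrightarrow> \<iota> ` V' = {v\<in>V. kept V E v} \<Longrightarrow> good V' E' S \<Longrightarrow>
      \<exists>S'. card S' \<le> card S \<and> finite S' \<and> good V E (\<iota> ` S' \<union> {v\<in>V. forced V E v \<and> \<not> kept V E v})"
    and card_ge_2: "twin_reduction V E V' E' \<iota> \<Longrightarrow> \<iota> ` V' = {v\<in>V. kept V E v} \<Longrightarrow> good V' E' S \<Longrightarrow>
      {v\<in>V. forced V E v \<and> \<not> kept V E v} \<noteq> {} \<Longrightarrow> 2 \<le> card S"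
    and fexp_ok: "hexp_ok 30 bound_regs fexp"
    and gexp_ok: "hexp_ok 30 bound_regs gexp"
    and hval_fexp: "simple_graph {..<n} E \<Longrightarrow> adjacency n E (A 0) \<Longrightarrow> \<rho> 0 = n \<Longrightarrow> \<rho> 10 < n \<Longrightarrow>
      hval fexp \<rho> A \<noteq> 0 \<longleftrightarrow> forced {..<n} E (\<rho> 10)"
    and hval_gexp: "simple_graph {..<n} E \<Longrightarrow> matrix n (ndist n E) (A 3) \<Longrightarrow> \<rho> 0 = n \<Longrightarrow>
      S \<subseteq> {..<n} \<Longrightarrow> (\<And>v. v < n \<Longrightarrow> A 6 v \<noteq> 0 \<longleftrightarrow> v \<in> S) \<Longrightarrow>
      hval gexp \<rho> A \<noteq> 0 \<longleftrightarrow> good {..<n} E S"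
begin

definition problem :: "nat set \<Rightarrow> nat set set \<Rightarrow> nat \<Rightarrow> bool" where
  "problem V E k \<longleftrightarrow> (\<exists>S. card S \<le> k \<and> good V E S)"

definition candidate :: "nat set \<Rightarrow> nat set set \<Rightarrow> nat \<Rightarrow> nat set" where
  "candidate V E m = {v\<in>V. forced V E v} \<union> decode {v\<in>V. kept V E v} m"

text \<open>\<open>t\<close> counts the vertices of the normal form beyond the forced ones. Keeping
  it in the statement ties the size of the counter to that of the solution, which both the time
  bound and the optimality of the first good candidate exploit.\<close>

lemma candidate_exists:
  assumes "simple_graph V E" "good V E S"
  shows "\<exists>m t. m < (card {v\<in>V. kept V E v} + 1) ^ t \<and> good V E (candidate V E m) \<and>
    card {v\<in>V. forced V E v} + t \<le> card S"
proof -
  let ?F = "{v\<in>V. forced V E v}" and ?K = "{v\<in>V. kept V E v}"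
  have fin: "finite V" using assms(1) by (simp add: simple_graph_def)
  obtain S' where S': "good V E S'" "card S' \<le> card S" "?F \<subseteq> S'" "S' \<subseteq> {v\<in>V. forced V E v \<or> kept V E v}"
    using normal_form[OF assms] by blast
  have "S' - ?F \<subseteq> ?K" using S'(4) by blast
  then obtain m where m: "m < (card ?K + 1) ^ card (S' - ?F)" "decode ?K m = S' - ?F"
    using decode_surj[of ?K "S' - ?F"] fin by auto
  have "candidate V E m = S'" using m(2) S'(3) by (auto simp: candidate_def)
  then have "good V E (candidate V E m)" using S'(1) by (simp only:)
  moreover have "S' \<subseteq> V" using S'(4) by blast
  then have "finite S'" using fin finite_subset by blast
  then have "card ?F + card (S' - ?F) = card S'"
    using card_Diff_subset[OF finite_subset[OF S'(3)] S'(3)] card_mono[OF _ S'(3)] by simp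
  then have "card ?F + card (S' - ?F) \<le> card S" using S'(2) by simp
  ultimately show ?thesis using m(1) by blast
qed

lemma candidate_bound:
  assumes "simple_graph V E"
  shows "\<exists>m<(card {v\<in>V. kept V E v} + 1) ^ vc V E. good V E (candidate V E m)"
proof -
  have fin: "finite V" using assms by (simp add: simple_graph_def)
  obtain X where X: "X \<subseteq> V" "card X = vc V E" "independent_set E (V - X)" using vc_witness[OF fin] .
  obtain m t where m: "m < (card {v\<in>V. kept V E v} + 1) ^ t" "good V E (candidate V E m)"
    "card {v\<in>V. forced V E v} + t \<le> card ({v\<in>V. forced V E v} \<union> X)"
    using candidate_exists[OF assms vertex_cover[OF assms X(1,3)]] by blast
  have "t \<le> vc V E" using m(3) card_Un_le[of "{v\<in>V. forced V E v}" X] X(2) by linarith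
  then have "(card {v\<in>V. kept V E v} + 1) ^ t \<le> (card {v\<in>V. kept V E v} + 1) ^ vc V E"
    by (intro power_increasing) auto
  with m show ?thesis by (meson order.strict_trans2)
qed

lemma problem_iff_least_candidate:
  assumes "simple_graph V E" "good V E (candidate V E m)"
    and least: "\<And>m'. good V E (candidate V E m') \<Longrightarrow> m \<le> m'"
  shows "problem V E k \<longleftrightarrow> card (candidate V E m) \<le> k"
proof
  assume "problem V E k"
  then obtain S where S: "card S \<le> k" "good V E S" by (auto simp: problem_def)
  have fin: "finite V" using assms by (simp add: simple_graph_def)
  obtain m' t where m': "m' < (card {v\<in>V. kept V E v} + 1) ^ t" "good V E (candidate V E m')"
    "card {v\<in>V. forced V E v} + t \<le> card S"
    using candidate_exists[OF assms(1) S(2)] by blast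
  have "m < (card {v\<in>V. kept V E v} + 1) ^ t" using least[OF m'(2)] m'(1) by simp
  then have "card (decode {v\<in>V. kept V E v} m) \<le> t" using fin by (intro card_decode_le) auto
  then show "card (candidate V E m) \<le> k"
    using card_Un_le[of "{v\<in>V. forced V E v}" "decode {v\<in>V. kept V E v} m"] m'(3) S(1)
    unfolding candidate_def by linarith
next
  assume "card (candidate V E m) \<le> k"
  then show "problem V E k" using assms(2) by (auto simp: problem_def)
qed

text \<open>\<open>max 1\<close> keeps the instance valid. It could help a kernel solution only if
  that had at most one element, and by \<open>card_ge_2\<close> this does not happen once a forced
  vertex was deleted. The cap excludes no solution, as all of them are subsets of
  \<open>V'\<close>.\<close>

lemma problem_kernel:
  assumes red: "twin_reduction V E V' E' \<iota>" and im: "\<iota> ` V' = {v\<in>V. kept V E v}" and "k \<ge> 1"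
  shows "problem V' E' (min (max 1 (k - card {v\<in>V. forced V E v \<and> \<not> kept V E v})) (card V' + 1)) \<longleftrightarrow>
    problem V E k"
proof -
  interpret twin_reduction V E V' E' \<iota> by (rule red)
  let ?R = "{v\<in>V. forced V E v \<and> \<not> kept V E v}"
  define k' where "k' = max 1 (k - card ?R)"
  have "problem V' E' (min k' (card V' + 1)) \<longleftrightarrow> problem V' E' k'"
  proof
    assume "problem V' E' k'"
    then obtain S where S: "card S \<le> k'" "good V' E' S" by (auto simp: problem_def)
    then have "card S \<le> card V'" using card_mono[OF fin(2) good_subset[OF S(2)]] by simp
    with S show "problem V' E' (min k' (card V' + 1))" unfolding problem_def by (intro exI[of _ S]) simp
  next
    assume "problem V' E' (min k' (card V' + 1))"
    then show "problem V' E' k'" unfolding problem_def by (meson min.boundedE)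
  qed
  also have "\<dots> \<longleftrightarrow> problem V E k"
  proof
    assume "problem V' E' k'"
    then obtain S where S: "card S \<le> k'" "good V' E' S" by (auto simp: problem_def)
    obtain S' where S': "card S' \<le> card S" "finite S'" "good V E (\<iota> ` S' \<union> ?R)"
      using extend[OF red im S(2)] by blast
    have finR: "finite ?R" using fin by simp
    have "card (\<iota> ` S' \<union> ?R) \<le> card S' + card ?R" using S'(2) finR by (rule card_extend)
    moreover have "card S + card ?R \<le> k"
    proof (cases "?R = {}")
      case True
      then have "card ?R = 0" by (simp only: card.empty)
      then show ?thesis using S(1) \<open>k \<ge> 1\<close> unfolding k'_def by linarith
    next
      case False
      then have "2 \<le> card S" using card_ge_2[OF red im S(2)] by blast
      then show ?thesis using S(1) unfolding k'_def by linarith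
    qed
    ultimately show "problem V E k" using S' unfolding problem_def by (intro exI[of _ "\<iota> ` S' \<union> ?R"]) simp
  next
    assume "problem V E k"
    then obtain S where S: "card S \<le> k" "good V E S" by (auto simp: problem_def)
    obtain S' where S': "good V E S'" "card S' \<le> card S" "{v\<in>V. forced V E v} \<subseteq> S'"
      "S' \<subseteq> {v\<in>V. forced V E v \<or> kept V E v}"
      using normal_form[OF graph S(2)] by blast
    have g: "good V' E' {i\<in>V'. \<iota> i \<in> S'}" by (rule restrict[OF red im S'(1,3,4)])
    have "S' \<subseteq> V" using good_subset S'(1) .
    then have "card {i\<in>V'. \<iota> i \<in> S'} + card (S' - \<iota> ` V') = card S'"
      using fin finite_subset by (intro card_restrict) auto
    moreover have "S' - \<iota> ` V' = ?R" using S'(3,4) unfolding im by blast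
    ultimately have "card {i\<in>V'. \<iota> i \<in> S'} \<le> k'" using S'(2) S(1) unfolding k'_def by simp
    with g show "problem V' E' k'" by (auto simp: problem_def)
  qed
  finally show ?thesis by (simp add: k'_def)
qed

end

lemma exec_hrun:
  assumes "hcom_ok 30 bound_regs c" "\<forall>b\<in>bound_regs. reg s b \<le> N"
  shows "\<exists>t s'. exec (hcom_com 30 c) s t s' \<and> arr s' = arr (hrun c s) \<and>
    (\<forall>x<30. reg s' x = reg (hrun c s) x) \<and> (\<forall>b\<in>bound_regs. reg s' b \<le> N) \<and> t \<le> hcom_cost c N"
proof -
  obtain t s' where *: "exec (hcom_com 30 c) s t s'" "agree 30 s' (reg (hrun c s)) (arr (hrun c s))"
    "t \<le> hcom_cost c N"
    using exec_hcom_com[OF assms(1) order_refl _ assms(2), of s] by (auto simp: agree_def)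
  moreover have "\<forall>b\<in>bound_regs. reg s' b \<le> N"
    using hrun_bounded[OF assms] *(2) by (auto simp: agree_def)
  ultimately show ?thesis by (intro exI[of _ t] exI[of _ s']) (auto simp: agree_def)
qed


section \<open>The programs\<close>

definition rankx :: "nat \<Rightarrow> hexp" where
  "rankx v = HSum 26 v (HA 1 (HV 26))"

definition prep_com :: "hexp \<Rightarrow> hcom" where
  "prep_com fexp = HSeq (fill 1 keptx) (fill 2 (notx (notx fexp)))"

text \<open>Position of the pair in registers 10 and 11 within the matrix of the kernel. Adding
  register 2, the kernel size, once for each kept vertex below the first one multiplies its rank by
  that size.\<close>

definition posx :: hexp where
  "posx = HPlus (HSum 26 10 (HGuard (HA 1 (HV 26)) (HV 2))) (rankx 11)"

definition both_keptx :: hexp where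
  "both_keptx = andx (HA 1 (HV 10)) (HA 1 (HV 11))"

text \<open>Truncated subtraction yields \<open>max 1 a\<close> as \<open>a + (1 - a)\<close> and
  \<open>min b c\<close> as \<open>b - (b - c)\<close>.\<close>

definition sizex :: hexp where
  "sizex = (let a = HMinus (HV 1) (HV 6); b = HPlus a (notx a)
     in HMinus b (HMinus b (HPlus (HV 2) (HC 1))))"

text \<open>The new matrix is assembled in array 4 and copied to array 0 afterwards, because its
  entries would overwrite parts of the old matrix that are still to be read.\<close>

definition kernel_com :: "hexp \<Rightarrow> hcom" where
  "kernel_com fexp = HSeq (prep_com fexp)
     (HSeq (HAsg 2 (HSum 10 0 (HA 1 (HV 10))))
     (HSeq (HAsg 6 (HSum 10 0 (andx (HA 2 (HV 10)) (notx (HA 1 (HV 10))))))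
     (HSeq (scatter 4 both_keptx posx (adjx 10 11))
     (HSeq (scatter 0 both_keptx posx (HA 4 posx))
           (HAsg 1 sizex)))))"

text \<open>Register 0 bounds loops and so may not be assigned in the structured language; a final
  machine instruction replaces it by the new number of vertices.\<close>

definition kernel_prog :: "hexp \<Rightarrow> com" where
  "kernel_prog fexp = Seq (hcom_com 30 (kernel_com fexp)) (SetReg 0 (Reg 2))"

text \<open>Division by counting the \<open>j\<close> for which \<open>j + 1\<close> copies of the
  divisor fit. Register 3 is a sufficient range because the dividend in register 5 never exceeds
  it.\<close>

definition divx :: hexp where
  "divx = HSum 13 3 (notx (lessx (HV 5) (HPlus (HSum 14 13 (HV 2)) (HV 2))))"

definition modx :: hexp where
  "modx = HMinus (HV 5) (HSum 13 3 (HGuard (lessx (HV 13) (HV 6)) (HV 2)))"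

definition decode_com :: hcom where
  "decode_com = HSeq (HAsg 5 (HV 3))
     (HFor 12 3 (HSeq (HAsg 6 divx) (HSeq (HStore 5 (HV 12) modx) (HAsg 5 (HV 6)))))"

definition candx :: hexp where
  "candx = orx (HA 2 (HV 10)) (andx (HA 1 (HV 10))
     (exx 12 3 (eqx (HA 5 (HV 12)) (HPlus (rankx 10) (HC 1)))))"

definition init_com :: "hexp \<Rightarrow> hcom" where
  "init_com fexp = HSeq (prep_com fexp)
     (HSeq dist_com (HAsg 2 (HPlus (HSum 10 0 (HA 1 (HV 10))) (HC 1))))"

definition try_com :: "hexp \<Rightarrow> hcom" where
  "try_com gexp = HSeq decode_com (HSeq (fill 6 candx) (HAsg 4 gexp))"

definition answer_com :: hcom where
  "answer_com = HAsg 7 (notx (lessx (HV 1) (HSum 10 0 (HA 6 (HV 10)))))"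

text \<open>Register 3 bounds loops of the body and is therefore incremented by a machine
  instruction. The increment follows the test, so at exit the successful counter value is one less;
  its candidate is still marked in array 6, from which the answer is computed.\<close>

definition search_prog :: "hexp \<Rightarrow> hexp \<Rightarrow> com" where
  "search_prog fexp gexp = Seq (hcom_com 30 (init_com fexp))
     (Seq (While (Eq (Reg 4) (Const 0))
            (Seq (hcom_com 30 (try_com gexp)) (SetReg 3 (Add (Reg 3) (Const 1)))))
     (Seq (hcom_com 30 answer_com) (SetReg 0 (Reg 7))))"

section \<open>Correctness of the program parts\<close>

lemma sum_of_bool: "(\<Sum>j<n::nat. of_bool (P j) :: nat) = card {j\<in>{..<n}. P j}"
proof -
  have "(\<Sum>j<n. of_bool (P j) :: nat) = card ({..<n} \<inter> {j. P j})"
    by simp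
  also have "{..<n} \<inter> {j. P j} = {j\<in>{..<n}. P j}" by blast
  finally show ?thesis .
qed

abbreviation kept_set :: "nat \<Rightarrow> nat set set \<Rightarrow> nat set" where
  "kept_set n E \<equiv> {v\<in>{..<n}. kept {..<n} E v}"

lemma hval_rankx:
  assumes "\<forall>v<n. A 1 v = of_bool (kept {..<n} E v)" "\<rho> v < n"
  shows "hval (rankx v) \<rho> A = rank (kept_set n E) (\<rho> v)"
proof -
  have "hval (rankx v) \<rho> A = (\<Sum>j<\<rho> v. of_bool (kept {..<n} E j))"
    unfolding rankx_def hval.simps using assms by (intro sum.cong) simp_all
  also have "\<dots> = card {j\<in>{..<\<rho> v}. kept {..<n} E j}" by (rule sum_of_bool)
  also have "{j\<in>{..<\<rho> v}. kept {..<n} E j} = {u\<in>kept_set n E. u < \<rho> v}" using assms(2) by auto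
  finally show ?thesis by (simp only: rank_def)
qed

lemma hval_divx:
  assumes "\<rho> 5 \<le> \<rho> 3" "\<rho> 2 > 0"
  shows "hval divx \<rho> A = \<rho> 5 div \<rho> 2"
proof -
  have "hval divx \<rho> A = (\<Sum>j<\<rho> 3. of_bool (j < \<rho> 5 div \<rho> 2))"
    unfolding divx_def hval.simps(7)
  proof (intro sum.cong refl)
    fix j
    have "hval (HPlus (HSum 14 13 (HV 2)) (HV 2)) (\<rho>(13 := j)) A = j * \<rho> 2 + \<rho> 2" by simp
    moreover have "\<not> \<rho> 5 < j * \<rho> 2 + \<rho> 2 \<longleftrightarrow> j < \<rho> 5 div \<rho> 2"
      using less_eq_div_iff_mult_less_eq[OF assms(2), of "j + 1" "\<rho> 5"]
      by (simp add: not_less add.commute Suc_le_eq)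
    ultimately show "hval (notx (lessx (HV 5) (HPlus (HSum 14 13 (HV 2)) (HV 2)))) (\<rho>(13 := j)) A =
        of_bool (j < \<rho> 5 div \<rho> 2)"
      unfolding hval_logic by simp
  qed
  also have "\<dots> = card {j\<in>{..<\<rho> 3}. j < \<rho> 5 div \<rho> 2}" by (rule sum_of_bool)
  also have "{j\<in>{..<\<rho> 3}. j < \<rho> 5 div \<rho> 2} = {..<\<rho> 5 div \<rho> 2}"
    using order_trans[OF div_le_dividend assms(1), of "\<rho> 2"] by auto
  finally show ?thesis by simp
qed

lemma hval_modx:
  assumes "\<rho> 5 \<le> \<rho> 3" "\<rho> 6 = \<rho> 5 div \<rho> 2"
  shows "hval modx \<rho> A = \<rho> 5 mod \<rho> 2"
proof -
  have "hval (HSum 13 3 (HGuard (lessx (HV 13) (HV 6)) (HV 2))) \<rho> A =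
      (\<Sum>j<\<rho> 3. of_bool (j < \<rho> 6) * \<rho> 2)"
    unfolding hval.simps(7) by (intro sum.cong) simp_all
  also have "\<dots> = (\<Sum>j<\<rho> 3. of_bool (j < \<rho> 6)) * \<rho> 2" by (simp only: sum_distrib_right)
  also have "\<dots> = card {j\<in>{..<\<rho> 3}. j < \<rho> 6} * \<rho> 2" by (simp only: sum_of_bool)
  also have "{j\<in>{..<\<rho> 3}. j < \<rho> 6} = {..<\<rho> 6}"
    using order_trans[OF div_le_dividend assms(1), of "\<rho> 2"] assms(2) by auto
  finally have "hval (HSum 13 3 (HGuard (lessx (HV 13) (HV 6)) (HV 2))) \<rho> A = \<rho> 5 div \<rho> 2 * \<rho> 2"
    using assms(2) by simp
  then show ?thesis unfolding modx_def hval.simps(5,2) by (simp add: minus_div_mult_eq_mod)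
qed

lemma hrun_decode_com:
  assumes "reg s 2 > 0"
  shows "\<forall>x. x \<notin> {5, 6, 12} \<longrightarrow> reg (hrun decode_com s) x = reg s x"
    and "\<forall>b. b \<noteq> 5 \<longrightarrow> arr (hrun decode_com s) b = arr s b"
    and "\<forall>i<reg s 3. arr (hrun decode_com s) 5 i = reg s 3 div reg s 2 ^ i mod reg s 2"
proof -
  define B m where "B = reg s 2" and "m = reg s 3"
  define I where "I = (\<lambda>i (s'::state). (\<forall>x. x \<notin> {5, 6, 12} \<longrightarrow> reg s' x = reg s x) \<and>
    (\<forall>b. b \<noteq> 5 \<longrightarrow> arr s' b = arr s b) \<and> reg s' 5 = m div B ^ i \<and>
    (\<forall>j<i. arr s' 5 j = m div B ^ j mod B))"
  let ?c = "HSeq (HAsg 6 divx) (HSeq (HStore 5 (HV 12) modx) (HAsg 5 (HV 6)))"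
  have "I m (loop (\<lambda>i s'. hrun ?c (set_reg 12 i s')) m (set_reg 5 m s))"
  proof (rule loop_inv)
    fix i and s' :: state assume "i < m" and I: "I i s'"
    define s1 where "s1 = set_reg 12 i s'"
    have 1: "reg s1 2 = B" "reg s1 3 = m" "reg s1 5 = m div B ^ i"
      using I by (simp_all add: s1_def I_def B_def m_def)
    define s2 where "s2 = set_reg 6 (m div B ^ i div B) s1"
    have d: "hval divx (reg s1) (arr s1) = m div B ^ i div B"
      using hval_divx[of "reg s1" "arr s1"] 1 assms by (simp add: B_def)
    have 2: "hval modx (reg s2) (arr s2) = m div B ^ i mod B"
      using hval_modx[of "reg s2" "arr s2"] 1 by (simp add: s2_def)
    have r12: "reg s2 12 = i" by (simp add: s2_def s1_def)
    have "hrun ?c s1 = set_reg 5 (m div B ^ i div B) (set_arr 5 i (m div B ^ i mod B) s2)"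
      using 2 r12 d by (simp add: s2_def)
    moreover have "m div B ^ i div B = m div B ^ Suc i"
      by (simp only: power_Suc2 div_mult2_eq)
    ultimately show "I (Suc i) (hrun ?c (set_reg 12 i s'))"
      using I by (auto simp: I_def s1_def s2_def less_Suc_eq)
  qed (simp add: I_def)
  then have "I m (hrun decode_com s)" by (simp add: decode_com_def m_def)
  then show "\<forall>x. x \<notin> {5, 6, 12} \<longrightarrow> reg (hrun decode_com s) x = reg s x"
    "\<forall>b. b \<noteq> 5 \<longrightarrow> arr (hrun decode_com s) b = arr s b"
    "\<forall>i<reg s 3. arr (hrun decode_com s) 5 i = reg s 3 div reg s 2 ^ i mod reg s 2"
    by (simp_all add: I_def B_def m_def)
qed

lemma hcom_ok_programs:
  assumes "hexp_ok 30 bound_regs fexp" "hexp_ok 30 bound_regs gexp"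
  shows "hcom_ok 30 bound_regs (kernel_com fexp)" "hcom_ok 30 bound_regs (init_com fexp)"
    "hcom_ok 30 bound_regs (try_com gexp)" "hcom_ok 30 bound_regs answer_com"
  using assms
  by (simp_all add: kernel_com_def prep_com_def both_keptx_def posx_def rankx_def sizex_def Let_def
      init_com_def try_com_def decode_com_def divx_def modx_def candx_def answer_com_def)

context twin_problem
begin

definition prepared :: "nat \<Rightarrow> nat set set \<Rightarrow> state \<Rightarrow> bool" where
  "prepared n E s \<longleftrightarrow> reg s 0 = n \<and> adjacency n E (arr s 0) \<and>
     (\<forall>v<n. arr s 1 v = of_bool (kept {..<n} E v)) \<and>
     (\<forall>v<n. arr s 2 v = of_bool (forced {..<n} E v))"

lemma hrun_prep_com:
  assumes "simple_graph {..<n} E" "reg s 0 = n" "adjacency n E (arr s 0)"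
  shows "prepared n E (hrun (prep_com fexp) s)"
    and "\<forall>x. x \<noteq> 10 \<longrightarrow> reg (hrun (prep_com fexp) s) x = reg s x"
    and "\<forall>b. b \<noteq> 1 \<and> b \<noteq> 2 \<longrightarrow> arr (hrun (prep_com fexp) s) b = arr s b"
proof -
  define s1 where "s1 = hrun (fill 1 keptx) s"
  have e1: "hval keptx ((reg s)(10 := j)) A = of_bool (kept {..<n} E j)"
    if "j < reg s 0" "same_arrs 1 (arr s) A" for j A
    using hval_keptx[of n E A "(reg s)(10 := j)"] that assms by (simp add: same_arrs_def)
  note f1 = hrun_fill[where a = 1 and e = keptx and s = s, OF e1, folded s1_def]
  have 1: "reg s1 0 = n" "adjacency n E (arr s1 0)" using f1(1,2) assms by simp_all
  have e2: "hval (notx (notx fexp)) ((reg s1)(10 := j)) A = of_bool (forced {..<n} E j)"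
    if "j < reg s1 0" "same_arrs 2 (arr s1) A" for j A
    using hval_fexp[of n E A "(reg s1)(10 := j)"] that 1 assms(1) by (simp add: same_arrs_def)
  note f2 = hrun_fill[where a = 2 and e = "notx (notx fexp)" and s = s1, OF e2]
  have eq: "hrun (prep_com fexp) s = hrun (fill 2 (notx (notx fexp))) s1"
    by (simp add: prep_com_def s1_def)
  show "prepared n E (hrun (prep_com fexp) s)"
    unfolding eq prepared_def using f1 f2 1 assms(2) by simp
  show "\<forall>x. x \<noteq> 10 \<longrightarrow> reg (hrun (prep_com fexp) s) x = reg s x"
    unfolding eq using f1(1) f2(1) by simp
  show "\<forall>b. b \<noteq> 1 \<and> b \<noteq> 2 \<longrightarrow> arr (hrun (prep_com fexp) s) b = arr s b"
    unfolding eq using f1(2) f2(2) by simp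
qed

end

text \<open>The inverse of the numbering by ranks that the program computes.\<close>

definition kernel_embedding :: "nat \<Rightarrow> nat set set \<Rightarrow> nat \<Rightarrow> nat" where
  "kernel_embedding n E = inv_into (kept_set n E) (rank (kept_set n E))"

definition kernel_edges :: "nat \<Rightarrow> nat set set \<Rightarrow> nat set set" where
  "kernel_edges n E = {{i, j} |i j. i < card (kept_set n E) \<and> j < card (kept_set n E) \<and>
     {kernel_embedding n E i, kernel_embedding n E j} \<in> E}"

lemma kernel_embedding:
  shows "kernel_embedding n E ` {..<card (kept_set n E)} = kept_set n E"
    and "inj_on (kernel_embedding n E) {..<card (kept_set n E)}"
    and "i < card (kept_set n E) \<Longrightarrow> rank (kept_set n E) (kernel_embedding n E i) = i"
proof -
  have bij: "bij_betw (rank (kept_set n E)) (kept_set n E) {..<card (kept_set n E)}"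
    by (rule bij_betw_rank) simp
  have "bij_betw (kernel_embedding n E) {..<card (kept_set n E)} (kept_set n E)"
    unfolding kernel_embedding_def using bij by (rule bij_betw_inv_into)
  then show "kernel_embedding n E ` {..<card (kept_set n E)} = kept_set n E"
    and "inj_on (kernel_embedding n E) {..<card (kept_set n E)}"
    by (simp_all add: bij_betw_def)
  show "rank (kept_set n E) (kernel_embedding n E i) = i" if "i < card (kept_set n E)"
    unfolding kernel_embedding_def using bij that by (intro f_inv_into_f) (simp add: bij_betw_def)
qed

lemma kernel_edges_iff:
  assumes "i < card (kept_set n E)" "j < card (kept_set n E)"
  shows "{i, j} \<in> kernel_edges n E \<longleftrightarrow> {kernel_embedding n E i, kernel_embedding n E j} \<in> E"
proof
  assume "{i, j} \<in> kernel_edges n E"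
  then obtain k l where kl: "{i, j} = {k, l}" "{kernel_embedding n E k, kernel_embedding n E l} \<in> E"
    unfolding kernel_edges_def by blast
  from kl(1) have "kernel_embedding n E ` {i, j} = kernel_embedding n E ` {k, l}" by simp
  with kl(2) show "{kernel_embedding n E i, kernel_embedding n E j} \<in> E" by simp
next
  assume "{kernel_embedding n E i, kernel_embedding n E j} \<in> E"
  then show "{i, j} \<in> kernel_edges n E" using assms unfolding kernel_edges_def by blast
qed

text \<open>The five remaining twins come from \<open>not_kept_twins\<close>, pulled back along the
  numbering of the kept vertices.\<close>

lemma twin_reduction_kernel:
  assumes "simple_graph {..<n} E"
  shows "twin_reduction {..<n} E {..<card (kept_set n E)} (kernel_edges n E) (kernel_embedding n E)"
proof
  show "simple_graph {..<card (kept_set n E)} (kernel_edges n E)"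
    unfolding simple_graph_def
  proof (intro conjI ballI)
    fix e assume "e \<in> kernel_edges n E"
    then obtain i j where e: "e = {i, j}" "i < card (kept_set n E)" "j < card (kept_set n E)"
      "{kernel_embedding n E i, kernel_embedding n E j} \<in> E"
      unfolding kernel_edges_def by blast
    then have "i \<noteq> j" using simple_graph_no_loop[OF assms, of "kernel_embedding n E i"] by auto
    with e show "e \<subseteq> {..<card (kept_set n E)}" "card e = 2" by simp_all
  qed simp
  show "\<exists>C\<subseteq>{..<card (kept_set n E)}. card C = 5 \<and> (\<forall>c\<in>C. twins {..<n} E v (kernel_embedding n E c))"
    if v: "v \<in> {..<n}" "v \<notin> kernel_embedding n E ` {..<card (kept_set n E)}" for v
  proof -
    have "\<not> kept {..<n} E v" using v unfolding kernel_embedding(1) by simp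
    then obtain C where C: "C \<subseteq> kept_set n E" "card C = 5" "\<forall>c\<in>C. c < v \<and> twins {..<n} E c v"
      using not_kept_twins[of "{..<n}" v E] v(1) by auto
    let ?C = "{i\<in>{..<card (kept_set n E)}. kernel_embedding n E i \<in> C}"
    have "C \<subseteq> kernel_embedding n E ` {..<card (kept_set n E)}" unfolding kernel_embedding(1) by (rule C(1))
    then have "kernel_embedding n E ` ?C = C" by auto
    moreover have inj: "inj_on (kernel_embedding n E) ?C"
      using kernel_embedding(2) by (rule inj_on_subset) auto
    moreover have "card (kernel_embedding n E ` ?C) = card ?C" using inj by (rule card_image)
    ultimately have "card ?C = 5" using C(2) by simp
    moreover have "\<forall>c\<in>?C. twins {..<n} E v (kernel_embedding n E c)"
    proof
      fix c assume "c \<in> ?C"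
      then have "twins {..<n} E (kernel_embedding n E c) v" using C(3) by simp
      then show "twins {..<n} E v (kernel_embedding n E c)" by (rule twins_sym)
    qed
    moreover have "?C \<subseteq> {..<card (kept_set n E)}" by blast
    ultimately show ?thesis by blast
  qed
  show "simple_graph {..<n} E" by (rule assms)
  show "inj_on (kernel_embedding n E) {..<card (kept_set n E)}" by (rule kernel_embedding(2))
  show "kernel_embedding n E ` {..<card (kept_set n E)} \<subseteq> {..<n}"
    unfolding kernel_embedding(1) by auto
  show "{i, j} \<in> kernel_edges n E \<longleftrightarrow> {kernel_embedding n E i, kernel_embedding n E j} \<in> E"
    if "i \<in> {..<card (kept_set n E)}" "j \<in> {..<card (kept_set n E)}" for i j
    by (rule kernel_edges_iff) (use that in \<open>simp_all only: lessThan_iff\<close>)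
qed

context twin_problem
begin

lemma hrun_kernel_com:
  assumes G: "simple_graph {..<n} E" and s: "reg s 0 = n" "reg s 1 = k" "adjacency n E (arr s 0)"
  defines "n' \<equiv> card (kept_set n E)"
    and "r \<equiv> card {v\<in>{..<n}. forced {..<n} E v \<and> \<not> kept {..<n} E v}"
  shows "reg (hrun (kernel_com fexp) s) 2 = n'"
    and "reg (hrun (kernel_com fexp) s) 1 = min (max 1 (k - r)) (n' + 1)"
    and "adjacency n' (kernel_edges n E) (arr (hrun (kernel_com fexp) s) 0)"
proof -
  let ?K = "kept_set n E"
  define s1 where "s1 = hrun (prep_com fexp) s"
  note p = hrun_prep_com[OF G s(1,3), folded s1_def]
  have s1: "reg s1 0 = n" "reg s1 1 = k" "adjacency n E (arr s1 0)"
    and kept1: "\<forall>v<n. arr s1 1 v = of_bool (kept {..<n} E v)"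
    and forced1: "\<forall>v<n. arr s1 2 v = of_bool (forced {..<n} E v)"
    using p s(2) by (simp_all add: prepared_def)
  have "hval (HSum 10 0 (HA 1 (HV 10))) (reg s1) (arr s1) = (\<Sum>j<n. of_bool (kept {..<n} E j))"
    unfolding hval.simps s1(1) using kept1 by (intro sum.cong) simp_all
  then have v2: "hval (HSum 10 0 (HA 1 (HV 10))) (reg s1) (arr s1) = n'"
    unfolding n'_def by (simp only: sum_of_bool)
  define s2 where "s2 = set_reg 2 n' s1"
  have "hval (HSum 10 0 (andx (HA 2 (HV 10)) (notx (HA 1 (HV 10))))) (reg s2) (arr s2) =
      (\<Sum>j<n. of_bool (forced {..<n} E j \<and> \<not> kept {..<n} E j))"
    unfolding hval.simps(7) using kept1 forced1 s1(1) by (intro sum.cong) (simp_all add: s2_def)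
  then have v6: "hval (HSum 10 0 (andx (HA 2 (HV 10)) (notx (HA 1 (HV 10))))) (reg s2) (arr s2) = r"
    unfolding r_def by (simp only: sum_of_bool)
  define s3 where "s3 = set_reg 6 r s2"
  have s3: "reg s3 0 = n" "reg s3 1 = k" "reg s3 2 = n'" "reg s3 6 = r" "arr s3 = arr s1"
    using s1 by (simp_all add: s3_def s2_def)
  define P where "P = (\<lambda>u v. rank ?K u * n' + rank ?K v)"
  have posx: "hval posx ((reg t)(10 := u, 11 := v)) A = P u v"
    if "reg t 0 = n" "reg t 2 = n'" "A 1 = arr s1 1" "u < n" "v < n" for t A u v
  proof -
    let ?\<rho> = "(reg t)(10 := u, 11 := v)"
    have "hval (HSum 26 10 (HGuard (HA 1 (HV 26)) (HV 2))) ?\<rho> A = (\<Sum>j<u. A 1 j * n')"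
      unfolding hval.simps(7) using that kept1 by (intro sum.cong) simp_all
    also have "\<dots> = (\<Sum>j<u. A 1 j) * n'" by (simp only: sum_distrib_right)
    also have "(\<Sum>j<u. A 1 j) = hval (rankx 10) ?\<rho> A" by (simp add: rankx_def)
    also have "\<dots> = rank ?K u" using hval_rankx[of n A E ?\<rho> 10] that kept1 by simp
    finally have "hval (HSum 26 10 (HGuard (HA 1 (HV 26)) (HV 2))) ?\<rho> A = rank ?K u * n'" .
    moreover have "hval (rankx 11) ?\<rho> A = rank ?K v" using hval_rankx[of n A E ?\<rho> 11] that kept1 by simp
    ultimately show ?thesis unfolding posx_def hval.simps(4) P_def by simp
  qed
  have both: "hval both_keptx ((reg t)(10 := u, 11 := v)) A \<noteq> 0 \<longleftrightarrow> u \<in> ?K \<and> v \<in> ?K"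
    if "A 1 = arr s1 1" "u < n" "v < n" for t A u v
    using that kept1 by (simp add: both_keptx_def)
  \<comment> \<open>Ranks of kept vertices are below \<open>n'\<close>, so the row-major position
    determines both. The common bound \<open>m\<close> is left open to let the statement serve both
    calls of \<open>hrun_scatter\<close>.\<close>
  have inj: "u = w \<and> v = x" if "u < m" "v < m" "w < m" "x < m"
      and K: "u \<in> ?K \<and> v \<in> ?K" "w \<in> ?K \<and> x \<in> ?K" and P: "P u v = P w x" for u v w x m
  proof -
    have fin: "finite ?K" by simp
    have "rank ?K v < n'" "rank ?K x < n'" unfolding n'_def using K rank_less_card[OF fin] by simp_all
    then have "rank ?K u = rank ?K w \<and> rank ?K v = rank ?K x" using P unfolding P_def by (rule row_major_inj)
    then show ?thesis using K rank_eq_iff[OF fin] by simp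
  qed
  define s4 where "s4 = hrun (scatter 4 both_keptx posx (adjx 10 11)) s3"
  have e4: "(hval both_keptx ((reg s3)(10 := i, 11 := j)) A \<noteq> 0 \<longleftrightarrow> i \<in> ?K \<and> j \<in> ?K) \<and>
      (i \<in> ?K \<and> j \<in> ?K \<longrightarrow> hval posx ((reg s3)(10 := i, 11 := j)) A = P i j \<and>
        hval (adjx 10 11) ((reg s3)(10 := i, 11 := j)) A = of_bool ({i, j} \<in> E))"
    if "i < reg s3 0" "j < reg s3 0" "same_arrs 4 (arr s3) A" for i j A
  proof -
    have A: "A 1 = arr s1 1" "A 0 = arr s1 0" using that(3) s3(5) by (simp_all add: same_arrs_def)
    have ij: "i < n" "j < n" using that s3(1) by simp_all
    have a: "hval (adjx 10 11) ((reg s3)(10 := i, 11 := j)) A = of_bool ({i, j} \<in> E)"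
      using hval_adjx[of n E A "(reg s3)(10 := i, 11 := j)" 10 11] A s1(3) s3(1) ij by simp
    show ?thesis
      by (simp only: a both[of A i j s3, OF A(1) ij] posx[of s3 A i j, OF s3(1,3) A(1) ij] simp_thms)
  qed
  have r4:
    "\<forall>x. x \<noteq> 10 \<and> x \<noteq> 11 \<longrightarrow> reg s4 x = reg s3 x"
    "\<forall>b. b \<noteq> 4 \<longrightarrow> arr s4 b = arr s3 b"
    "\<forall>i<reg s3 0. \<forall>j<reg s3 0. i \<in> ?K \<and> j \<in> ?K \<longrightarrow> arr s4 4 (P i j) = of_bool ({i, j} \<in> E)"
    unfolding s4_def
    subgoal by (rule hrun_scatter(1)[where G = "\<lambda>i j. i \<in> ?K \<and> j \<in> ?K" and P = P and X = "\<lambda>i j. of_bool ({i, j} \<in> E)"]; (rule e4 | rule inj); assumption)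
    subgoal by (rule hrun_scatter(2)[where G = "\<lambda>i j. i \<in> ?K \<and> j \<in> ?K" and P = P and X = "\<lambda>i j. of_bool ({i, j} \<in> E)"]; (rule e4 | rule inj); assumption)
    subgoal by (rule hrun_scatter(3)[where G = "\<lambda>i j. i \<in> ?K \<and> j \<in> ?K" and P = P and X = "\<lambda>i j. of_bool ({i, j} \<in> E)"]; (rule e4 | rule inj); assumption)
    done
  have s4: "reg s4 0 = n" "reg s4 1 = k" "reg s4 2 = n'" "reg s4 6 = r" "arr s4 1 = arr s1 1"
    using r4(1,2) s3 by simp_all
  define s5 where "s5 = hrun (scatter 0 both_keptx posx (HA 4 posx)) s4"
  have e5: "(hval both_keptx ((reg s4)(10 := i, 11 := j)) A \<noteq> 0 \<longleftrightarrow> i \<in> ?K \<and> j \<in> ?K) \<and>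
      (i \<in> ?K \<and> j \<in> ?K \<longrightarrow> hval posx ((reg s4)(10 := i, 11 := j)) A = P i j \<and>
        hval (HA 4 posx) ((reg s4)(10 := i, 11 := j)) A = of_bool ({i, j} \<in> E))"
    if "i < reg s4 0" "j < reg s4 0" "same_arrs 0 (arr s4) A" for i j A
  proof -
    have A: "A 1 = arr s1 1" "A 4 = arr s4 4" using that(3) s4(5) by (simp_all add: same_arrs_def)
    have ij: "i < n" "j < n" using that s4(1) by simp_all
    have p: "hval posx ((reg s4)(10 := i, 11 := j)) A = P i j" by (rule posx[of s4 A i j, OF s4(1,3) A(1) ij])
    have a: "hval (HA 4 posx) ((reg s4)(10 := i, 11 := j)) A = of_bool ({i, j} \<in> E)" if K: "i \<in> ?K \<and> j \<in> ?K"
    proof -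
      have "arr s4 4 (P i j) = of_bool ({i, j} \<in> E)" using r4(3) ij K unfolding s3(1) by blast
      then show ?thesis unfolding hval.simps(3) p A(2) .
    qed
    show ?thesis
      unfolding both[of A i j s4, OF A(1) ij] p by (intro conjI impI refl) (erule a)
  qed
  have r5:
    "\<forall>x. x \<noteq> 10 \<and> x \<noteq> 11 \<longrightarrow> reg s5 x = reg s4 x"
    "\<forall>b. b \<noteq> 0 \<longrightarrow> arr s5 b = arr s4 b"
    "\<forall>i<reg s4 0. \<forall>j<reg s4 0. i \<in> ?K \<and> j \<in> ?K \<longrightarrow> arr s5 0 (P i j) = of_bool ({i, j} \<in> E)"
    unfolding s5_def
    subgoal by (rule hrun_scatter(1)[where G = "\<lambda>i j. i \<in> ?K \<and> j \<in> ?K" and P = P and X = "\<lambda>i j. of_bool ({i, j} \<in> E)"]; (rule e5 | rule inj); assumption)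
    subgoal by (rule hrun_scatter(2)[where G = "\<lambda>i j. i \<in> ?K \<and> j \<in> ?K" and P = P and X = "\<lambda>i j. of_bool ({i, j} \<in> E)"]; (rule e5 | rule inj); assumption)
    subgoal by (rule hrun_scatter(3)[where G = "\<lambda>i j. i \<in> ?K \<and> j \<in> ?K" and P = P and X = "\<lambda>i j. of_bool ({i, j} \<in> E)"]; (rule e5 | rule inj); assumption)
    done
  have s5: "reg s5 1 = k" "reg s5 2 = n'" "reg s5 6 = r" using r5(1) s4 by simp_all
  have "hval sizex (reg s5) (arr s5) = min (max 1 (k - r)) (n' + 1)"
    using s5 by (auto simp: sizex_def Let_def)
  moreover have "hrun (kernel_com fexp) s = set_reg 1 (hval sizex (reg s5) (arr s5)) s5"
    using v2 v6 unfolding kernel_com_def hrun.simps s1_def[symmetric]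
    by (simp only: s2_def[symmetric] s3_def[symmetric] s4_def[symmetric] s5_def[symmetric])
  ultimately have eq: "hrun (kernel_com fexp) s = set_reg 1 (min (max 1 (k - r)) (n' + 1)) s5" by simp
  show "reg (hrun (kernel_com fexp) s) 2 = n'" "reg (hrun (kernel_com fexp) s) 1 = min (max 1 (k - r)) (n' + 1)"
    unfolding eq using s5 by simp_all
  show "adjacency n' (kernel_edges n E) (arr (hrun (kernel_com fexp) s) 0)"
    unfolding adjacency_def
  proof (intro allI impI)
    fix i j assume ij: "i < n'" "j < n'"
    define u v where "u = kernel_embedding n E i" and "v = kernel_embedding n E j"
    have uv: "u \<in> ?K" "v \<in> ?K" "rank ?K u = i" "rank ?K v = j"
      using kernel_embedding(1)[of n E] kernel_embedding(3)[of i n E] kernel_embedding(3)[of j n E] ij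
      unfolding u_def v_def n'_def by blast+
    then have "arr s5 0 (P u v) = of_bool ({u, v} \<in> E)" using r5(3) s4(1) by simp
    then show "arr (hrun (kernel_com fexp) s) 0 (i * n' + j) = of_bool ({i, j} \<in> kernel_edges n E)"
      unfolding eq using uv(3,4) kernel_edges_iff[of i n E j] ij
      by (simp add: P_def u_def v_def n'_def)
  qed
qed

end


section \<open>Running times\<close>

lemma adjacency_input_state: "adjacency n E (arr (input_state n E k) 0)"
  using encodes_input_state[of n E k] by (simp add: encodes_def adjacency_def)

lemma input_state_regs: "reg (input_state n E k) 0 = n" "reg (input_state n E k) 1 = k"
  "x \<noteq> 0 \<Longrightarrow> x \<noteq> 1 \<Longrightarrow> reg (input_state n E k) x = 0"
  by (simp_all add: input_state_def)

text \<open>Register 1 is not among the loop bounds, which is why running times do not depend on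
  \<open>k\<close>.\<close>

lemma input_state_bounded: "\<forall>b\<in>bound_regs. reg (input_state n E k) b \<le> n"
  by (auto simp: input_state_def)

lemma real_poly_bounded_O:
  "(\<lambda>n. real (C * (n + 1) ^ d)) \<in> O(\<lambda>n. real n ^ d)"
proof (rule bigoI)
  show "\<forall>\<^sub>F n in at_top. norm (real (C * (n + 1) ^ d)) \<le> real (C * 2 ^ d) * norm (real n ^ d)"
  proof (rule eventually_at_top_linorderI[of 1])
    fix n :: nat assume "1 \<le> n"
    then have "(n + 1) ^ d \<le> (2 * n) ^ d" by (intro power_mono) auto
    then have "C * (n + 1) ^ d \<le> C * 2 ^ d * n ^ d" by (simp add: power_mult_distrib)
    then have "real (C * (n + 1) ^ d) \<le> real (C * 2 ^ d * n ^ d)" by (rule of_nat_mono)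
    then show "norm (real (C * (n + 1) ^ d)) \<le> real (C * 2 ^ d) * norm (real n ^ d)" by simp
  qed
qed

text \<open>From \<open>v + 1 \<le> 2 ^ v\<close> the left side is at most \<open>6 * 2 ^ v\<close>.
  Rounding 6 up to 8 leaves a plain power of 2.\<close>

lemma kept_set_card_le:
  assumes "simple_graph {..<n} E"
  shows "card (kept_set n E) + 1 \<le> 2 ^ (vc {..<n} E + 3)"
proof -
  let ?v = "vc {..<n} E"
  obtain X where X: "X \<subseteq> {..<n}" "card X = ?v" "independent_set E ({..<n} - X)"
    using vc_witness[of "{..<n}" E] by auto
  have "card (kept_set n E) \<le> ?v + 5 * 2 ^ ?v"
    using card_kept[OF _ X(1,3)] X(2) by simp
  moreover have "?v < 2 ^ ?v" by (rule less_exp)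
  moreover have "(2::nat) ^ (?v + 3) = 8 * 2 ^ ?v" by (simp add: power_add)
  ultimately show ?thesis by linarith
qed

context twin_problem
begin

lemma exec_kernel_prog:
  assumes G: "simple_graph {..<n} E" and k: "k \<ge> 1"
  shows "\<exists>t s n' E' k'. exec (kernel_prog fexp) (input_state n E k) t s \<and>
    t \<le> hcom_cost (kernel_com fexp) n + 2 \<and> encodes s n' E' k' \<and> valid_instance n' E' k' \<and>
    (problem {..<n'} E' k' \<longleftrightarrow> problem {..<n} E k) \<and>
    n' + 1 \<le> 2 ^ (vc {..<n} E + 3) \<and> k' \<le> n' + 1"
proof -
  define n' where "n' = card (kept_set n E)"
  define r where "r = card {v\<in>{..<n}. forced {..<n} E v \<and> \<not> kept {..<n} E v}"
  define k' where "k' = min (max 1 (k - r)) (n' + 1)"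
  define E' where "E' = kernel_edges n E"
  let ?s = "input_state n E k"
  note h = hrun_kernel_com[OF G input_state_regs(1)[of n E k] input_state_regs(2)[of n E k]
      adjacency_input_state[of n E k], folded n'_def r_def,
      folded k'_def E'_def]
  obtain t s where s: "exec (hcom_com 30 (kernel_com fexp)) ?s t s"
    "arr s = arr (hrun (kernel_com fexp) ?s)" "\<forall>x<30. reg s x = reg (hrun (kernel_com fexp) ?s) x"
    "t \<le> hcom_cost (kernel_com fexp) n"
    using exec_hrun[OF hcom_ok_programs(1)[OF fexp_ok gexp_ok] input_state_bounded] by blast
  have e: "exec (kernel_prog fexp) ?s (t + (acost (Reg 2) + 1)) (set_reg 0 n' s)"
    using exec.Seq[OF s(1) exec_SetReg[of 0 "Reg 2" s]] s(3) h(1) by (simp add: kernel_prog_def)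
  have red: "twin_reduction {..<n} E {..<n'} E' (kernel_embedding n E)"
    unfolding n'_def E'_def using G by (rule twin_reduction_kernel)
  have "encodes (set_reg 0 n' s) n' E' k'"
    unfolding encodes_def using h(2,3) s(2,3) by (simp add: adjacency_def)
  moreover have "valid_instance n' E' k'"
    using red by (simp add: valid_instance_def twin_reduction_def k'_def)
  moreover have "problem {..<n'} E' k' \<longleftrightarrow> problem {..<n} E k"
    using problem_kernel[OF red _ k] kernel_embedding(1)[of n E]
    unfolding k'_def r_def n'_def by simp
  moreover have "n' + 1 \<le> 2 ^ (vc {..<n} E + 3)" unfolding n'_def using G by (rule kept_set_card_le)
  moreover have "k' \<le> n' + 1" by (simp add: k'_def)
  ultimately show ?thesis using e s(4) by (intro exI[of _ "t + (acost (Reg 2) + 1)"] exI conjI) auto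
qed

lemma kernelizes:
  "\<exists>c f p K. f \<in> O(\<lambda>v. real v) \<and> polynomially_bounded p \<and>
     kernelizes_in_time c problem p (\<lambda>v. 2 powr f v) K"
proof -
  have "poly_bounded_nat (\<lambda>n. hcom_cost (kernel_com fexp) n + 2)"
    by (intro poly_bounded_intros poly_bounded_hcom_cost)
  then obtain C d where Cd: "\<And>n. hcom_cost (kernel_com fexp) n + 2 \<le> C * (n + 1) ^ d"
    unfolding poly_bounded_nat_def by blast
  have "(\<lambda>v. real (v + 3)) \<in> O(\<lambda>v. real v)"
    by (rule bigoI[of _ 4], rule eventually_at_top_linorderI[of 1]) simp
  moreover have "polynomially_bounded (\<lambda>n. real (C * (n + 1) ^ d))"
    unfolding polynomially_bounded_def using real_poly_bounded_O by blast
  moreover have "kernelizes_in_time (kernel_prog fexp) problem (\<lambda>n. real (C * (n + 1) ^ d))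
      (\<lambda>v. 2 powr real (v + 3)) (\<lambda>v. 2 ^ (v + 3))"
    unfolding kernelizes_in_time_def
  proof (intro allI impI)
    fix n E k assume "valid_instance n E k"
    then have "simple_graph {..<n} E" "k \<ge> 1" by (simp_all add: valid_instance_def)
    from exec_kernel_prog[OF this] obtain t s n' E' k' where
      *: "exec (kernel_prog fexp) (input_state n E k) t s"
      "t \<le> hcom_cost (kernel_com fexp) n + 2" "encodes s n' E' k'" "valid_instance n' E' k'"
      "problem {..<n'} E' k' \<longleftrightarrow> problem {..<n} E k" "n' + 1 \<le> 2 ^ (vc {..<n} E + 3)" "k' \<le> n' + 1"
      by blast
    have "real t \<le> real (C * (n + 1) ^ d)"
      using order_trans[OF *(2) Cd[of n]] by (rule of_nat_mono)
    moreover have "real n' \<le> 2 powr real (vc {..<n} E + 3)"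
    proof -
      have "n' \<le> 2 ^ (vc {..<n} E + 3)" using *(6) by simp
      then have "real n' \<le> real (2 ^ (vc {..<n} E + 3))" by (rule of_nat_mono)
      also have "\<dots> = 2 powr real (vc {..<n} E + 3)" by (subst powr_realpow) simp_all
      finally show ?thesis .
    qed
    moreover have "k' \<le> 2 ^ (vc {..<n} E + 3)" using *(6,7) by simp
    ultimately show "\<exists>t s n' E' k'. exec (kernel_prog fexp) (input_state n E k) t s \<and>
        real t \<le> real (C * (n + 1) ^ d) \<and> encodes s n' E' k' \<and> valid_instance n' E' k' \<and>
        (problem {..<n'} E' k' \<longleftrightarrow> problem {..<n} E k) \<and>
        real n' \<le> 2 powr real (vc {..<n} E + 3) \<and> k' \<le> 2 ^ (vc {..<n} E + 3)"
      using *(1,3,4,5) by blast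
  qed
  ultimately show ?thesis by blast
qed

section \<open>The search over the candidates and its running time\<close>

definition searching :: "nat \<Rightarrow> nat set set \<Rightarrow> nat \<Rightarrow> state \<Rightarrow> bool" where
  "searching n E k s \<longleftrightarrow> prepared n E s \<and> matrix n (ndist n E) (arr s 3) \<and>
     reg s 1 = k \<and> reg s 2 = card (kept_set n E) + 1"

lemma hrun_init_com:
  assumes G: "simple_graph {..<n} E" and s: "reg s 0 = n" "reg s 1 = k" "adjacency n E (arr s 0)"
  shows "searching n E k (hrun (init_com fexp) s)"
    and "x \<notin> {2, 10, 11, 12} \<Longrightarrow> reg (hrun (init_com fexp) s) x = reg s x"
proof -
  define s1 where "s1 = hrun (prep_com fexp) s"
  note p = hrun_prep_com[OF G s(1,3), folded s1_def]
  define s2 where "s2 = hrun dist_com s1"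
  have s1: "reg s1 0 = n" "adjacency n E (arr s1 0)" using p(1) by (simp_all add: prepared_def)
  note d = hrun_dist_com[OF s1, folded s2_def]
  have p2: "prepared n E s2" using p(1) d(1,2) by (simp add: prepared_def)
  have "hval (HSum 10 0 (HA 1 (HV 10))) (reg s2) (arr s2) = (\<Sum>j<n. of_bool (kept {..<n} E j))"
    unfolding hval.simps(7) using p2 by (intro sum.cong) (simp_all add: prepared_def)
  then have v: "hval (HPlus (HSum 10 0 (HA 1 (HV 10))) (HC 1)) (reg s2) (arr s2) = card (kept_set n E) + 1"
    by (simp only: sum_of_bool hval.simps(4,1))
  have eq: "hrun (init_com fexp) s = set_reg 2 (card (kept_set n E) + 1) s2"
    unfolding init_com_def hrun.simps s1_def[symmetric] s2_def[symmetric] v ..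
  show "searching n E k (hrun (init_com fexp) s)"
    unfolding eq using p2 d(3) d(1) p(2) s(2) by (simp add: searching_def prepared_def)
  show "reg (hrun (init_com fexp) s) x = reg s x" if "x \<notin> {2, 10, 11, 12}"
    unfolding eq using that d(1) p(2) by simp
qed

lemma hrun_try_com:
  assumes G: "simple_graph {..<n} E" and s: "searching n E k s"
  shows "searching n E k (hrun (try_com gexp) s)"
    and "reg (hrun (try_com gexp) s) 3 = reg s 3"
    and "reg (hrun (try_com gexp) s) 4 \<noteq> 0 \<longleftrightarrow> good {..<n} E (candidate {..<n} E (reg s 3))"
    and "\<forall>v<n. arr (hrun (try_com gexp) s) 6 v = of_bool (v \<in> candidate {..<n} E (reg s 3))"
proof -
  let ?K = "kept_set n E" and ?m = "reg s 3" and ?B = "card (kept_set n E) + 1"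
  have B: "reg s 2 = ?B" using s by (simp add: searching_def)
  define s1 where "s1 = hrun decode_com s"
  have "reg s 2 > 0" using B by simp
  note d = hrun_decode_com[OF this, folded s1_def, unfolded B]
  have s1: "searching n E k s1" "reg s1 3 = ?m"
    using s d(1,2) by (simp_all add: searching_def prepared_def)
  then have s1': "reg s1 0 = n" "\<forall>v<n. arr s1 1 v = of_bool (kept {..<n} E v)"
    "\<forall>v<n. arr s1 2 v = of_bool (forced {..<n} E v)"
    by (simp_all add: searching_def prepared_def)
  define s2 where "s2 = hrun (fill 6 candx) s1"
  have e: "hval candx ((reg s1)(10 := j)) A = of_bool (j \<in> candidate {..<n} E ?m)"
    if j: "j < reg s1 0" and A: "same_arrs 6 (arr s1) A" for j A
  proof -
    let ?\<rho> = "(reg s1)(10 := j)"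
    have jn: "j < n" using j s1'(1) by simp
    have A1: "A 1 = arr s1 1" "A 2 = arr s1 2" "A 5 = arr s1 5" using A by (simp_all add: same_arrs_def)
    have rk: "hval (rankx 10) (?\<rho>(12 := i)) A = rank ?K j" for i
      using hval_rankx[of n A E "?\<rho>(12 := i)" 10] jn A1(1) s1'(2) by simp
    have "hval (exx 12 3 (eqx (HA 5 (HV 12)) (HPlus (rankx 10) (HC 1)))) ?\<rho> A =
        of_bool (\<exists>i<?m. ?m div ?B ^ i mod ?B = rank ?K j + 1)"
      using d(3) s1(2) A1(3) rk by simp
    moreover have "j \<in> candidate {..<n} E ?m \<longleftrightarrow> forced {..<n} E j \<or>
        kept {..<n} E j \<and> (\<exists>i<?m. ?m div ?B ^ i mod ?B = rank ?K j + 1)"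
      unfolding candidate_def decode_bounded[of ?K ?m, simplified] using jn decode_bounded[of ?K ?m] by auto
    moreover have "hval (HA 1 (HV 10)) ?\<rho> A = of_bool (kept {..<n} E j)"
      "hval (HA 2 (HV 10)) ?\<rho> A = of_bool (forced {..<n} E j)"
      using A1(1,2) s1'(2,3) jn by simp_all
    ultimately show ?thesis unfolding candx_def hval_logic by simp
  qed
  have f: "\<forall>x. x \<noteq> 10 \<longrightarrow> reg s2 x = reg s1 x" "\<forall>b. b \<noteq> 6 \<longrightarrow> arr s2 b = arr s1 b"
    "\<forall>j<reg s1 0. arr s2 6 j = of_bool (j \<in> candidate {..<n} E ?m)"
    unfolding s2_def
    subgoal by (rule hrun_fill(1)[where X = "\<lambda>j. of_bool (j \<in> candidate {..<n} E ?m)"]; rule e; assumption)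
    subgoal by (rule hrun_fill(2)[where X = "\<lambda>j. of_bool (j \<in> candidate {..<n} E ?m)"]; rule e; assumption)
    subgoal by (rule hrun_fill(3)[where X = "\<lambda>j. of_bool (j \<in> candidate {..<n} E ?m)"]; rule e; assumption)
    done
  have s2: "searching n E k s2" "reg s2 3 = ?m"
    using s1 f(1,2) by (simp_all add: searching_def prepared_def)
  have sol: "\<forall>v<n. arr s2 6 v = of_bool (v \<in> candidate {..<n} E ?m)" using f(3) s1'(1) by simp
  have "candidate {..<n} E ?m \<subseteq> {..<n}" by (auto simp: candidate_def decode_def)
  then have g: "hval gexp (reg s2) (arr s2) \<noteq> 0 \<longleftrightarrow> good {..<n} E (candidate {..<n} E ?m)"
    using s2(1) sol by (intro hval_gexp[OF G]) (simp_all add: searching_def prepared_def)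
  have eq: "hrun (try_com gexp) s = set_reg 4 (hval gexp (reg s2) (arr s2)) s2"
    unfolding try_com_def hrun.simps s1_def[symmetric] s2_def[symmetric] ..
  show "searching n E k (hrun (try_com gexp) s)" "reg (hrun (try_com gexp) s) 3 = reg s 3"
    unfolding eq using s2 by (simp_all add: searching_def prepared_def)
  show "reg (hrun (try_com gexp) s) 4 \<noteq> 0 \<longleftrightarrow> good {..<n} E (candidate {..<n} E (reg s 3))"
    unfolding eq using g by simp
  show "\<forall>v<n. arr (hrun (try_com gexp) s) 6 v = of_bool (v \<in> candidate {..<n} E (reg s 3))"
    unfolding eq using sol by simp
qed

definition search_cost :: "nat \<Rightarrow> nat" where
  "search_cost N = hcom_cost (init_com fexp) N +
     ((N + 1) * (hcom_cost (try_com gexp) N + 4 + 3 + 1) + 3 + 1 + (hcom_cost answer_com N + 2))"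

text \<open>The loop makes \<open>m + 1\<close> rounds for the least good \<open>m\<close>, and
  \<open>m < M\<close> by \<open>candidate_bound\<close>. Hence register 3 never exceeds
  \<open>M\<close>, and \<open>n + M\<close> bounds all loop bounds throughout.\<close>

lemma exec_search_prog:
  assumes G: "simple_graph {..<n} E"
    and M: "M = (card (kept_set n E) + 1) ^ vc {..<n} E"
  shows "\<exists>t s. exec (search_prog fexp gexp) (input_state n E k) t s \<and>
    reg s 0 = of_bool (problem {..<n} E k) \<and> t \<le> search_cost (n + M)"
proof -
  define m where "m = (LEAST m. good {..<n} E (candidate {..<n} E m))"
  obtain m1 where m1: "m1 < M" "good {..<n} E (candidate {..<n} E m1)"
    using candidate_bound[OF G] M by blast
  have good: "good {..<n} E (candidate {..<n} E m)" unfolding m_def using m1(2) by (rule LeastI)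
  have least: "m \<le> m'" if "good {..<n} E (candidate {..<n} E m')" for m'
    unfolding m_def using that by (rule Least_le)
  have mM: "m < M" using least[OF m1(2)] m1(1) by simp
  let ?N = "n + M" and ?s = "input_state n E k"
  have b0: "\<forall>b\<in>bound_regs. reg ?s b \<le> ?N"
    using input_state_bounded[of n E k] by (meson trans_le_add1)
  note ok = hcom_ok_programs[OF fexp_ok gexp_ok]
  obtain t1 s1 where 1: "exec (hcom_com 30 (init_com fexp)) ?s t1 s1" "arr s1 = arr (hrun (init_com fexp) ?s)"
    "\<forall>x<30. reg s1 x = reg (hrun (init_com fexp) ?s) x" "\<forall>b\<in>bound_regs. reg s1 b \<le> ?N"
    "t1 \<le> hcom_cost (init_com fexp) ?N"
    using exec_hrun[OF ok(2) b0] by blast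
  note i = hrun_init_com[OF G input_state_regs(1)[of n E k] input_state_regs(2)[of n E k]
      adjacency_input_state[of n E k]]
  have s1: "searching n E k s1" "reg s1 3 = 0" "reg s1 4 = 0"
    using i 1(2,3) input_state_regs(3)[of 3 n E k] input_state_regs(3)[of 4 n E k]
    by (simp_all add: searching_def prepared_def)
  \<comment> \<open>After \<open>j\<close> rounds the candidate tested last is the one with number
    \<open>j - 1\<close>; before the first round register 4 is 0, which lets the loop start.\<close>
  define I where "I = (\<lambda>j s. searching n E k s \<and> (\<forall>b\<in>bound_regs. reg s b \<le> ?N) \<and> reg s 3 = j \<and>
    (j = 0 \<longrightarrow> reg s 4 = 0) \<and>
    (j > 0 \<longrightarrow> (reg s 4 \<noteq> 0 \<longleftrightarrow> good {..<n} E (candidate {..<n} E (j - 1))) \<and>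
       (\<forall>v<n. arr s 6 v = of_bool (v \<in> candidate {..<n} E (j - 1)))))"
  let ?b = "Eq (Reg 4) (Const 0)"
  let ?c = "Seq (hcom_com 30 (try_com gexp)) (SetReg 3 (Add (Reg 3) (Const 1)))"
  have "\<exists>t s'. exec (While ?b ?c) s1 t s' \<and> I (m + 1) s' \<and>
      t \<le> (m + 1) * ((hcom_cost (try_com gexp) ?N + 4) + bcost ?b + 1) + bcost ?b + 1"
  proof (rule while_rule)
    fix j and s :: state assume j: "j < m + 1" and I: "I j s"
    have b: "bval ?b s"
    proof (cases "j = 0")
      case False
      then have "\<not> good {..<n} E (candidate {..<n} E (j - 1))" using least[of "j - 1"] j by linarith
      then show ?thesis using I False by (simp add: I_def)
    qed (use I in \<open>simp add: I_def\<close>)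
    have bd: "\<forall>b\<in>bound_regs. reg s b \<le> ?N" using I unfolding I_def by (elim conjE)
    have sr: "searching n E k s" using I unfolding I_def by (elim conjE)
    have j3: "reg s 3 = j" using I unfolding I_def by (elim conjE)
    obtain t s' where 2: "exec (hcom_com 30 (try_com gexp)) s t s'" "arr s' = arr (hrun (try_com gexp) s)"
      "\<forall>x<30. reg s' x = reg (hrun (try_com gexp) s) x" "\<forall>b\<in>bound_regs. reg s' b \<le> ?N"
      "t \<le> hcom_cost (try_com gexp) ?N"
      using exec_hrun[OF ok(3) bd] by blast
    note h = hrun_try_com[OF G sr, unfolded j3]
    have r3: "reg s' 3 = j" using 2(3) h(2) by simp
    have e: "exec ?c s (t + (acost (Add (Reg 3) (Const 1)) + 1)) (set_reg 3 (j + 1) s')"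
      using exec.Seq[OF 2(1) exec_SetReg[of 3 "Add (Reg 3) (Const 1)" s']] r3 by simp
    have "searching n E k s'" using h(1) 2(2,3) by (simp add: searching_def prepared_def)
    then have a: "searching n E k (set_reg 3 (j + 1) s')" by (simp add: searching_def prepared_def)
    have bd': "\<forall>b\<in>bound_regs. reg (set_reg 3 (j + 1) s') b \<le> ?N"
    proof
      fix b :: nat assume "b \<in> bound_regs"
      then have "reg s' b \<le> ?N" by (rule bspec[OF 2(4)])
      then show "reg (set_reg 3 (j + 1) s') b \<le> ?N" using j mM by simp
    qed
    have "reg s' 4 = reg (hrun (try_com gexp) s) 4" using 2(3) by simp
    then have g: "reg (set_reg 3 (j + 1) s') 4 \<noteq> 0 \<longleftrightarrow> good {..<n} E (candidate {..<n} E j)"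
      using h(3) by simp
    have sol: "\<forall>v<n. arr (set_reg 3 (j + 1) s') 6 v = of_bool (v \<in> candidate {..<n} E j)"
      using h(4) unfolding 2(2)[symmetric] by simp
    have "reg (set_reg 3 (j + 1) s') 3 = Suc j" by simp
    then have "I (Suc j) (set_reg 3 (j + 1) s')"
      unfolding I_def diff_Suc_1 using a bd' g sol by (intro conjI impI) simp_all
    with b e 2(5) show "bval ?b s \<and> (\<exists>t s'. exec ?c s t s' \<and> I (Suc j) s' \<and> t \<le> hcom_cost (try_com gexp) ?N + 4)"
      by (intro conjI exI[of _ "t + (acost (Add (Reg 3) (Const 1)) + 1)"] exI[of _ "set_reg 3 (j + 1) s'"]) auto
  next
    fix s assume "I (m + 1) s"
    then show "\<not> bval ?b s" using good by (simp add: I_def)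
  next
    show "I 0 s1" using s1 1(4) by (simp add: I_def)
  qed
  then obtain t2 s2 where 2: "exec (While ?b ?c) s1 t2 s2" "I (m + 1) s2"
    "t2 \<le> (m + 1) * ((hcom_cost (try_com gexp) ?N + 4) + bcost ?b + 1) + bcost ?b + 1" by blast
  have bd2: "\<forall>b\<in>bound_regs. reg s2 b \<le> ?N" using 2(2) unfolding I_def by (elim conjE)
  have r1: "reg s2 1 = k" and n2: "reg s2 0 = n"
    and sol: "\<forall>v<n. arr s2 6 v = of_bool (v \<in> candidate {..<n} E m)"
    using 2(2) by (simp_all add: I_def searching_def prepared_def)
  obtain t3 s3 where 3: "exec (hcom_com 30 answer_com) s2 t3 s3"
    "\<forall>x<30. reg s3 x = reg (hrun answer_com s2) x" "t3 \<le> hcom_cost answer_com ?N"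
    using exec_hrun[OF ok(4) bd2] by blast
  have "hval (HSum 10 0 (HA 6 (HV 10))) (reg s2) (arr s2) = (\<Sum>j<n. of_bool (j \<in> candidate {..<n} E m))"
    unfolding hval.simps(7) n2 using sol by (intro sum.cong) simp_all
  also have "\<dots> = card {j\<in>{..<n}. j \<in> candidate {..<n} E m}" by (rule sum_of_bool)
  also have "{j\<in>{..<n}. j \<in> candidate {..<n} E m} = candidate {..<n} E m"
    by (auto simp: candidate_def decode_def)
  finally have cnt: "hval (HSum 10 0 (HA 6 (HV 10))) (reg s2) (arr s2) = card (candidate {..<n} E m)" .
  have "hval (notx (lessx (HV 1) (HSum 10 0 (HA 6 (HV 10))))) (reg s2) (arr s2) = of_bool (problem {..<n} E k)"
    using problem_iff_least_candidate[OF G good least, of k] unfolding hval_logic cnt hval.simps(2) r1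
    by (simp add: not_less)
  then have ans: "reg s3 7 = of_bool (problem {..<n} E k)" using 3(2) by (simp add: answer_com_def)
  have e: "exec (search_prog fexp gexp) ?s (t1 + (t2 + (t3 + (acost (Reg 7) + 1)))) (set_reg 0 (reg s3 7) s3)"
    unfolding search_prog_def
    using exec.Seq[OF 1(1) exec.Seq[OF 2(1) exec.Seq[OF 3(1) exec_SetReg[of 0 "Reg 7" s3]]]] by simp
  have bc: "bcost ?b = 3" by simp
  have "(m + 1) * (hcom_cost (try_com gexp) ?N + 4 + 3 + 1) \<le>
      (?N + 1) * (hcom_cost (try_com gexp) ?N + 4 + 3 + 1)"
    using mM by (intro mult_le_mono1) simp
  then have "t1 + (t2 + (t3 + (acost (Reg 7) + 1))) \<le> search_cost ?N"
    using 1(5) 2(3) 3(3) unfolding search_cost_def acost.simps bc by linarith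
  with e ans show ?thesis
    by (intro exI[of _ "t1 + (t2 + (t3 + (acost (Reg 7) + 1)))"] exI[of _ "set_reg 0 (reg s3 7) s3"]) simp
qed

lemma decides:
  "\<exists>c f p. f \<in> O(\<lambda>v. real v ^ 2) \<and> polynomially_bounded p \<and>
     decides_in_time c problem (\<lambda>n v. 2 powr f v * p n)"
proof -
  have "poly_bounded_nat search_cost"
    unfolding search_cost_def by (intro poly_bounded_intros poly_bounded_hcom_cost)
  then obtain C d where Cd: "\<And>N. search_cost N \<le> C * (N + 1) ^ d"
    unfolding poly_bounded_nat_def by blast
  \<comment> \<open>\<open>(v + 3) * v\<close> is the exponent bounding \<open>M\<close>, the 1
    absorbs passing to \<open>M + 1\<close>, and \<open>d\<close> is the degree of the cost
    polynomial.\<close>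
  define f where "f = (\<lambda>v. d * ((v + 3) * v + 1))"
  have "(\<lambda>v. real (f v)) \<in> O(\<lambda>v. real v ^ 2)"
  proof (rule bigoI[of _ "real (5 * d)"], rule eventually_at_top_linorderI[of 1])
    fix v :: nat assume v: "1 \<le> v"
    have "(v + 3) * v + 1 \<le> 5 * v ^ 2"
    proof -
      have "v \<le> v * v" "1 \<le> v * v" using v by simp_all
      moreover have "(v + 3) * v + 1 = v * v + 3 * v + 1" by (simp add: algebra_simps)
      ultimately have "(v + 3) * v + 1 \<le> 5 * (v * v)" by linarith
      then show ?thesis by (simp only: power2_eq_square)
    qed
    then have "d * ((v + 3) * v + 1) \<le> d * (5 * v ^ 2)" by (rule mult_le_mono2)
    then have "f v \<le> 5 * d * v ^ 2" unfolding f_def by (simp only: mult_ac)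
    then have "real (f v) \<le> real (5 * d * v ^ 2)" by (rule of_nat_mono)
    then show "norm (real (f v)) \<le> real (5 * d) * norm (real v ^ 2)" by simp
  qed
  moreover have "polynomially_bounded (\<lambda>n. real (C * (n + 1) ^ d))"
    unfolding polynomially_bounded_def using real_poly_bounded_O by blast
  moreover have "decides_in_time (search_prog fexp gexp) problem
      (\<lambda>n v. 2 powr real (f v) * real (C * (n + 1) ^ d))"
    unfolding decides_in_time_def
  proof (intro allI impI)
    fix n E k assume "valid_instance n E k"
    then have G: "simple_graph {..<n} E" by (simp add: valid_instance_def)
    define v where "v = vc {..<n} E"
    define M where "M = (card (kept_set n E) + 1) ^ v"
    obtain t s where ts: "exec (search_prog fexp gexp) (input_state n E k) t s"
      "reg s 0 = of_bool (problem {..<n} E k)" "t \<le> search_cost (n + M)"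
      using exec_search_prog[OF G, of M k] by (auto simp: M_def v_def)
    have "M \<le> (2 ^ (v + 3)) ^ v"
      unfolding M_def v_def using kept_set_card_le[OF G] by (rule power_mono) simp
    also have "\<dots> = 2 ^ ((v + 3) * v)" by (simp only: power_mult)
    finally have "M \<le> 2 ^ ((v + 3) * v)" .
    moreover have "(1::nat) \<le> 2 ^ ((v + 3) * v)" by (rule one_le_power) simp
    ultimately have "M + 1 \<le> 2 ^ ((v + 3) * v + 1)" unfolding power_add power_one_right by linarith
    \<comment> \<open>Turning the sum into a product separates the factor depending on the vertex
      cover number from the one depending on \<open>n\<close>.\<close>
    have "n + M + 1 \<le> (n + 1) * (M + 1)" by simp
    also have "\<dots> \<le> (n + 1) * 2 ^ ((v + 3) * v + 1)"
      using \<open>M + 1 \<le> 2 ^ ((v + 3) * v + 1)\<close> by (rule mult_le_mono2)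
    finally have "(n + M + 1) ^ d \<le> ((n + 1) * 2 ^ ((v + 3) * v + 1)) ^ d" by (rule power_mono) simp
    also have "\<dots> = 2 ^ f v * (n + 1) ^ d"
      by (simp only: f_def power_mult_distrib power_mult[symmetric] mult.commute[of "(n + 1) ^ d"]
          mult.commute[of d])
    finally have "C * (n + M + 1) ^ d \<le> C * (2 ^ f v * (n + 1) ^ d)" by (rule mult_le_mono2)
    with ts(3) Cd[of "n + M"] have "t \<le> C * (2 ^ f v * (n + 1) ^ d)" by linarith
    then have "t \<le> 2 ^ f v * (C * (n + 1) ^ d)" by (simp only: mult.left_commute)
    then have "real t \<le> real (2 ^ f v * (C * (n + 1) ^ d))" by (rule of_nat_mono)
    also have "\<dots> = 2 powr real (f v) * real (C * (n + 1) ^ d)" by (simp add: powr_realpow)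
    finally show "\<exists>t s. exec (search_prog fexp gexp) (input_state n E k) t s \<and>
        reg s 0 = of_bool (problem {..<n} E k) \<and>
        real t \<le> 2 powr real (f (vc {..<n} E)) * real (C * (n + 1) ^ d)"
      using ts(1,2) unfolding v_def by blast
  qed
  ultimately show ?thesis by blast
qed

end


section \<open>The two problems\<close>

text \<open>For metric dimension every deleted vertex is thus forced, and confinement to forced and
  kept vertices is automatic.\<close>

lemma not_kept_repeated:
  assumes "\<not> kept V E v"
  shows "repeated V E v"
proof -
  have "{u\<in>V. u < v \<and> twins V E u v} \<noteq> {}"
  proof
    assume *: "{u\<in>V. u < v \<and> twins V E u v} = {}"
    show False using assms unfolding kept_def * by simp
  qed
  then show ?thesis unfolding repeated_def by blast
qed

definition repeatedx :: hexp where
  "repeatedx = exx 11 10 (twinx 11 10)"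

definition resolvingx :: hexp where
  "resolvingx = allx 11 0 (allx 12 0 (orx (eqx (HV 11) (HV 12))
     (exx 13 0 (andx (HA 6 (HV 13)) (notx (eqx (HA 3 (idx 13 11)) (HA 3 (idx 13 12))))))))"

definition simplicialx :: hexp where
  "simplicialx = allx 11 0 (allx 12 0 (orx (notx (andx (adjx 10 11) (adjx 10 12)))
     (orx (eqx (HV 11) (HV 12)) (adjx 11 12))))"

definition geodeticx :: hexp where
  "geodeticx = allx 11 0 (exx 12 0 (exx 13 0 (andx (andx (HA 6 (HV 12)) (HA 6 (HV 13)))
     (andx (eqx (HPlus (HA 3 (idx 12 11)) (HA 3 (idx 11 13))) (HA 3 (idx 12 13)))
           (lessx (HA 3 (idx 12 13)) (HV 0))))))"

lemma hval_repeatedx: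
  assumes "adjacency n E (A 0)" "\<rho> 0 = n" "\<rho> 10 < n"
  shows "hval repeatedx \<rho> A \<noteq> 0 \<longleftrightarrow> repeated {..<n} E (\<rho> 10)"
proof -
  have "hval (twinx 11 10) (\<rho>(11 := j)) A = of_bool (twins {..<n} E j (\<rho> 10))" if "j < \<rho> 10" for j
    using hval_twinx[of n E A "\<rho>(11 := j)" 11 10] assms that by simp
  then have "hval repeatedx \<rho> A = of_bool (\<exists>j<\<rho> 10. twins {..<n} E j (\<rho> 10))"
    unfolding repeatedx_def hval_logic by (intro arg_cong[of _ _ of_bool] ex_cong1 conj_cong refl) simp
  also have "(\<exists>j<\<rho> 10. twins {..<n} E j (\<rho> 10)) \<longleftrightarrow> repeated {..<n} E (\<rho> 10)"
    unfolding repeated_def using assms(3) by fastforce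
  finally show ?thesis by simp
qed

lemma hval_resolvingx:
  assumes "matrix n (ndist n E) (A 3)" "\<rho> 0 = n" "S \<subseteq> {..<n}" "\<And>v. v < n \<Longrightarrow> A 6 v \<noteq> 0 \<longleftrightarrow> v \<in> S"
  shows "hval resolvingx \<rho> A \<noteq> 0 \<longleftrightarrow> resolving_set {..<n} E S"
proof -
  have d: "A 3 (u * n + v) = ndist n E u v" if "u < n" "v < n" for u v
    using assms(1) that by (simp add: matrix_def)
  have "hval resolvingx \<rho> A \<noteq> 0 \<longleftrightarrow> (\<forall>u<n. \<forall>v<n. u = v \<or>
      (\<exists>w<n. A 6 w \<noteq> 0 \<and> A 3 (w * n + u) \<noteq> A 3 (w * n + v)))"
    using assms(2) by (simp add: resolvingx_def)
  also have "\<dots> \<longleftrightarrow> (\<forall>u<n. \<forall>v<n. u = v \<or> (\<exists>w<n. w \<in> S \<and> ndist n E w u \<noteq> ndist n E w v))"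
    using d assms(4) by (intro all_cong1 imp_cong disj_cong ex_cong1 conj_cong refl) simp_all
  also have "\<dots> \<longleftrightarrow> resolving_set {..<n} E S"
    unfolding resolving_set_def ndist_eq_iff using assms(3) by (auto; meson lessThan_iff subsetD)
  finally show ?thesis .
qed

lemma hval_simplicialx:
  assumes "adjacency n E (A 0)" "\<rho> 0 = n" "\<rho> 10 < n"
  shows "hval simplicialx \<rho> A \<noteq> 0 \<longleftrightarrow> simplicial {..<n} E (\<rho> 10)"
proof -
  have a: "hval (adjx u v) (\<rho>(11 := a, 12 := b)) A = of_bool ({(\<rho>(11 := a, 12 := b)) u, (\<rho>(11 := a, 12 := b)) v} \<in> E)"
    if "a < n" "b < n" "u \<in> {10, 11, 12}" "v \<in> {10, 11, 12}" for a b u v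
    using that assms by (intro hval_adjx) auto
  have "hval simplicialx \<rho> A \<noteq> 0 \<longleftrightarrow>
      (\<forall>a<n. \<forall>b<n. \<not> ({\<rho> 10, a} \<in> E \<and> {\<rho> 10, b} \<in> E) \<or> a = b \<or> {a, b} \<in> E)"
    unfolding simplicialx_def hval_logic using assms(2) a
    by (simp cong: all_cong) blast
  also have "\<dots> \<longleftrightarrow> simplicial {..<n} E (\<rho> 10)"
    unfolding simplicial_def by auto
  finally show ?thesis .
qed

lemma hval_geodeticx:
  assumes "matrix n (ndist n E) (A 3)" "\<rho> 0 = n" "S \<subseteq> {..<n}" "\<And>v. v < n \<Longrightarrow> A 6 v \<noteq> 0 \<longleftrightarrow> v \<in> S"
  shows "hval geodeticx \<rho> A \<noteq> 0 \<longleftrightarrow> geodetic_set {..<n} E S"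
proof -
  have d: "A 3 (u * n + v) = ndist n E u v" if "u < n" "v < n" for u v
    using assms(1) that by (simp add: matrix_def)
  have "hval geodeticx \<rho> A \<noteq> 0 \<longleftrightarrow> (\<forall>u<n. \<exists>s<n. \<exists>t<n. (A 6 s \<noteq> 0 \<and> A 6 t \<noteq> 0) \<and>
      A 3 (s * n + u) + A 3 (u * n + t) = A 3 (s * n + t) \<and> A 3 (s * n + t) < n)"
    using assms(2) by (simp add: geodeticx_def) blast
  also have "\<dots> \<longleftrightarrow> (\<forall>u<n. \<exists>s<n. \<exists>t<n. (s \<in> S \<and> t \<in> S) \<and> covers {..<n} E s t u)"
    using d assms(4) unfolding covers_ndist_iff
    by (intro all_cong1 imp_cong ex_cong1 conj_cong refl) simp_all
  also have "\<dots> \<longleftrightarrow> geodetic_set {..<n} E S"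
    unfolding geodetic_set_iff using assms(3) by (auto; meson lessThan_iff subsetD)
  finally show ?thesis .
qed

interpretation metric_dimension: twin_problem resolving_set repeated repeatedx resolvingx
proof
  show "S \<subseteq> V" if "resolving_set V E S" for V E S
    using that by (simp add: resolving_set_def)
next
  fix V :: "nat set" and E S assume G: "simple_graph V E" and S: "resolving_set V E S"
  have "finite V" using G by (simp add: simple_graph_def)
  then obtain S' where S': "resolving_set V E S'" "card S' = card S" "{v\<in>V. repeated V E v} \<subseteq> S'"
    using resolving_set_normal_form[OF _ S] by blast
  have "S' \<subseteq> V" using S'(1) by (simp add: resolving_set_def)
  then have "S' \<subseteq> {v\<in>V. repeated V E v \<or> kept V E v}" using not_kept_repeated by blast
  with S' show "\<exists>S'. resolving_set V E S' \<and> card S' \<le> card S \<and> {v\<in>V. repeated V E v} \<subseteq> S' \<and>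
      S' \<subseteq> {v\<in>V. repeated V E v \<or> kept V E v}" by (intro exI[of _ S']) simp
next
  show "resolving_set V E ({v\<in>V. repeated V E v} \<union> X)"
    if "simple_graph V E" "X \<subseteq> V" "independent_set E (V - X)" for V E X
    using that by (rule resolving_set_vertex_cover)
next
  fix V V' :: "nat set" and E E' \<iota> S
  assume red: "twin_reduction V E V' E' \<iota>" and im: "\<iota> ` V' = {v\<in>V. kept V E v}"
  interpret twin_reduction V E V' E' \<iota> by (rule red)
  have removed: "{v\<in>V. repeated V E v \<and> \<not> kept V E v} = V - \<iota> ` V'"
    unfolding im using not_kept_repeated by blast
  show "resolving_set V' E' {i\<in>V'. \<iota> i \<in> S}"
    if "resolving_set V E S" "{v\<in>V. repeated V E v} \<subseteq> S"
    using that(1) by (rule resolving_set_restrict) (use removed that(2) in blast)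
  show "\<exists>S'. card S' \<le> card S \<and> finite S' \<and>
      resolving_set V E (\<iota> ` S' \<union> {v\<in>V. repeated V E v \<and> \<not> kept V E v})"
    if S: "resolving_set V' E' S"
  proof (intro exI conjI)
    show "card S \<le> card S" ..
    have "S \<subseteq> V'" using S by (simp add: resolving_set_def)
    then show "finite S" using fin(2) by (rule finite_subset)
    show "resolving_set V E (\<iota> ` S \<union> {v\<in>V. repeated V E v \<and> \<not> kept V E v})"
      unfolding removed using S by (rule resolving_set_extend)
  qed
  show "2 \<le> card S" if "resolving_set V' E' S" "{v\<in>V. repeated V E v \<and> \<not> kept V E v} \<noteq> {}"
    using that unfolding removed by (rule resolving_set_card_ge_2)
next
  show "hexp_ok 30 bound_regs repeatedx" "hexp_ok 30 bound_regs resolvingx"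
    by (simp_all add: repeatedx_def resolvingx_def)
  show "hval repeatedx \<rho> A \<noteq> 0 \<longleftrightarrow> repeated {..<n} E (\<rho> 10)"
    if "simple_graph {..<n} E" "adjacency n E (A 0)" "\<rho> 0 = n" "\<rho> 10 < n" for n E A \<rho>
    using that(2-4) by (rule hval_repeatedx)
  show "hval resolvingx \<rho> A \<noteq> 0 \<longleftrightarrow> resolving_set {..<n} E S"
    if "simple_graph {..<n} E" "matrix n (ndist n E) (A 3)" "\<rho> 0 = n" "S \<subseteq> {..<n}"
      "\<And>v. v < n \<Longrightarrow> A 6 v \<noteq> 0 \<longleftrightarrow> v \<in> S" for n E A \<rho> S
    using that(2-5) by (rule hval_resolvingx)
qed

interpretation geodetic: twin_problem geodetic_set simplicial simplicialx geodeticx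
proof
  show "S \<subseteq> V" if "geodetic_set V E S" for V E S
    using that by (simp add: geodetic_set_def)
next
  fix V :: "nat set" and E S assume "simple_graph V E" "geodetic_set V E S"
  from geodetic_set_normal_form[OF this]
  show "\<exists>S'. geodetic_set V E S' \<and> card S' \<le> card S \<and> {v\<in>V. simplicial V E v} \<subseteq> S' \<and>
      S' \<subseteq> {v\<in>V. simplicial V E v \<or> kept V E v}" by blast
next
  show "geodetic_set V E ({v\<in>V. simplicial V E v} \<union> X)"
    if "simple_graph V E" "X \<subseteq> V" "independent_set E (V - X)" for V E and X :: "nat set"
    using that by (rule geodetic_set_vertex_cover)
next
  fix V V' :: "nat set" and E E' \<iota> S
  assume red: "twin_reduction V E V' E' \<iota>" and im: "\<iota> ` V' = {v\<in>V. kept V E v}"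
  interpret twin_reduction V E V' E' \<iota> by (rule red)
  have removed: "{v\<in>V. simplicial V E v \<and> \<not> kept V E v} = {v\<in>V - \<iota> ` V'. simplicial V E v}"
    unfolding im by blast
  show "geodetic_set V' E' {i\<in>V'. \<iota> i \<in> S}"
    if "geodetic_set V E S" "S \<subseteq> {v\<in>V. simplicial V E v \<or> kept V E v}"
    using that(1) by (rule geodetic_set_restrict) (use that(2) in \<open>unfold im, blast\<close>)
  show "\<exists>S'. card S' \<le> card S \<and> finite S' \<and>
      geodetic_set V E (\<iota> ` S' \<union> {v\<in>V. simplicial V E v \<and> \<not> kept V E v})"
    if S: "geodetic_set V' E' S"
  proof -
    \<comment> \<open>An arbitrary solution of the kernel may contain whole classes, so it is made
      nonredundant before it is extended.\<close>
    obtain S' where S': "geodetic_set V' E' S'" "card S' \<le> card S" "nonredundant V' E' S'"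
      using geodetic_set_normal_form[OF graph' S] by blast
    have "S' \<subseteq> V'" using S'(1) by (simp add: geodetic_set_def)
    then have "finite S'" using fin(2) by (rule finite_subset)
    moreover have "geodetic_set V E (\<iota> ` S' \<union> {v\<in>V. simplicial V E v \<and> \<not> kept V E v})"
      unfolding removed using S'(1,3) by (rule geodetic_set_extend)
    ultimately show ?thesis using S'(2) by blast
  qed
  show "2 \<le> card S" if "geodetic_set V' E' S" "{v\<in>V. simplicial V E v \<and> \<not> kept V E v} \<noteq> {}"
    using that unfolding removed by (rule geodetic_set_card_ge_2)
next
  show "hexp_ok 30 bound_regs simplicialx" "hexp_ok 30 bound_regs geodeticx"
    by (simp_all add: simplicialx_def geodeticx_def)
  show "hval simplicialx \<rho> A \<noteq> 0 \<longleftrightarrow> simplicial {..<n} E (\<rho> 10)"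
    if "simple_graph {..<n} E" "adjacency n E (A 0)" "\<rho> 0 = n" "\<rho> 10 < n" for n E A \<rho>
    using that(2-4) by (rule hval_simplicialx)
  show "hval geodeticx \<rho> A \<noteq> 0 \<longleftrightarrow> geodetic_set {..<n} E S"
    if "simple_graph {..<n} E" "matrix n (ndist n E) (A 3)" "\<rho> 0 = n" "S \<subseteq> {..<n}"
      "\<And>v. v < n \<Longrightarrow> A 6 v \<noteq> 0 \<longleftrightarrow> v \<in> S" for n E A \<rho> S
    using that(2-5) by (rule hval_geodeticx)
qed

theorem theorem1:
  "\<forall>P \<in> {METRIC_DIMENSION, GEODETIC_SET}.
     (\<exists>c f p. f \<in> O(\<lambda>v. real v ^ 2) \<and> polynomially_bounded p \<and>
        decides_in_time c P (\<lambda>n v. 2 powr f v * p n)) \<and>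
     (\<exists>c f p K. f \<in> O(\<lambda>v. real v) \<and> polynomially_bounded p \<and>
        kernelizes_in_time c P p (\<lambda>v. 2 powr f v) K)"
proof -
  have "METRIC_DIMENSION = metric_dimension.problem"
    by (intro ext) (simp add: METRIC_DIMENSION_def metric_dimension.problem_def)
  moreover have "GEODETIC_SET = geodetic.problem"
    by (intro ext) (simp add: GEODETIC_SET_def geodetic.problem_def)
  ultimately show ?thesis
    using metric_dimension.decides metric_dimension.kernelizes geodetic.decides geodetic.kernelizes
    by simp
qed


end
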